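(* Let $\mathcal{S}^0=(\mathbb{C}\times\mathbb{H})/G_A$ be an Inoue surface of type $\mathcal{S}^0$ and let $\theta$ be the closed one-form on $\mathcal{S}^0$ induced by $\frac{dw_2}{w_2}$, $w_2=\operatorname{Im} w$ (the Lee form of Tricerri's metric). Then $$H^1_\theta(\mathcal{S}^0)=0,\qquad H^2_\theta(\mathcal{S}^0)\simeq\mathbb{R},\qquad H^3_\theta(\mathcal{S}^0)\simeq\mathbb{R}.$$
   Context: Morse-Novikov cohomology: for a closed real one-form $\eta$ on a smooth manifold $M$, put $d_\eta=d-\eta\wedge\cdot$ on smooth real forms $\Omega^\bullet(M)$; then $d_\eta^2=0$ and $H^\bullet_\eta(M)$ denotes the cohomology of $(\Omega^\bullet(M),d_\eta)$. Inoue surface $\mathcal{S}^0$: let $A\in \mathrm{SL}_3(\mathbb{Z})$ have one real eigenvalue $\alpha>1$ and two complex (non-real) eigenvalues $\beta,\bar\beta$. Let $(a_1,a_2,a_3)^t$ be a real eigenvector for $\alpha$ and $(b_1,b_2,b_3)^t$ a complex eigenvector for $\beta$. Let $\mathbb{H}$ be the upper half-plane and $G_A$ the group of transformations of $\mathbb{C}\times\mathbb{H}$ (coordinates $(z,w)$) generated by $(z,w)\mapsto(\beta z,\alpha w)$ and $(z,w)\mapsto(z+b_i,w+a_i)$, $i=1,2,3$. Then $\mathcal{S}^0=(\mathbb{C}\times\mathbb{H})/G_A$, a compact complex surface. The one-form $\frac{dw_2}{w_2}$ is $G_A$-invariant and so descends to $\mathcal{S}^0$. *)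

theory Defs
  imports "HOL-Analysis.Analysis" "HOL-Algebra.Group_Action" "HOL-Algebra.Generated_Groups"
begin

section \<open>Differential forms on open subsets of a Euclidean space\<close>

primrec times_differentiable_on ::
  "nat \<Rightarrow> 'e::euclidean_space set \<Rightarrow> ('e \<Rightarrow> real) \<Rightarrow> bool" where
  "times_differentiable_on 0 S f \<longleftrightarrow> continuous_on S f"
| "times_differentiable_on (Suc n) S f \<longleftrightarrow>
     (\<forall>x\<in>S. f differentiable (at x)) \<and>
     (\<forall>v. times_differentiable_on n S (\<lambda>x. frechet_derivative f (at x) v))"

definition smooth_fun_on :: "'e::euclidean_space set \<Rightarrow> ('e \<Rightarrow> real) \<Rightarrow> bool" where
  "smooth_fun_on S f \<longleftrightarrow> (\<forall>n. times_differentiable_on n S f)"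

text \<open>The value of a \<open>k\<close>-form \<open>\<omega>\<close> at the point \<open>x\<close> on the tangent vectors \<open>v\<^sub>1, \<dots>, v\<^sub>k\<close> is
  \<open>\<omega> x [v\<^sub>1, \<dots>, v\<^sub>k]\<close>.  Off the domain, and on lists of any other length, a form takes the value
  \<open>0\<close>, so that equality of forms is equality of functions.\<close>

type_synonym 'e form = "'e \<Rightarrow> 'e list \<Rightarrow> real"

definition alternating_multilinear :: "nat \<Rightarrow> ('e::real_vector list \<Rightarrow> real) \<Rightarrow> bool" where
  "alternating_multilinear k f \<longleftrightarrow>
     (\<forall>vs. length vs = k \<longrightarrow> (\<forall>i<k. linear (\<lambda>v. f (vs[i := v])))) \<and>
     (\<forall>vs. length vs = k \<longrightarrow> (\<forall>i<k. \<forall>j<k. i \<noteq> j \<and> vs ! i = vs ! j \<longrightarrow> f vs = 0))"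

definition form_on :: "nat \<Rightarrow> 'e::euclidean_space set \<Rightarrow> 'e form \<Rightarrow> bool" where
  "form_on k S \<omega> \<longleftrightarrow>
     (\<forall>x\<in>S. alternating_multilinear k (\<omega> x)) \<and>
     (\<forall>vs. smooth_fun_on S (\<lambda>x. \<omega> x vs)) \<and>
     (\<forall>x vs. x \<notin> S \<or> length vs \<noteq> k \<longrightarrow> \<omega> x vs = 0)"

definition omit :: "nat \<Rightarrow> 'a list \<Rightarrow> 'a list" where
  "omit i vs = take i vs @ drop (Suc i) vs"

definition ext_deriv :: "'e::euclidean_space set \<Rightarrow> 'e form \<Rightarrow> 'e form" where
  "ext_deriv S \<omega> x vs =
     (if x \<in> S
      then \<Sum>i<length vs. (-1) ^ i * frechet_derivative (\<lambda>y. \<omega> y (omit i vs)) (at x) (vs ! i)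
      else 0)"

text \<open>The wedge product \<open>\<eta> \<and> \<omega>\<close> for a one-form \<open>\<eta>\<close> (without factorials, matching the
  normalisation of \<open>ext_deriv\<close>).\<close>

definition wedge_one :: "'e form \<Rightarrow> 'e form \<Rightarrow> 'e form" where
  "wedge_one \<eta> \<omega> x vs = (\<Sum>i<length vs. (-1) ^ i * \<eta> x [vs ! i] * \<omega> x (omit i vs))"

section \<open>Differential forms on a manifold\<close>

text \<open>A chart is given by its domain and its coordinate map (whose values off the domain are
  irrelevant).  A form on a manifold with a given atlas is a family of local expressions, one for
  each chart of the atlas, related by pull-back along the transition maps.  The differential and
  the wedge product act on local expressions.\<close>

type_synonym ('m, 'e) chart = "'m set \<times> ('m \<Rightarrow> 'e)"
type_synonym ('m, 'e) mform = "('m, 'e) chart \<Rightarrow> 'e form"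

definition chart_image :: "('m, 'e) chart \<Rightarrow> 'e set" where
  "chart_image c = snd c ` fst c"

definition transition :: "('m, 'e) chart \<Rightarrow> ('m, 'e) chart \<Rightarrow> 'e \<Rightarrow> 'e" where
  "transition c c' = snd c' \<circ> inv_into (fst c) (snd c)"

definition mforms ::
  "('m, 'e::euclidean_space) chart set \<Rightarrow> nat \<Rightarrow> ('m, 'e) mform set" where
  "mforms At k = {\<omega>.
     (\<forall>c\<in>At. form_on k (chart_image c) (\<omega> c)) \<and>
     (\<forall>c\<in>At. \<forall>c'\<in>At. \<forall>x\<in>snd c ` (fst c \<inter> fst c'). \<forall>vs.
        \<omega> c x vs = \<omega> c' (transition c c' x)
          (map (frechet_derivative (transition c c') (at x)) vs)) \<and>
     (\<forall>c. c \<notin> At \<longrightarrow> \<omega> c = (\<lambda>x vs. 0))}"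

definition mform_zero :: "('m, 'e) mform" where
  "mform_zero c x vs = 0"

definition mform_add :: "('m, 'e) mform \<Rightarrow> ('m, 'e) mform \<Rightarrow> ('m, 'e) mform" where
  "mform_add \<omega> \<sigma> c x vs = \<omega> c x vs + \<sigma> c x vs"

definition mform_scale :: "real \<Rightarrow> ('m, 'e) mform \<Rightarrow> ('m, 'e) mform" where
  "mform_scale r \<omega> c x vs = r * \<omega> c x vs"

definition mform_diff :: "('m, 'e) mform \<Rightarrow> ('m, 'e) mform \<Rightarrow> ('m, 'e) mform" where
  "mform_diff \<omega> \<sigma> c x vs = \<omega> c x vs - \<sigma> c x vs"

definition mform_ext_deriv :: "('m, 'e::euclidean_space) mform \<Rightarrow> ('m, 'e) mform" where
  "mform_ext_deriv \<omega> c = ext_deriv (chart_image c) (\<omega> c)"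

definition mform_wedge_one :: "('m, 'e) mform \<Rightarrow> ('m, 'e) mform \<Rightarrow> ('m, 'e) mform" where
  "mform_wedge_one \<eta> \<omega> c = wedge_one (\<eta> c) (\<omega> c)"

section \<open>Morse--Novikov cohomology\<close>

definition mn_deriv ::
  "('m, 'e::euclidean_space) mform \<Rightarrow> ('m, 'e) mform \<Rightarrow> ('m, 'e) mform" where
  "mn_deriv \<eta> \<omega> = mform_diff (mform_ext_deriv \<omega>) (mform_wedge_one \<eta> \<omega>)"

definition mn_cocycles ::
  "('m, 'e::euclidean_space) chart set \<Rightarrow> ('m, 'e) mform \<Rightarrow> nat \<Rightarrow> ('m, 'e) mform set" where
  "mn_cocycles At \<eta> k = {\<omega> \<in> mforms At k. mn_deriv \<eta> \<omega> = mform_zero}"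

definition mn_coboundaries ::
  "('m, 'e::euclidean_space) chart set \<Rightarrow> ('m, 'e) mform \<Rightarrow> nat \<Rightarrow> ('m, 'e) mform set" where
  "mn_coboundaries At \<eta> k =
     (case k of 0 \<Rightarrow> {mform_zero} | Suc j \<Rightarrow> mn_deriv \<eta> ` mforms At j)"

definition mn_rel ::
  "('m, 'e::euclidean_space) chart set \<Rightarrow> ('m, 'e) mform \<Rightarrow> nat \<Rightarrow> ('m, 'e) mform rel" where
  "mn_rel At \<eta> k = {(\<omega>, \<sigma>). \<omega> \<in> mn_cocycles At \<eta> k \<and> \<sigma> \<in> mn_cocycles At \<eta> k \<and>
     mform_diff \<omega> \<sigma> \<in> mn_coboundaries At \<eta> k}"

definition mn_class ::
  "('m, 'e::euclidean_space) chart set \<Rightarrow> ('m, 'e) mform \<Rightarrow> nat \<Rightarrow> ('m, 'e) mform \<Rightarrow>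
   ('m, 'e) mform set" where
  "mn_class At \<eta> k \<omega> = mn_rel At \<eta> k `` {\<omega>}"

definition mn_cohomology ::
  "('m, 'e::euclidean_space) chart set \<Rightarrow> ('m, 'e) mform \<Rightarrow> nat \<Rightarrow> ('m, 'e) mform set set" where
  "mn_cohomology At \<eta> k = mn_cocycles At \<eta> k // mn_rel At \<eta> k"

text \<open>The vector space operations on cohomology are those induced from cocycles; \<open>f\<close> is an
  isomorphism of real vector spaces from the cohomology onto \<open>'v\<close>.\<close>

definition mn_linear_iso ::
  "('m, 'e::euclidean_space) chart set \<Rightarrow> ('m, 'e) mform \<Rightarrow> nat \<Rightarrow>
   (('m, 'e) mform set \<Rightarrow> 'v::real_vector) \<Rightarrow> bool" where
  "mn_linear_iso At \<eta> k f \<longleftrightarrow>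
     bij_betw f (mn_cohomology At \<eta> k) UNIV \<and>
     (\<forall>\<omega>\<in>mn_cocycles At \<eta> k. \<forall>\<sigma>\<in>mn_cocycles At \<eta> k.
        f (mn_class At \<eta> k (mform_add \<omega> \<sigma>)) = f (mn_class At \<eta> k \<omega>) + f (mn_class At \<eta> k \<sigma>)) \<and>
     (\<forall>r. \<forall>\<omega>\<in>mn_cocycles At \<eta> k.
        f (mn_class At \<eta> k (mform_scale r \<omega>)) = r *\<^sub>R f (mn_class At \<eta> k \<omega>))"

section \<open>The Inoue surface\<close>

definition is_eigenvector :: "'a::field^'n^'n \<Rightarrow> 'a \<Rightarrow> 'a^'n \<Rightarrow> bool" where
  "is_eigenvector M l v \<longleftrightarrow> v \<noteq> 0 \<and> M *v v = l *s v"

definition inoue_data ::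
  "int^3^3 \<Rightarrow> real \<Rightarrow> complex \<Rightarrow> real^3 \<Rightarrow> complex^3 \<Rightarrow> bool" where
  "inoue_data A \<alpha> \<beta> a b \<longleftrightarrow>
     det A = 1 \<and> \<alpha> > 1 \<and> \<beta> \<notin> \<real> \<and>
     {l. \<exists>v. is_eigenvector (map_matrix complex_of_int A) l v} = {complex_of_real \<alpha>, \<beta>, cnj \<beta>} \<and>
     is_eigenvector (map_matrix real_of_int A) \<alpha> a \<and>
     is_eigenvector (map_matrix complex_of_int A) \<beta> b"

definition C_times_H :: "(complex \<times> complex) set" where
  "C_times_H = UNIV \<times> {w. Im w > 0}"

definition inoue_dilation :: "real \<Rightarrow> complex \<Rightarrow> complex \<times> complex \<Rightarrow> complex \<times> complex" where
  "inoue_dilation \<alpha> \<beta> = (\<lambda>(z, w)\<in>C_times_H. (\<beta> * z, complex_of_real \<alpha> * w))"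

definition inoue_translation ::
  "real^3 \<Rightarrow> complex^3 \<Rightarrow> 3 \<Rightarrow> complex \<times> complex \<Rightarrow> complex \<times> complex" where
  "inoue_translation a b i = (\<lambda>(z, w)\<in>C_times_H. (z + b $ i, w + complex_of_real (a $ i)))"

definition inoue_group ::
  "real \<Rightarrow> complex \<Rightarrow> real^3 \<Rightarrow> complex^3 \<Rightarrow> (complex \<times> complex \<Rightarrow> complex \<times> complex) monoid" where
  "inoue_group \<alpha> \<beta> a b = BijGroup C_times_H
     \<lparr>carrier := generate (BijGroup C_times_H)
        (insert (inoue_dilation \<alpha> \<beta>) (range (inoue_translation a b)))\<rparr>"

definition inoue_proj ::
  "real \<Rightarrow> complex \<Rightarrow> real^3 \<Rightarrow> complex^3 \<Rightarrow> complex \<times> complex \<Rightarrow> (complex \<times> complex) set" where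
  "inoue_proj \<alpha> \<beta> a b = orbit (inoue_group \<alpha> \<beta> a b) (\<lambda>g. g)"

definition inoue_surface ::
  "real \<Rightarrow> complex \<Rightarrow> real^3 \<Rightarrow> complex^3 \<Rightarrow> (complex \<times> complex) set set" where
  "inoue_surface \<alpha> \<beta> a b = orbits (inoue_group \<alpha> \<beta> a b) C_times_H (\<lambda>g. g)"

text \<open>The charts of the quotient manifold are the local sections of the projection with open
  image, that is, the local inverses of the projection.  As the group acts freely and properly
  discontinuously, their domains cover the surface.\<close>

definition inoue_atlas ::
  "real \<Rightarrow> complex \<Rightarrow> real^3 \<Rightarrow> complex^3 \<Rightarrow> ((complex \<times> complex) set, complex \<times> complex) chart set" where
  "inoue_atlas \<alpha> \<beta> a b =
     {(U, \<phi>). U \<subseteq> inoue_surface \<alpha> \<beta> a b \<and> \<phi> \<in> extensional U \<and>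
        open (\<phi> ` U) \<and> \<phi> ` U \<subseteq> C_times_H \<and> (\<forall>u\<in>U. inoue_proj \<alpha> \<beta> a b (\<phi> u) = u)}"

text \<open>In the charts above a form on the quotient has the same expression as its pull-back to the
  covering, which for the Lee form is \<open>dw\<^sub>2 / w\<^sub>2\<close> with \<open>w\<^sub>2 = Im w\<close>.\<close>

definition lee_form ::
  "real \<Rightarrow> complex \<Rightarrow> real^3 \<Rightarrow> complex^3 \<Rightarrow> ((complex \<times> complex) set, complex \<times> complex) mform" where
  "lee_form \<alpha> \<beta> a b c p vs =
     (if c \<in> inoue_atlas \<alpha> \<beta> a b \<and> p \<in> chart_image c \<and> length vs = 1
      then Im (snd (vs ! 0)) / Im (snd p) else 0)"

end

theory Submission
  imports Defs "HOL-Real_Asymp.Real_Asymp"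
begin

text \<open>Write a point of the covering \<open>C_times_H\<close> as a horizontal part \<open>(z, Re w)\<close> together with the
  height \<open>t = Im w\<close>.  The translations generate a lattice in the three horizontal directions, and
  the remaining generator is the dilation \<open>D (z, w) = (\<beta> z, \<alpha> w)\<close>, which maps the lattice onto
  itself because \<open>A\<close> and its inverse have integer entries.  So the surface is a bundle of three-tori
  over the circle \<open>{t > 0} / (t \<sim> \<alpha> t)\<close>.

  The Lee form is \<open>d (ln t)\<close>, hence \<open>d\<^sub>\<theta> (t \<sigma>) = t d\<sigma>\<close>.  Dividing forms by \<open>t\<close> therefore turns the
  Morse--Novikov complex of the surface into the ordinary de Rham complex of those forms \<open>\<sigma>\<close> on the
  covering that are periodic under the lattice and satisfy \<open>D\<^sup>* \<sigma> = \<sigma> / \<alpha>\<close> (\<open>equivariant_forms\<close>,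
  \<open>mn_cocycles_eq\<close>, \<open>mn_coboundaries_eq\<close>).  Two facts compute the cohomology of that complex.

  First, every closed periodic form of degree 1, 2 or 3 differs from a horizontal form with constant
  coefficients, its period, by the differential of a periodic form, and the period of an exact form
  vanishes (\<open>periodic_closed_form_cohomologous_const\<close>, \<open>period_ext_deriv\<close>).  The proof averages
  along the three lattice directions one after the other.  For a single direction \<open>u\<close> the operator
  \<open>K f (x) = \<integral> s f (x + s u) ds\<close> over \<open>[0, 1]\<close> satisfies \<open>\<partial>\<^sub>u K f = f - average\<close> on \<open>u\<close>-periodic
  functions and commutes with all derivatives, so by Cartan's formula \<open>K\<close> composed with the
  contraction by \<open>u\<close> is a homotopy between the identity and the averaging.  The averaged form depends
  on the height only and is integrated directly.

  Second, the operator \<open>T = D\<^sup>* - 1 / \<alpha>\<close>, whose kernel consists of the equivariant forms, is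
  surjective on periodic forms (\<open>twist_surjective\<close>): a smooth cutoff in the height splits the right-hand
  side into two pieces, and for each of them one of the two geometric series inverting \<open>T\<close> is a
  locally finite sum.

  Consequently only the kernel and the cokernel of \<open>T\<close> on constant horizontal forms matter, as in the
  Wang sequence of a mapping torus.  On these \<open>D\<^sup>*\<close> has the eigenvalues \<open>1\<close> in degree 0, then
  \<open>\<alpha>, \<beta>, cnj \<beta>\<close>, then \<open>\<beta> cnj \<beta>, \<alpha> \<beta>, \<alpha> cnj \<beta>\<close>, and \<open>1\<close> in degree 3.  As
  \<open>\<alpha> \<beta> cnj \<beta> = det A = 1\<close> and \<open>\<beta>\<close> is not real, the value \<open>1 / \<alpha>\<close> occurs exactly once, for the area
  form \<open>dx \<and> dy\<close> of the \<open>z\<close>-plane.  It generates the second cohomology as a kernel.  As a cokernel it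
  generates the third: \<open>T (ln t dx \<and> dy)\<close> is a nonzero multiple of \<open>dx \<and> dy\<close>, so
  \<open>d (ln t dx \<and> dy)\<close> is equivariant but has no equivariant primitive.  Nothing is left in degree 1.\<close>

section \<open>Smooth functions\<close>

lemma frechet_derivative_cong_open:
  assumes "open S" "x \<in> S" "\<And>y. y \<in> S \<Longrightarrow> f y = g y"
  shows "frechet_derivative f (at x) = frechet_derivative g (at x)"
proof -
  have "(f has_derivative D) (at x) \<longleftrightarrow> (g has_derivative D) (at x)" for D
    using assms has_derivative_transform_within_open[of f D x UNIV S g]
      has_derivative_transform_within_open[of g D x UNIV S f] by auto
  then show ?thesis unfolding frechet_derivative_def by simp
qed

lemma differentiable_cong_open:
  assumes "open S" "x \<in> S" "\<And>y. y \<in> S \<Longrightarrow> f y = g y" "f differentiable (at x)"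
  shows "g differentiable (at x)"
  using assms has_derivative_transform_within_open[of f _ x UNIV S g]
  unfolding differentiable_def by blast

lemma times_differentiable_on_cong:
  assumes "open S" "\<And>x. x \<in> S \<Longrightarrow> f x = g x" "times_differentiable_on n S f"
  shows "times_differentiable_on n S g"
  using assms(2,3)
proof (induction n arbitrary: f g)
  case 0
  then show ?case by (auto cong: continuous_on_cong)
next
  case (Suc n)
  have "frechet_derivative f (at x) = frechet_derivative g (at x)" if "x \<in> S" for x
    using frechet_derivative_cong_open[OF assms(1) that] Suc.prems(1) by blast
  then have "times_differentiable_on n S (\<lambda>x. frechet_derivative g (at x) v)" for v
    using Suc.IH[of "\<lambda>x. frechet_derivative f (at x) v" "\<lambda>x. frechet_derivative g (at x) v"] Suc.prems(2)
    by simp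
  moreover have "g differentiable (at x)" if "x \<in> S" for x
    using differentiable_cong_open[OF assms(1) that] Suc.prems that by auto
  ultimately show ?case by simp
qed

text \<open>The recursive definition speaks of \<open>frechet_derivative\<close>; the closure properties below
  are inductions on the order in which the derivative is known by an explicit formula.\<close>

lemma times_differentiable_on_SucI:
  assumes "open S" "\<And>x. x \<in> S \<Longrightarrow> (f has_derivative D x) (at x)"
    and "\<And>v. times_differentiable_on n S (\<lambda>x. D x v)"
  shows "times_differentiable_on (Suc n) S f"
proof -
  have "D x = frechet_derivative f (at x)" if "x \<in> S" for x
    using assms(2)[OF that] by (rule frechet_derivative_at)
  then have "times_differentiable_on n S (\<lambda>x. frechet_derivative f (at x) v)" for v
    using times_differentiable_on_cong[OF assms(1) _ assms(3)] by simp
  then show ?thesis using assms(2) by (auto intro: differentiableI)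
qed

lemma times_differentiable_on_has_derivative:
  assumes "times_differentiable_on (Suc n) S f" "x \<in> S"
  shows "(f has_derivative frechet_derivative f (at x)) (at x)"
  using assms by (simp add: frechet_derivative_works)

lemma times_differentiable_on_le_Suc:
  "times_differentiable_on (Suc n) S f \<Longrightarrow> times_differentiable_on n S f"
proof (induction n arbitrary: f)
  case 0
  then show ?case
    by (auto intro!: continuous_at_imp_continuous_on differentiable_imp_continuous_within)
next
  case (Suc n)
  then show ?case by (metis times_differentiable_on.simps(2))
qed

lemma times_differentiable_on_continuous_on:
  "times_differentiable_on n S f \<Longrightarrow> continuous_on S f"
proof (induction n)
  case (Suc n)
  then show ?case using times_differentiable_on_le_Suc by blast
qed simp

lemma times_differentiable_on_local:
  assumes "\<And>x. x \<in> S \<Longrightarrow> \<exists>T. open T \<and> x \<in> T \<and> times_differentiable_on n T f"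
  shows "times_differentiable_on n S f"
  using assms
proof (induction n arbitrary: f)
  case 0
  then have "isCont f x" if "x \<in> S" for x
    using that by (metis times_differentiable_on.simps(1) continuous_on_eq_continuous_at)
  then show ?case by (auto intro: continuous_at_imp_continuous_on)
next
  case (Suc n)
  then show ?case by (meson times_differentiable_on.simps(2))
qed

lemma times_differentiable_on_subset:
  "times_differentiable_on n S f \<Longrightarrow> T \<subseteq> S \<Longrightarrow> times_differentiable_on n T f"
  by (induction n arbitrary: f) (auto intro: continuous_on_subset)

lemma times_differentiable_on_const: "times_differentiable_on n S (\<lambda>x. c)"
  by (induction n arbitrary: c) auto

lemma times_differentiable_on_linear:
  assumes "open S" "linear l"
  shows "times_differentiable_on n S l"
proof -
  have l: "bounded_linear l" using assms(2) by (simp add: linear_conv_bounded_linear)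
  then have c: "continuous_on S l" by (simp add: linear_continuous_on)
  show ?thesis
  proof (cases n)
    case (Suc m)
    show ?thesis unfolding Suc
      by (rule times_differentiable_on_SucI[where D="\<lambda>x. l", OF assms(1)])
        (auto intro: times_differentiable_on_const bounded_linear_imp_has_derivative l)
  qed (use c in simp)
qed

lemma times_differentiable_on_add:
  assumes "open S" "times_differentiable_on n S f" "times_differentiable_on n S g"
  shows "times_differentiable_on n S (\<lambda>x. f x + g x)"
  using assms(2,3)
proof (induction n arbitrary: f g)
  case 0
  then show ?case by (auto intro: continuous_intros)
next
  case (Suc n)
  show ?case
    by (rule times_differentiable_on_SucI[OF assms(1)
         has_derivative_add[OF times_differentiable_on_has_derivative[OF Suc.prems(1)]
           times_differentiable_on_has_derivative[OF Suc.prems(2)]]])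
       (use Suc in auto)
qed

lemma times_differentiable_on_mult:
  assumes "open S" "times_differentiable_on n S f" "times_differentiable_on n S g"
  shows "times_differentiable_on n S (\<lambda>x. f x * g x)"
  using assms(2,3)
proof (induction n arbitrary: f g)
  case 0
  then show ?case by (auto intro: continuous_intros)
next
  case (Suc n)
  show ?case
    by (rule times_differentiable_on_SucI[OF assms(1)
         has_derivative_mult[OF times_differentiable_on_has_derivative[OF Suc.prems(1)]
           times_differentiable_on_has_derivative[OF Suc.prems(2)]]])
       (use Suc.prems times_differentiable_on_le_Suc in \<open>auto intro!: times_differentiable_on_add[OF assms(1)] Suc.IH\<close>)
qed

lemma times_differentiable_on_affine:
  fixes L :: "'a::euclidean_space \<Rightarrow> 'b::euclidean_space"
  assumes "open S" "linear L" "\<And>x. x \<in> S \<Longrightarrow> L x + c \<in> T" "times_differentiable_on n T f"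
  shows "times_differentiable_on n S (\<lambda>x. f (L x + c))"
  using assms(4)
proof (induction n arbitrary: f)
  case 0
  have "continuous_on S (\<lambda>x. L x + c)"
    using assms(2) by (intro continuous_intros linear_continuous_on) (simp add: linear_conv_bounded_linear)
  then show ?case using 0 assms(3) by (auto intro: continuous_on_compose2)
next
  case (Suc n)
  have "((\<lambda>x. L x + c) has_derivative L) (at x)" for x
    using assms(2) by (auto intro!: derivative_eq_intros bounded_linear_imp_has_derivative
        simp: linear_conv_bounded_linear)
  from has_derivative_compose[OF this times_differentiable_on_has_derivative[OF Suc.prems assms(3)]]
  show ?case
    by (intro times_differentiable_on_SucI[OF assms(1)]) (use Suc in auto)
qed

lemma times_differentiable_on_compose_real:
  fixes \<phi> :: "real \<Rightarrow> real"
  assumes "open S" "\<And>x. x \<in> S \<Longrightarrow> u x \<in> J" "times_differentiable_on n J \<phi>" "times_differentiable_on n S u"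
  shows "times_differentiable_on n S (\<lambda>x. \<phi> (u x))"
  using assms(3,4)
proof (induction n arbitrary: \<phi>)
  case 0
  then show ?case using assms(2) by (auto intro: continuous_on_compose2)
next
  case (Suc n)
  have lin: "frechet_derivative \<phi> (at y) w = w * frechet_derivative \<phi> (at y) 1" if "y \<in> J" for y w
  proof -
    have "linear (frechet_derivative \<phi> (at y))"
      using Suc.prems(1) that by (auto intro: linear_frechet_derivative)
    from linear_cmul[OF this, of w 1] show ?thesis by simp
  qed
  from has_derivative_compose[OF times_differentiable_on_has_derivative[OF Suc.prems(2)]
      times_differentiable_on_has_derivative[OF Suc.prems(1) assms(2)]]
  show ?case
  proof (rule times_differentiable_on_SucI[OF assms(1)])
    fix v
    have "times_differentiable_on n S
       (\<lambda>x. frechet_derivative u (at x) v * frechet_derivative \<phi> (at (u x)) 1)"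
      using Suc.prems times_differentiable_on_le_Suc[OF Suc.prems(2)]
      by (auto intro!: times_differentiable_on_mult assms(1) Suc.IH[of "\<lambda>y. frechet_derivative \<phi> (at y) 1"])
    then show "times_differentiable_on n S
       (\<lambda>x. frechet_derivative \<phi> (at (u x)) (frechet_derivative u (at x) v))"
      by (rule times_differentiable_on_cong[OF assms(1), rotated]) (subst lin; simp add: assms(2))
  qed
qed

lemma smooth_fun_on_cong:
  "open S \<Longrightarrow> (\<And>x. x \<in> S \<Longrightarrow> f x = g x) \<Longrightarrow> smooth_fun_on S f \<Longrightarrow> smooth_fun_on S g"
  unfolding smooth_fun_on_def using times_differentiable_on_cong by blast

lemma smooth_fun_on_local:
  assumes "\<And>x. x \<in> S \<Longrightarrow> \<exists>T. open T \<and> x \<in> T \<and> smooth_fun_on T f"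
  shows "smooth_fun_on S f"
  unfolding smooth_fun_on_def
  using assms by (auto simp: smooth_fun_on_def intro!: times_differentiable_on_local)

lemma smooth_fun_on_subset: "smooth_fun_on S f \<Longrightarrow> T \<subseteq> S \<Longrightarrow> smooth_fun_on T f"
  unfolding smooth_fun_on_def using times_differentiable_on_subset by blast

lemma smooth_fun_on_const [simp]: "smooth_fun_on S (\<lambda>x. c)"
  by (simp add: smooth_fun_on_def times_differentiable_on_const)

lemma smooth_fun_on_linear: "open S \<Longrightarrow> linear l \<Longrightarrow> smooth_fun_on S l"
  by (simp add: smooth_fun_on_def times_differentiable_on_linear)

lemma smooth_fun_on_add:
  "open S \<Longrightarrow> smooth_fun_on S f \<Longrightarrow> smooth_fun_on S g \<Longrightarrow> smooth_fun_on S (\<lambda>x. f x + g x)"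
  by (simp add: smooth_fun_on_def times_differentiable_on_add)

lemma smooth_fun_on_mult:
  "open S \<Longrightarrow> smooth_fun_on S f \<Longrightarrow> smooth_fun_on S g \<Longrightarrow> smooth_fun_on S (\<lambda>x. f x * g x)"
  by (simp add: smooth_fun_on_def times_differentiable_on_mult)

lemma smooth_fun_on_diff:
  assumes "open S" "smooth_fun_on S f" "smooth_fun_on S g"
  shows "smooth_fun_on S (\<lambda>x. f x - g x)"
  using smooth_fun_on_add[OF assms(1,2) smooth_fun_on_mult[OF assms(1) smooth_fun_on_const[of S "-1"] assms(3)]]
  by simp

lemma smooth_fun_on_sum:
  "open S \<Longrightarrow> (\<And>i. i \<in> I \<Longrightarrow> smooth_fun_on S (f i)) \<Longrightarrow> smooth_fun_on S (\<lambda>x. \<Sum>i\<in>I. f i x)"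
  by (induction I rule: infinite_finite_induct) (auto intro: smooth_fun_on_add)

lemma smooth_fun_on_affine:
  fixes L :: "'a::euclidean_space \<Rightarrow> 'b::euclidean_space"
  shows "open S \<Longrightarrow> linear L \<Longrightarrow> (\<And>x. x \<in> S \<Longrightarrow> L x + c \<in> T) \<Longrightarrow> smooth_fun_on T f \<Longrightarrow>
    smooth_fun_on S (\<lambda>x. f (L x + c))"
  unfolding smooth_fun_on_def using times_differentiable_on_affine by blast

lemma smooth_fun_on_compose_real:
  fixes \<phi> :: "real \<Rightarrow> real"
  shows "open S \<Longrightarrow> (\<And>x. x \<in> S \<Longrightarrow> u x \<in> J) \<Longrightarrow> smooth_fun_on J \<phi> \<Longrightarrow> smooth_fun_on S u \<Longrightarrow>
    smooth_fun_on S (\<lambda>x. \<phi> (u x))"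
  unfolding smooth_fun_on_def using times_differentiable_on_compose_real by blast

lemma smooth_fun_onI:
  assumes "open S" "\<And>x. x \<in> S \<Longrightarrow> (f has_derivative D x) (at x)"
    and "\<And>v. smooth_fun_on S (\<lambda>x. D x v)"
  shows "smooth_fun_on S f"
  unfolding smooth_fun_on_def
proof
  fix n
  show "times_differentiable_on n S f"
    using times_differentiable_on_SucI[OF assms(1,2), of n]
      assms(3) times_differentiable_on_le_Suc unfolding smooth_fun_on_def by blast
qed

lemma smooth_fun_on_has_derivative:
  "smooth_fun_on S f \<Longrightarrow> x \<in> S \<Longrightarrow> (f has_derivative frechet_derivative f (at x)) (at x)"
  unfolding smooth_fun_on_def using times_differentiable_on_has_derivative by blast

lemma smooth_fun_on_differentiable: "smooth_fun_on S f \<Longrightarrow> x \<in> S \<Longrightarrow> f differentiable (at x)"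
  using smooth_fun_on_has_derivative unfolding differentiable_def by blast

lemma smooth_fun_on_linear_derivative:
  "smooth_fun_on S f \<Longrightarrow> x \<in> S \<Longrightarrow> linear (frechet_derivative f (at x))"
  using smooth_fun_on_differentiable linear_frechet_derivative by blast

lemma smooth_fun_on_directional:
  "smooth_fun_on S f \<Longrightarrow> smooth_fun_on S (\<lambda>x. frechet_derivative f (at x) v)"
  unfolding smooth_fun_on_def by (metis times_differentiable_on.simps(2))

lemma smooth_fun_on_continuous_on: "smooth_fun_on S f \<Longrightarrow> continuous_on S f"
  unfolding smooth_fun_on_def by (metis times_differentiable_on.simps(1))

section \<open>Integration along a segment\<close>

text \<open>The weight \<open>k = 1\<close> gives the average over the segment, the weight \<open>k s = s\<close> the kernel of the
  homotopy between the identity and this average.\<close>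

definition segment_integral :: "(real \<Rightarrow> real) \<Rightarrow> 'e::real_vector \<Rightarrow> ('e \<Rightarrow> real) \<Rightarrow> 'e \<Rightarrow> real" where
  "segment_integral k u f x = integral {0..1} (\<lambda>s. k s * f (x + s *\<^sub>R u))"

lemma segment_integrand_continuous:
  fixes u :: "'e::euclidean_space" and f :: "'e \<Rightarrow> real" and k :: "real \<Rightarrow> real"
  assumes "\<And>x s. x \<in> U \<Longrightarrow> s \<in> {0..1} \<Longrightarrow> x + s *\<^sub>R u \<in> S"
    and "continuous_on {0..1} k" "continuous_on S f"
  shows "continuous_on (U \<times> {0..1}) (\<lambda>(x, s). k s * f (x + s *\<^sub>R u))"
proof -
  have 1: "continuous_on (U \<times> {0..1}) (\<lambda>p. f (fst p + snd p *\<^sub>R u))"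
    by (rule continuous_on_compose2[OF assms(3)]) (use assms(1) in \<open>auto intro!: continuous_intros\<close>)
  have 2: "continuous_on (U \<times> {0..1}) (\<lambda>p. k (snd p))"
    by (rule continuous_on_compose2[OF assms(2)]) (auto intro!: continuous_intros)
  show ?thesis using continuous_on_mult[OF 2 1] by (simp add: split_beta)
qed

lemma segment_integral_integrable:
  fixes u :: "'e::euclidean_space" and f :: "'e \<Rightarrow> real" and k :: "real \<Rightarrow> real"
  assumes "\<And>s. s \<in> {0..1} \<Longrightarrow> x + s *\<^sub>R u \<in> S"
    and "continuous_on {0..1} k" "continuous_on S f"
  shows "(\<lambda>s. k s * f (x + s *\<^sub>R u)) integrable_on {0..1}"
proof (rule integrable_continuous_real)
  have "continuous_on {0..1} (\<lambda>s. (case (x, s) of (x, s) \<Rightarrow> k s * f (x + s *\<^sub>R u)))"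
    by (rule continuous_on_compose2[OF segment_integrand_continuous[where U="{x}", OF _ assms(2,3)]])
      (use assms(1) in \<open>auto intro!: continuous_intros\<close>)
  then show "continuous_on {0..1} (\<lambda>s. k s * f (x + s *\<^sub>R u))" by simp
qed

text \<open>Leibniz' rule wants the derivative of the integrand as a continuous family of bounded linear maps.
  In finite dimension it is enough to check the continuity on basis vectors, that is, for the
  directional derivatives, which are continuous by assumption.\<close>

lemma segment_integral_has_derivative:
  fixes u :: "'e::euclidean_space" and f :: "'e \<Rightarrow> real" and k :: "real \<Rightarrow> real"
  assumes "open S" "open U" "convex U" and sub: "\<And>x s. x \<in> U \<Longrightarrow> s \<in> {0..1} \<Longrightarrow> x + s *\<^sub>R u \<in> S"
    and k: "continuous_on {0..1} k" and f: "times_differentiable_on (Suc n) S f" and x: "x \<in> U"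
  shows "(segment_integral k u f has_derivative
     (\<lambda>v. segment_integral k u (\<lambda>y. frechet_derivative f (at y) v) x)) (at x)"
proof -
  let ?D = "\<lambda>y. frechet_derivative f (at y)"
  have fc: "continuous_on S f" using f times_differentiable_on_continuous_on by blast
  have Dc: "continuous_on S (\<lambda>y. ?D y v)" for v
    using f by (auto intro: times_differentiable_on_continuous_on[of n])
  have Dl: "bounded_linear (?D y)" if "y \<in> S" for y
    using times_differentiable_on_has_derivative[OF f that] has_derivative_bounded_linear by blast
  define B where "B x s = k s *\<^sub>R Blinfun (?D (x + s *\<^sub>R u))" for x s
  have B: "blinfun_apply (B x s) v = k s * ?D (x + s *\<^sub>R u) v" if "x \<in> U" "s \<in> {0..1}" for x s v
    using that sub Dl by (simp add: B_def bounded_linear_Blinfun_apply scaleR_blinfun.rep_eq)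
  have Bcont: "continuous_on (U \<times> cbox 0 1) (\<lambda>(x, s). B x s)"
  proof (rule continuous_on_blinfun_componentwise)
    fix i :: 'e
    have "continuous_on (U \<times> {0..1}) (\<lambda>(x, s). k s * ?D (x + s *\<^sub>R u) i)"
      by (rule segment_integrand_continuous[OF sub k Dc])
    then show "continuous_on (U \<times> cbox 0 1) (\<lambda>p. blinfun_apply (case p of (x, s) \<Rightarrow> B x s) i)"
      unfolding cbox_interval by (rule continuous_on_eq) (auto simp: B)
  qed
  have "((\<lambda>x. integral (cbox 0 1) (\<lambda>s. k s * f (x + s *\<^sub>R u))) has_derivative
      blinfun_apply (integral (cbox 0 1) (B x))) (at x within U)"
  proof (rule leibniz_rule[where U=U and fx=B])
    fix x s assume xs: "x \<in> U" "s \<in> cbox (0::real) 1"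
    have y: "x + s *\<^sub>R u \<in> S" using sub xs by auto
    have "((\<lambda>x. x + s *\<^sub>R u) has_derivative (\<lambda>v. v)) (at x within U)"
      by (auto intro!: derivative_eq_intros)
    from has_derivative_compose[OF this times_differentiable_on_has_derivative[OF f y]]
    have "((\<lambda>x. f (x + s *\<^sub>R u)) has_derivative ?D (x + s *\<^sub>R u)) (at x within U)" .
    then have "((\<lambda>x. k s * f (x + s *\<^sub>R u)) has_derivative (\<lambda>v. k s * ?D (x + s *\<^sub>R u) v)) (at x within U)"
      by (intro derivative_intros)
    moreover have "blinfun_apply (B x s) = (\<lambda>v. k s * ?D (x + s *\<^sub>R u) v)"
      using B xs by auto
    ultimately show "((\<lambda>x. k s * f (x + s *\<^sub>R u)) has_derivative blinfun_apply (B x s)) (at x within U)"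
      by simp
  next
    fix x assume "x \<in> U"
    then show "(\<lambda>s. k s * f (x + s *\<^sub>R u)) integrable_on cbox 0 1"
      using segment_integral_integrable[OF _ k fc] sub by simp
  qed (use x assms Bcont in auto)
  moreover have "blinfun_apply (integral (cbox 0 1) (B x)) =
     (\<lambda>v. segment_integral k u (\<lambda>y. ?D y v) x)"
  proof
    fix v
    have "continuous_on (cbox 0 1) (\<lambda>s. (case (x, s) of (x, s) \<Rightarrow> B x s))"
      by (rule continuous_on_compose2[OF Bcont]) (use x in \<open>auto intro!: continuous_intros\<close>)
    then have "(\<lambda>s. B x s) integrable_on cbox 0 1" by (intro integrable_continuous) simp
    then have "blinfun_apply (integral (cbox 0 1) (B x)) v = integral (cbox 0 1) (\<lambda>s. blinfun_apply (B x s) v)"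
      by (simp add: blinfun_apply_integral)
    also have "\<dots> = segment_integral k u (\<lambda>y. ?D y v) x"
      unfolding segment_integral_def cbox_interval by (rule integral_cong) (use x B in auto)
    finally show "blinfun_apply (integral (cbox 0 1) (B x)) v = segment_integral k u (\<lambda>y. ?D y v) x" .
  qed
  ultimately show ?thesis
    using at_within_open[OF x assms(2)] unfolding segment_integral_def cbox_interval by simp
qed

lemma smooth_fun_on_segment_integral:
  fixes u :: "'e::euclidean_space" and f :: "'e \<Rightarrow> real" and k :: "real \<Rightarrow> real"
  assumes "open S" "open U" "convex U" and sub: "\<And>x s. x \<in> U \<Longrightarrow> s \<in> {0..1} \<Longrightarrow> x + s *\<^sub>R u \<in> S"
    and k: "continuous_on {0..1} k" and f: "smooth_fun_on S f"
  shows "smooth_fun_on U (segment_integral k u f)"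
proof -
  have "times_differentiable_on n U (segment_integral k u f)" if "times_differentiable_on (Suc n) S f" for n
    using that
  proof (induction n arbitrary: f)
    case 0
    from segment_integral_has_derivative[OF assms(1-4) k 0] have "isCont (segment_integral k u f) x" if "x \<in> U" for x
      using that has_derivative_continuous by blast
    then show ?case by (auto intro: continuous_at_imp_continuous_on)
  next
    case (Suc n)
    have "times_differentiable_on n U (segment_integral k u (\<lambda>y. frechet_derivative f (at y) v))" for v
      by (rule Suc.IH) (use Suc.prems in \<open>metis times_differentiable_on.simps(2)\<close>)
    then show ?case
      by (intro times_differentiable_on_SucI[OF assms(2)
            segment_integral_has_derivative[OF assms(1-4) k Suc.prems]])
  qed
  then show ?thesis using f unfolding smooth_fun_on_def by blast
qed

lemma segment_integral_derivative:
  fixes u :: "'e::euclidean_space" and f :: "'e \<Rightarrow> real" and k :: "real \<Rightarrow> real"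
  assumes "open S" "open U" "convex U" and sub: "\<And>x s. x \<in> U \<Longrightarrow> s \<in> {0..1} \<Longrightarrow> x + s *\<^sub>R u \<in> S"
    and k: "continuous_on {0..1} k" and f: "smooth_fun_on S f" and x: "x \<in> U"
  shows "frechet_derivative (segment_integral k u f) (at x) v
     = segment_integral k u (\<lambda>y. frechet_derivative f (at y) v) x"
proof -
  have "times_differentiable_on (Suc 0) S f" using f unfolding smooth_fun_on_def by blast
  from frechet_derivative_at[OF segment_integral_has_derivative[OF assms(1-5) this x]]
  show ?thesis by (metis (no_types, lifting))
qed

lemma smooth_fun_on_line_derivative:
  assumes "smooth_fun_on S f" "x + s *\<^sub>R u \<in> S"
  shows "((\<lambda>s. f (x + s *\<^sub>R u)) has_real_derivative frechet_derivative f (at (x + s *\<^sub>R u)) u) (at s within I)"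
proof -
  let ?D = "frechet_derivative f (at (x + s *\<^sub>R u))"
  have "((\<lambda>s. x + s *\<^sub>R u) has_derivative (\<lambda>h. h *\<^sub>R u)) (at s within I)"
    by (auto intro!: derivative_eq_intros)
  from has_derivative_compose[OF this smooth_fun_on_has_derivative[OF assms]]
  have "((\<lambda>s. f (x + s *\<^sub>R u)) has_derivative (\<lambda>h. ?D (h *\<^sub>R u))) (at s within I)" .
  moreover have "?D (h *\<^sub>R u) = h * ?D u" for h
    using linear_cmul[OF smooth_fun_on_linear_derivative[OF assms]] by simp
  ultimately show ?thesis
    by (simp add: has_field_derivative_def mult.commute[of _ "?D u"])
qed

lemma segment_integral_add:
  fixes u :: "'e::euclidean_space" and f :: "'e \<Rightarrow> real" and k :: "real \<Rightarrow> real"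
  assumes "\<And>s. s \<in> {0..1} \<Longrightarrow> x + s *\<^sub>R u \<in> S"
    and k: "continuous_on {0..1} k" and "continuous_on S f" "continuous_on S g"
  shows "segment_integral k u (\<lambda>y. f y + g y) x = segment_integral k u f x + segment_integral k u g x"
  using integral_add[OF segment_integral_integrable[OF assms(1,2,3)] segment_integral_integrable[OF assms(1,2,4)]]
  by (simp add: segment_integral_def algebra_simps)

lemma segment_integral_cmult:
  "segment_integral k u (\<lambda>y. c * f y) x = c * segment_integral k u f x"
  using integral_mult_right[of "{0..1}" c "\<lambda>s. k s * f (x + s *\<^sub>R u)"]
  by (simp add: segment_integral_def algebra_simps)

lemma segment_integral_zero [simp]: "segment_integral k u (\<lambda>y. 0) x = 0"
  by (simp add: segment_integral_def)

lemma segment_integral_cong: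
  assumes "\<And>s. s \<in> {0..1} \<Longrightarrow> f (x + s *\<^sub>R u) = g (x + s *\<^sub>R u)"
  shows "segment_integral k u f x = segment_integral k u g x"
  unfolding segment_integral_def by (rule integral_cong) (use assms in auto)

lemma segment_integral_sum:
  fixes u :: "'e::euclidean_space" and f :: "'i \<Rightarrow> 'e \<Rightarrow> real" and k :: "real \<Rightarrow> real"
  assumes "finite I" "\<And>s. s \<in> {0..1} \<Longrightarrow> x + s *\<^sub>R u \<in> S"
    and "continuous_on {0..1} k" and "\<And>i. i \<in> I \<Longrightarrow> continuous_on S (f i)"
  shows "segment_integral k u (\<lambda>y. \<Sum>i\<in>I. f i y) x = (\<Sum>i\<in>I. segment_integral k u (f i) x)"
  using assms(1,4)
proof (induction I)
  case (insert i I)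
  have "segment_integral k u (\<lambda>y. f i y + (\<Sum>i\<in>I. f i y)) x
      = segment_integral k u (f i) x + segment_integral k u (\<lambda>y. \<Sum>i\<in>I. f i y) x"
    by (rule segment_integral_add[OF assms(2,3)]) (auto intro!: continuous_on_sum insert.prems)
  then show ?case using insert by simp
qed simp

lemma segment_integral_const:
  "segment_integral (\<lambda>s. 1) u (\<lambda>y. c) x = c"
  by (simp add: segment_integral_def)

text \<open>The fundamental theorem of calculus, and integration by parts with the weight \<open>s\<close>.  If \<open>f\<close> has the
  period \<open>u\<close>, the second equation says that the weighted integral inverts the derivative along \<open>u\<close>
  up to the average.\<close>

lemma segment_integral_directional:
  fixes u :: "'e::euclidean_space" and f :: "'e \<Rightarrow> real"
  assumes "\<And>s. s \<in> {0..1} \<Longrightarrow> x + s *\<^sub>R u \<in> S" "smooth_fun_on S f"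
  shows "segment_integral (\<lambda>s. 1) u (\<lambda>y. frechet_derivative f (at y) u) x = f (x + u) - f x"
    and "segment_integral (\<lambda>s. s) u (\<lambda>y. frechet_derivative f (at y) u) x
       = f (x + u) - segment_integral (\<lambda>s. 1) u f x"
proof -
  let ?D = "\<lambda>s. frechet_derivative f (at (x + s *\<^sub>R u)) u"
  have d: "((\<lambda>s. f (x + s *\<^sub>R u)) has_real_derivative ?D s) (at s within {0..1})" if "s \<in> {0..1}" for s
    using smooth_fun_on_line_derivative[OF assms(2) assms(1)[OF that]] .
  then have "(?D has_integral f (x + 1 *\<^sub>R u) - f (x + 0 *\<^sub>R u)) {0..1}"
    by (intro fundamental_theorem_of_calculus) (auto simp: has_real_derivative_iff_has_vector_derivative)
  then show "segment_integral (\<lambda>s. 1) u (\<lambda>y. frechet_derivative f (at y) u) x = f (x + u) - f x"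
    by (simp add: segment_integral_def integral_unique)
  have "((\<lambda>s. s * f (x + s *\<^sub>R u)) has_real_derivative (1 * f (x + s *\<^sub>R u) + s * ?D s)) (at s within {0..1})"
    if "s \<in> {0..1}" for s
    using DERIV_mult[OF DERIV_ident d[OF that]] by (simp add: algebra_simps)
  then have "((\<lambda>s. 1 * f (x + s *\<^sub>R u) + s * ?D s) has_integral 1 * f (x + 1 *\<^sub>R u) - 0 * f (x + 0 *\<^sub>R u)) {0..1}"
    by (intro fundamental_theorem_of_calculus[where f="\<lambda>s. s * f (x + s *\<^sub>R u)"]) (auto simp: has_real_derivative_iff_has_vector_derivative)
  moreover have "(\<lambda>s. 1 * f (x + s *\<^sub>R u)) integrable_on {0..1}"
    by (rule segment_integral_integrable[OF assms(1)]) (auto intro: smooth_fun_on_continuous_on assms(2))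
  moreover have "(\<lambda>s. s * ?D s) integrable_on {0..1}"
    by (rule segment_integral_integrable[OF assms(1)])
      (auto intro: smooth_fun_on_continuous_on[OF smooth_fun_on_directional[OF assms(2)]])
  ultimately show "segment_integral (\<lambda>s. s) u (\<lambda>y. frechet_derivative f (at y) u) x
       = f (x + u) - segment_integral (\<lambda>s. 1) u f x"
    using integral_add[of "\<lambda>s. 1 * f (x + s *\<^sub>R u)" "{0..1}" "\<lambda>s. s * ?D s"]
    by (simp add: segment_integral_def integral_unique)
qed

lemma constant_along_segment:
  fixes u :: "'e::euclidean_space" and f :: "'e \<Rightarrow> real"
  assumes "\<And>s. s \<in> {0..1} \<Longrightarrow> x + s *\<^sub>R u \<in> S" "smooth_fun_on S f"
    and "\<And>y. y \<in> S \<Longrightarrow> frechet_derivative f (at y) u = 0"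
  shows "f (x + u) = f x"
proof -
  have "segment_integral (\<lambda>s. 1) u (\<lambda>y. frechet_derivative f (at y) u) x = segment_integral (\<lambda>s. 1) u (\<lambda>y. 0) x"
    by (rule segment_integral_cong) (use assms in auto)
  then show ?thesis using segment_integral_directional(1)[OF assms(1,2)] by simp
qed

section \<open>Symmetry of second derivatives\<close>

text \<open>Two applications of the mean value theorem, first along \<open>u\<close> and then along \<open>v\<close>.  As the left-hand
  side is symmetric in \<open>u\<close> and \<open>v\<close>, exchanging the two directions expresses it through the other
  mixed derivative as well.\<close>

lemma second_difference_mean_value:
  fixes f :: "'e::euclidean_space \<Rightarrow> real"
  assumes f: "smooth_fun_on S f" and t: "t > 0"
    and S: "\<And>a b. a \<in> {0..t} \<Longrightarrow> b \<in> {0..t} \<Longrightarrow> x + a *\<^sub>R u + b *\<^sub>R v \<in> S"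
  shows "\<exists>a\<in>{0..t}. \<exists>b\<in>{0..t}.
    f (x + t *\<^sub>R u + t *\<^sub>R v) - f (x + t *\<^sub>R u) - f (x + t *\<^sub>R v) + f x
    = t * t * frechet_derivative (\<lambda>y. frechet_derivative f (at y) u) (at (x + a *\<^sub>R u + b *\<^sub>R v)) v"
proof -
  let ?D = "\<lambda>y. frechet_derivative f (at y) u"
  have comm: "x + a *\<^sub>R u + b *\<^sub>R v = x + b *\<^sub>R v + a *\<^sub>R u" for a b by simp
  have "((\<lambda>a. f (x + t *\<^sub>R v + a *\<^sub>R u) - f (x + a *\<^sub>R u)) has_real_derivative
     (?D (x + t *\<^sub>R v + a *\<^sub>R u) - ?D (x + a *\<^sub>R u))) (at a)" if "0 \<le> a" "a \<le> t" for a
    using S[of a t] S[of a 0] that t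
    by (intro DERIV_diff smooth_fun_on_line_derivative[OF f]) (auto simp: add_ac)
  from MVT2[OF t this] obtain a where a: "a > 0" "a < t"
    "f (x + t *\<^sub>R v + t *\<^sub>R u) - f (x + t *\<^sub>R u) - (f (x + t *\<^sub>R v + 0 *\<^sub>R u) - f (x + 0 *\<^sub>R u))
      = (t - 0) * (?D (x + t *\<^sub>R v + a *\<^sub>R u) - ?D (x + a *\<^sub>R u))" by auto
  have "((\<lambda>b. ?D (x + a *\<^sub>R u + b *\<^sub>R v)) has_real_derivative
     frechet_derivative ?D (at (x + a *\<^sub>R u + b *\<^sub>R v)) v) (at b)" if "0 \<le> b" "b \<le> t" for b
    using S[of a b] that a
    by (intro smooth_fun_on_line_derivative[OF smooth_fun_on_directional[OF f]]) auto
  from MVT2[OF t this] obtain b where b: "b > 0" "b < t"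
    "?D (x + a *\<^sub>R u + t *\<^sub>R v) - ?D (x + a *\<^sub>R u + 0 *\<^sub>R v)
       = (t - 0) * frechet_derivative ?D (at (x + a *\<^sub>R u + b *\<^sub>R v)) v" by auto
  show ?thesis
    by (rule bexI[of _ a], rule bexI[of _ b]) (use a b in \<open>auto simp: algebra_simps\<close>)
qed

lemma symmetric_second_derivative:
  fixes f :: "'e::euclidean_space \<Rightarrow> real"
  assumes "open S" "smooth_fun_on S f" "x \<in> S"
  shows "frechet_derivative (\<lambda>y. frechet_derivative f (at y) u) (at x) v
       = frechet_derivative (\<lambda>y. frechet_derivative f (at y) v) (at x) u"
proof -
  define F where "F = (\<lambda>y. frechet_derivative (\<lambda>y. frechet_derivative f (at y) u) (at y) v)"
  define G where "G = (\<lambda>y. frechet_derivative (\<lambda>y. frechet_derivative f (at y) v) (at y) u)"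
  have cont: "isCont F x" "isCont G x"
    using smooth_fun_on_continuous_on[OF smooth_fun_on_directional[OF smooth_fun_on_directional[OF assms(2)]]] assms(1,3)
    unfolding F_def G_def by (auto simp: continuous_on_eq_continuous_at)
  have "dist (F x) (G x) < e" if e: "e > 0" for e
  proof -
    obtain d1 where d1: "d1 > 0" "\<And>y. dist y x < d1 \<Longrightarrow> dist (F y) (F x) < e / 2"
      using cont(1) e unfolding continuous_at_eps_delta by (meson half_gt_zero)
    obtain d2 where d2: "d2 > 0" "\<And>y. dist y x < d2 \<Longrightarrow> dist (G y) (G x) < e / 2"
      using cont(2) e unfolding continuous_at_eps_delta by (meson half_gt_zero)
    obtain d3 where d3: "d3 > 0" "ball x d3 \<subseteq> S" using assms(1,3) openE by blast
    define d where "d = min d1 (min d2 d3)"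
    \<comment> \<open>The scale at which all points of the parallelogram spanned by t u and t v are d-close to x.\<close>
    define t where "t = d / (2 * (norm u + norm v + 1))"
    have n: "norm u + norm v + 1 > 0" by (smt (verit) norm_ge_zero)
    have t: "t > 0" using d1(1) d2(1) d3(1) n by (simp add: t_def d_def)
    have near: "dist (x + a *\<^sub>R u + b *\<^sub>R v) x < d" if "a \<in> {0..t}" "b \<in> {0..t}" for a b
    proof -
      have "dist (x + a *\<^sub>R u + b *\<^sub>R v) x = norm (a *\<^sub>R u + b *\<^sub>R v)" by (simp add: dist_norm)
      also have "\<dots> \<le> a * norm u + b * norm v"
        using norm_triangle_ineq[of "a *\<^sub>R u" "b *\<^sub>R v"] that by simp
      also have "\<dots> \<le> t * norm u + t * norm v" using that by (intro add_mono mult_right_mono) auto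
      also have "\<dots> < t * (2 * (norm u + norm v + 1))" using t mult_nonneg_nonneg[of t "norm u"] mult_nonneg_nonneg[of t "norm v"]
        by (simp add: algebra_simps add_nonneg_pos)
      also have "\<dots> = d" using n by (simp add: t_def)
      finally show ?thesis .
    qed
    have inS: "x + a *\<^sub>R u + b *\<^sub>R v \<in> S" if "a \<in> {0..t}" "b \<in> {0..t}" for a b
      using near[OF that] d3(2) by (auto simp: d_def dist_commute)
    obtain a b where ab: "a \<in> {0..t}" "b \<in> {0..t}"
      "f (x + t *\<^sub>R u + t *\<^sub>R v) - f (x + t *\<^sub>R u) - f (x + t *\<^sub>R v) + f x = t * t * F (x + a *\<^sub>R u + b *\<^sub>R v)"
      using second_difference_mean_value[OF assms(2) t inS] unfolding F_def by blast
    have inS': "x + a *\<^sub>R v + b *\<^sub>R u \<in> S" if "a \<in> {0..t}" "b \<in> {0..t}" for a b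
      using inS[OF that(2,1)] by (simp add: add_ac)
    obtain b' a' where ab': "a' \<in> {0..t}" "b' \<in> {0..t}"
      "f (x + t *\<^sub>R v + t *\<^sub>R u) - f (x + t *\<^sub>R v) - f (x + t *\<^sub>R u) + f x = t * t * G (x + b' *\<^sub>R v + a' *\<^sub>R u)"
      using second_difference_mean_value[OF assms(2) t inS'] unfolding G_def by blast
    have "t * t * F (x + a *\<^sub>R u + b *\<^sub>R v) = t * t * G (x + b' *\<^sub>R v + a' *\<^sub>R u)"
      using ab(3) ab'(3)[unfolded add.assoc add.commute[of "t *\<^sub>R v"]] unfolding add.assoc by linarith
    then have eq: "F (x + a *\<^sub>R u + b *\<^sub>R v) = G (x + a' *\<^sub>R u + b' *\<^sub>R v)"
      using t by (simp add: add_ac)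
    have "dist (F (x + a *\<^sub>R u + b *\<^sub>R v)) (F x) < e / 2"
      using d1(2) near[OF ab(1,2)] by (simp add: d_def)
    moreover have "dist (F (x + a *\<^sub>R u + b *\<^sub>R v)) (G x) < e / 2"
      unfolding eq using d2(2) near[OF ab'(1,2)] by (simp add: d_def)
    ultimately show ?thesis
      using dist_triangle3[of "F x" "G x" "F (x + a *\<^sub>R u + b *\<^sub>R v)"] by linarith
  qed
  then have "F x = G x" by (metis dist_self less_irrefl zero_less_dist_iff)
  then show ?thesis by (simp add: F_def G_def)
qed

section \<open>A smooth cutoff function\<close>

lemma smooth_fun_on_real_derivI:
  fixes f :: "real \<Rightarrow> real"
  assumes "open S" "\<And>x. x \<in> S \<Longrightarrow> (f has_real_derivative f' x) (at x)" "smooth_fun_on S f'"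
  shows "smooth_fun_on S f"
  by (rule smooth_fun_onI[OF assms(1) assms(2)[unfolded has_field_derivative_def]])
    (auto intro: smooth_fun_on_mult assms)

lemma smooth_fun_on_inverse: "smooth_fun_on {0<..} (inverse :: real \<Rightarrow> real)"
proof -
  have "times_differentiable_on n {0<..} (inverse :: real \<Rightarrow> real)" for n
  proof (induction n)
    case 0
    then show ?case by (auto intro!: continuous_intros)
  next
    case (Suc n)
    show ?case
    proof (rule times_differentiable_on_SucI)
      fix x :: real assume "x \<in> {0<..}"
      then have "(inverse has_real_derivative - 1 * (inverse x * inverse x)) (at x)"
        using DERIV_inverse[of x UNIV] by (simp add: power2_eq_square)
      then show "(inverse has_derivative (\<lambda>h. (- 1 * (inverse x * inverse x)) * h)) (at x)"
        by (simp only: has_field_derivative_def)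
    next
      fix v :: real
      show "times_differentiable_on n {0<..} (\<lambda>x. (- 1 * (inverse x * inverse x)) * v)"
        by (intro times_differentiable_on_mult times_differentiable_on_const Suc) auto
    qed simp
  qed
  then show ?thesis by (simp add: smooth_fun_on_def)
qed

lemma smooth_fun_on_ln: "smooth_fun_on {0<..} (ln :: real \<Rightarrow> real)"
  by (rule smooth_fun_on_real_derivI[OF _ _ smooth_fun_on_inverse])
    (auto intro!: derivative_eq_intros simp: field_simps)

text \<open>The powers of \<open>1 / x\<close> make this family of flat functions closed under differentiation.\<close>

definition flat_exp :: "nat \<Rightarrow> real \<Rightarrow> real" where
  "flat_exp m x = (if x > 0 then (1 / x) ^ m * exp (- 1 / x) else 0)"

lemma flat_exp_has_derivative:
  "(flat_exp m has_real_derivative (- real m * flat_exp (m + 1) x + flat_exp (m + 2) x)) (at x)"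
proof -
  consider "x > 0" | "x < 0" | "x = 0" by linarith
  then show ?thesis
  proof cases
    case 1
    define y where "y = 1 / x"
    have d: "((\<lambda>x. 1 / x) has_real_derivative - (y * y)) (at x)"
      and e: "((\<lambda>x. - 1 / x) has_real_derivative y * y) (at x)"
      using 1 by (auto intro!: derivative_eq_intros simp: y_def)
    have "((\<lambda>x. (1 / x) ^ m * exp (- 1 / x)) has_real_derivative
        (- real m * flat_exp (m + 1) x + flat_exp (m + 2) x)) (at x)"
      by (rule DERIV_cong[OF DERIV_mult[OF DERIV_power[OF d] DERIV_chain2[OF DERIV_exp e]]],
          unfold flat_exp_def y_def[symmetric]) (use 1 in \<open>cases m; simp add: algebra_simps\<close>)
    then show ?thesis
      by (rule has_field_derivative_transform_within_open[where S="{0<..}"]) (use 1 in \<open>auto simp: flat_exp_def\<close>)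
  next
    case 2
    have "((\<lambda>x. 0) has_real_derivative 0) (at x)" by simp
    then have "(flat_exp m has_real_derivative 0) (at x)"
      by (rule has_field_derivative_transform_within_open[where S="{..<0}"]) (use 2 in \<open>auto simp: flat_exp_def\<close>)
    then show ?thesis using 2 by (simp add: flat_exp_def)
  next
    case 3
    have "((\<lambda>y::real. (1 / y) ^ m * exp (- 1 / y) / y) \<longlongrightarrow> 0) (at_right 0)"
      by real_asymp
    then have r: "((\<lambda>y. flat_exp m y / y) \<longlongrightarrow> 0) (at_right 0)"
      by (rule filterlim_cong[THEN iffD1, rotated -1])
        (auto simp: flat_exp_def eventually_at_right_less intro: eventually_mono[OF eventually_at_right_less])
    have "((\<lambda>y. 0::real) \<longlongrightarrow> 0) (at_left 0)" by simp
    then have l: "((\<lambda>y. flat_exp m y / y) \<longlongrightarrow> 0) (at_left 0)"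
      by (rule filterlim_cong[THEN iffD1, rotated -1])
        (auto simp: flat_exp_def eventually_at_filter)
    from l r have "((\<lambda>y. flat_exp m y / y) \<longlongrightarrow> 0) (at 0)"
      by (simp add: filterlim_at_split)
    then show ?thesis using 3 by (simp add: has_field_derivative_iff flat_exp_def)
  qed
qed

lemma smooth_fun_on_flat_exp: "smooth_fun_on UNIV (flat_exp m)"
proof -
  have "times_differentiable_on n UNIV (flat_exp m)" for n
  proof (induction n arbitrary: m)
    case 0
    show ?case by (auto intro!: continuous_at_imp_continuous_on DERIV_isCont[OF flat_exp_has_derivative])
  next
    case (Suc n)
    show ?case
      by (rule times_differentiable_on_SucI[OF _ flat_exp_has_derivative[unfolded has_field_derivative_def]])
        (intro times_differentiable_on_mult times_differentiable_on_add times_differentiable_on_const Suc open_UNIV)+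
  qed
  then show ?thesis by (simp add: smooth_fun_on_def)
qed

lemma smooth_cutoff_exists:
  "\<exists>h::real \<Rightarrow> real. smooth_fun_on UNIV h \<and> (\<forall>t\<le>1. h t = 0) \<and> (\<forall>t\<ge>2. h t = 1)"
proof -
  define \<phi> where "\<phi> = flat_exp 0"
  have aff: "smooth_fun_on UNIV (\<lambda>t. \<phi> (c *\<^sub>R t + d))" for c d :: real
    unfolding \<phi>_def by (rule smooth_fun_on_affine[OF _ _ _ smooth_fun_on_flat_exp]) (auto intro: linear_scaleR)
  \<comment> \<open>The cutoff is the quotient of f (t - 1) by f (t - 1) + f (2 - t); one of the two summands is always positive.\<close>
  have pos: "\<phi> (1 *\<^sub>R t + - 1) + \<phi> (- 1 *\<^sub>R t + 2) \<in> {0<..}" for t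
    by (auto simp: \<phi>_def flat_exp_def intro: add_pos_pos)
  define h where "h t = \<phi> (1 *\<^sub>R t + - 1) * inverse (\<phi> (1 *\<^sub>R t + - 1) + \<phi> (- 1 *\<^sub>R t + 2))" for t :: real
  have "smooth_fun_on UNIV h" unfolding h_def
    by (intro smooth_fun_on_mult aff smooth_fun_on_compose_real[OF _ _ smooth_fun_on_inverse] smooth_fun_on_add)
      (use pos in auto)
  moreover have "h t = 0" if "t \<le> 1" for t using that by (simp add: h_def \<phi>_def flat_exp_def)
  moreover have "h t = 1" if "t \<ge> 2" for t using that by (simp add: h_def \<phi>_def flat_exp_def)
  ultimately show ?thesis by blast
qed

section \<open>Derivatives of algebraic combinations\<close>

lemma frechet_derivative_add:
  assumes "smooth_fun_on S f" "smooth_fun_on S g" "x \<in> S"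
  shows "frechet_derivative (\<lambda>y. f y + g y) (at x) v
     = frechet_derivative f (at x) v + frechet_derivative g (at x) v"
  using frechet_derivative_at[OF has_derivative_add[OF smooth_fun_on_has_derivative[OF assms(1,3)]
      smooth_fun_on_has_derivative[OF assms(2,3)]]] by metis

lemma frechet_derivative_diff:
  assumes "smooth_fun_on S f" "smooth_fun_on S g" "x \<in> S"
  shows "frechet_derivative (\<lambda>y. f y - g y) (at x) v
     = frechet_derivative f (at x) v - frechet_derivative g (at x) v"
  using frechet_derivative_at[OF has_derivative_diff[OF smooth_fun_on_has_derivative[OF assms(1,3)]
      smooth_fun_on_has_derivative[OF assms(2,3)]]] by metis

lemma frechet_derivative_mult:
  fixes f g :: "'e::euclidean_space \<Rightarrow> real"
  assumes "smooth_fun_on S f" "smooth_fun_on S g" "x \<in> S"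
  shows "frechet_derivative (\<lambda>y. f y * g y) (at x) v
     = f x * frechet_derivative g (at x) v + frechet_derivative f (at x) v * g x"
  using frechet_derivative_at[OF has_derivative_mult[OF smooth_fun_on_has_derivative[OF assms(1,3)]
      smooth_fun_on_has_derivative[OF assms(2,3)]]] by metis

lemma frechet_derivative_cmult:
  fixes f :: "'e::euclidean_space \<Rightarrow> real"
  assumes "smooth_fun_on S f" "x \<in> S"
  shows "frechet_derivative (\<lambda>y. c * f y) (at x) v = c * frechet_derivative f (at x) v"
  using frechet_derivative_at[OF has_derivative_mult_right[OF smooth_fun_on_has_derivative[OF assms], of c]] by metis

lemma frechet_derivative_affine:
  fixes L :: "'a::euclidean_space \<Rightarrow> 'b::euclidean_space"
  assumes "linear L" "smooth_fun_on T f" "L x + c \<in> T"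
  shows "frechet_derivative (\<lambda>y. f (L y + c)) (at x) v = frechet_derivative f (at (L x + c)) (L v)"
proof -
  have "((\<lambda>x. L x + c) has_derivative L) (at x)"
    using assms(1) by (auto intro!: derivative_eq_intros bounded_linear_imp_has_derivative
        simp: linear_conv_bounded_linear)
  from frechet_derivative_at[OF has_derivative_compose[OF this smooth_fun_on_has_derivative[OF assms(2,3)]]]
  show ?thesis by metis
qed

section \<open>Alternating forms\<close>

lemma omit_0 [simp]: "omit 0 (v # vs) = vs"
  and omit_Suc [simp]: "omit (Suc i) (v # vs) = v # omit i vs"
  by (auto simp: omit_def)

lemma length_omit [simp]: "i < length vs \<Longrightarrow> length (omit i vs) = length vs - 1"
  by (simp add: omit_def)

lemma map_omit: "map f (omit i vs) = omit i (map f vs)"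
  by (simp add: omit_def take_map drop_map)

lemma alternating_multilinearD:
  assumes "alternating_multilinear k f" "length vs = k"
  shows alternating_multilinear_linear: "i < k \<Longrightarrow> linear (\<lambda>v. f (vs[i := v]))"
    and alternating_multilinear_repeat:
      "i < k \<Longrightarrow> j < k \<Longrightarrow> i \<noteq> j \<Longrightarrow> vs ! i = vs ! j \<Longrightarrow> f vs = 0"
  using assms unfolding alternating_multilinear_def by blast+

lemma alternating_multilinearI:
  assumes "\<And>vs i v w. length vs = k \<Longrightarrow> i < k \<Longrightarrow> f (vs[i := v + w]) = f (vs[i := v]) + f (vs[i := w])"
    and "\<And>vs i r v. length vs = k \<Longrightarrow> i < k \<Longrightarrow> f (vs[i := r *\<^sub>R v]) = r * f (vs[i := v])"
    and "\<And>vs i j. length vs = k \<Longrightarrow> i < k \<Longrightarrow> j < k \<Longrightarrow> i \<noteq> j \<Longrightarrow> vs ! i = vs ! j \<Longrightarrow> f vs = 0"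
  shows "alternating_multilinear k f"
  unfolding alternating_multilinear_def using assms by (auto intro!: linearI)

lemma alternating_multilinear_add_slot:
  assumes "alternating_multilinear k f" "length vs = k" "i < k"
  shows "f (vs[i := v + w]) = f (vs[i := v]) + f (vs[i := w])"
  using linear_add[OF alternating_multilinear_linear[OF assms]] .

lemma alternating_multilinear_scale_slot:
  assumes "alternating_multilinear k f" "length vs = k" "i < k"
  shows "f (vs[i := r *\<^sub>R v]) = r * f (vs[i := v])"
  using linear_cmul[OF alternating_multilinear_linear[OF assms]] by simp

lemma alternating_multilinear_add:
  assumes "alternating_multilinear k f" "alternating_multilinear k g"
  shows "alternating_multilinear k (\<lambda>vs. f vs + g vs)"
proof (rule alternating_multilinearI)
  fix vs :: "'a list" and i j assume "length vs = k" "i < k" "j < k" "i \<noteq> j" "vs ! i = vs ! j"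
  then show "f vs + g vs = 0"
    using assms[THEN alternating_multilinear_repeat, of vs i j] by simp
qed (use assms in \<open>auto simp: alternating_multilinear_add_slot alternating_multilinear_scale_slot
       algebra_simps\<close>)

lemma alternating_multilinear_scale:
  assumes "alternating_multilinear k f"
  shows "alternating_multilinear k (\<lambda>vs. c * f vs)"
  by (rule alternating_multilinearI)
    (use assms in \<open>auto simp: alternating_multilinear_add_slot alternating_multilinear_scale_slot
       algebra_simps dest: alternating_multilinear_repeat\<close>)

lemma alternating_multilinear_zero: "alternating_multilinear k (\<lambda>vs. 0)"
  by (rule alternating_multilinearI) auto

lemma alternating_multilinear_map:
  fixes L :: "'b::real_vector \<Rightarrow> 'a::real_vector"
  assumes "alternating_multilinear k f" "linear L"
  shows "alternating_multilinear k (\<lambda>vs. f (map L vs))"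
proof (rule alternating_multilinearI)
  fix vs :: "'b list" and i j assume "length vs = k" "i < k" "j < k" "i \<noteq> j" "vs ! i = vs ! j"
  then show "f (map L vs) = 0"
    using alternating_multilinear_repeat[OF assms(1), of "map L vs" i j] by simp
qed (use assms in \<open>auto simp: map_update linear_add linear_cmul alternating_multilinear_add_slot
      alternating_multilinear_scale_slot\<close>)

lemma alternating_multilinear_contract:
  assumes "alternating_multilinear (Suc k) f"
  shows "alternating_multilinear k (\<lambda>vs. f (u # vs))"
proof (rule alternating_multilinearI)
  fix vs :: "'a list" and i v w assume "length vs = k" "i < k"
  then show "f (u # vs[i := v + w]) = f (u # vs[i := v]) + f (u # vs[i := w])"
    using alternating_multilinear_add_slot[OF assms, of "u # vs" "Suc i"] by simp
next
  fix vs :: "'a list" and i r v assume "length vs = k" "i < k"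
  then show "f (u # vs[i := r *\<^sub>R v]) = r * f (u # vs[i := v])"
    using alternating_multilinear_scale_slot[OF assms, of "u # vs" "Suc i"] by simp
next
  fix vs :: "'a list" and i j assume "length vs = k" "i < k" "j < k" "i \<noteq> j" "vs ! i = vs ! j"
  then show "f (u # vs) = 0"
    using alternating_multilinear_repeat[OF assms, of "u # vs" "Suc i" "Suc j"] by simp
qed

text \<open>Integrals and directional derivatives act linearly on coefficient functions and see their values
  on \<open>S\<close> only.  This is all that is needed to carry the alternating property over from the form to
  the transformed form.\<close>

lemma alternating_multilinear_transform:
  fixes T :: "('b \<Rightarrow> real) \<Rightarrow> real" and \<omega> :: "'b \<Rightarrow> 'a::real_vector list \<Rightarrow> real"
  assumes \<omega>: "\<And>y. y \<in> S \<Longrightarrow> alternating_multilinear k (\<omega> y)"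
    and add: "\<And>vs ws. T (\<lambda>y. \<omega> y vs + \<omega> y ws) = T (\<lambda>y. \<omega> y vs) + T (\<lambda>y. \<omega> y ws)"
    and scale: "\<And>r vs. T (\<lambda>y. r * \<omega> y vs) = r * T (\<lambda>y. \<omega> y vs)"
    and cong: "\<And>f g. (\<And>y. y \<in> S \<Longrightarrow> f y = g y) \<Longrightarrow> T f = T g"
  shows "alternating_multilinear k (\<lambda>ws. T (\<lambda>y. \<omega> y ws))"
proof (rule alternating_multilinearI)
  fix vs :: "'a list" and i v w assume vs: "length vs = k" "i < k"
  have "T (\<lambda>y. \<omega> y (vs[i := v + w])) = T (\<lambda>y. \<omega> y (vs[i := v]) + \<omega> y (vs[i := w]))"
    by (rule cong) (use vs alternating_multilinear_add_slot[OF \<omega>] in auto)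
  then show "T (\<lambda>y. \<omega> y (vs[i := v + w])) = T (\<lambda>y. \<omega> y (vs[i := v])) + T (\<lambda>y. \<omega> y (vs[i := w]))"
    by (simp only: add)
next
  fix vs :: "'a list" and i r v assume vs: "length vs = k" "i < k"
  have "T (\<lambda>y. \<omega> y (vs[i := r *\<^sub>R v])) = T (\<lambda>y. r * \<omega> y (vs[i := v]))"
    by (rule cong) (use vs alternating_multilinear_scale_slot[OF \<omega>] in auto)
  then show "T (\<lambda>y. \<omega> y (vs[i := r *\<^sub>R v])) = r * T (\<lambda>y. \<omega> y (vs[i := v]))"
    by (simp only: scale)
next
  fix vs :: "'a list" and i j assume vs: "length vs = k" "i < k" "j < k" "i \<noteq> j" "vs ! i = vs ! j"
  have "T (\<lambda>y. \<omega> y vs) = T (\<lambda>y. 0 * \<omega> y vs)"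
    by (rule cong) (use vs alternating_multilinear_repeat[OF \<omega>] in auto)
  also have "\<dots> = 0 * T (\<lambda>y. \<omega> y vs)" by (rule scale)
  finally show "T (\<lambda>y. \<omega> y vs) = 0" by simp
qed

lemma form_onD:
  assumes "form_on k S \<omega>"
  shows form_on_alternating: "x \<in> S \<Longrightarrow> alternating_multilinear k (\<omega> x)"
    and form_on_smooth: "smooth_fun_on S (\<lambda>x. \<omega> x vs)"
    and form_on_outside: "x \<notin> S \<Longrightarrow> \<omega> x vs = 0"
    and form_on_length: "length vs \<noteq> k \<Longrightarrow> \<omega> x vs = 0"
  using assms unfolding form_on_def by blast+

lemma form_on_continuous_on: "form_on k S \<omega> \<Longrightarrow> continuous_on S (\<lambda>x. \<omega> x vs)"
  by (rule smooth_fun_on_continuous_on[OF form_on_smooth])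

lemma form_onI:
  assumes "\<And>x. x \<in> S \<Longrightarrow> alternating_multilinear k (\<omega> x)" "\<And>vs. smooth_fun_on S (\<lambda>x. \<omega> x vs)"
    "\<And>x vs. x \<notin> S \<Longrightarrow> \<omega> x vs = 0" "\<And>x vs. x \<in> S \<Longrightarrow> length vs \<noteq> k \<Longrightarrow> \<omega> x vs = 0"
  shows "form_on k S \<omega>"
  unfolding form_on_def using assms by blast

lemma form_on_fun_mult:
  assumes "open S" "form_on k S \<omega>" "smooth_fun_on S g"
  shows "form_on k S (\<lambda>x vs. g x * \<omega> x vs)"
  by (rule form_onI) (auto simp: form_on_outside[OF assms(2)] form_on_length[OF assms(2)]
      intro!: alternating_multilinear_scale smooth_fun_on_mult assms form_on_alternating[OF assms(2)]
        form_on_smooth[OF assms(2)])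

lemma form_on_zero: "form_on k S (\<lambda>x vs. 0)"
  by (rule form_onI) (auto intro: alternating_multilinear_zero)

lemma form_on_add:
  assumes "open S" "form_on k S \<omega>" "form_on k S \<sigma>"
  shows "form_on k S (\<lambda>x vs. \<omega> x vs + \<sigma> x vs)"
  by (rule form_onI) (auto simp: assms(2,3)[THEN form_on_outside] assms(2,3)[THEN form_on_length]
      intro!: alternating_multilinear_add smooth_fun_on_add assms assms(2,3)[THEN form_on_alternating]
        assms(2,3)[THEN form_on_smooth])

lemma form_on_scale:
  "open S \<Longrightarrow> form_on k S \<omega> \<Longrightarrow> form_on k S (\<lambda>x vs. c * \<omega> x vs)"
  by (rule form_on_fun_mult) auto

lemma form_on_diff:
  assumes "open S" "form_on k S \<omega>" "form_on k S \<sigma>"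
  shows "form_on k S (\<lambda>x vs. \<omega> x vs - \<sigma> x vs)"
  using form_on_add[OF assms(1,2) form_on_scale[OF assms(1,3), of "-1"]] by simp

lemma form_on_sum:
  assumes "open S" "\<And>i. i \<in> I \<Longrightarrow> form_on k S (\<omega> i)"
  shows "form_on k S (\<lambda>x vs. \<Sum>i\<in>I. \<omega> i x vs)"
  using assms(2) by (induction I rule: infinite_finite_induct) (auto intro: form_on_zero form_on_add assms(1))

lemma form_on_contract:
  assumes "form_on (Suc k) S \<omega>"
  shows "form_on k S (\<lambda>x vs. \<omega> x (u # vs))"
  by (rule form_onI) (auto simp: form_on_outside[OF assms] form_on_length[OF assms]
      intro!: form_on_smooth[OF assms] alternating_multilinear_contract form_on_alternating[OF assms])

lemma form_on_const:
  assumes "open S" "alternating_multilinear k c" "\<And>vs. length vs \<noteq> k \<Longrightarrow> c vs = 0"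
  shows "form_on k S (\<lambda>x vs. if x \<in> S then c vs else 0)"
proof (rule form_onI)
  fix vs
  show "smooth_fun_on S (\<lambda>x. if x \<in> S then c vs else 0)"
    by (rule smooth_fun_on_cong[OF assms(1) _ smooth_fun_on_const[of S "c vs"]]) auto
qed (use assms in auto)

lemma form_on_pullback:
  assumes "open S" "linear L" "\<And>x. L x \<in> S \<longleftrightarrow> x \<in> S" "form_on k S \<omega>"
  shows "form_on k S (\<lambda>x vs. \<omega> (L x) (map L vs))"
proof (rule form_onI)
  fix vs
  show "smooth_fun_on S (\<lambda>x. \<omega> (L x) (map L vs))"
    using smooth_fun_on_affine[OF assms(1,2), of 0 S "\<lambda>x. \<omega> x (map L vs)"] assms
    by (simp add: form_on_smooth)
qed (use assms in \<open>auto intro: form_onD alternating_multilinear_map\<close>)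

lemma form_on_restrict:
  assumes "open V" "V \<subseteq> S" "form_on k S \<omega>"
  shows "form_on k V (\<lambda>p vs. if p \<in> V then \<omega> p vs else 0)"
proof (rule form_onI)
  fix vs
  show "smooth_fun_on V (\<lambda>p. if p \<in> V then \<omega> p vs else 0)"
    by (rule smooth_fun_on_cong[OF assms(1) _ smooth_fun_on_subset[OF form_on_smooth[OF assms(3), of vs] assms(2)]]) auto
qed (use assms(2) form_on_alternating[OF assms(3)] form_on_length[OF assms(3)] in auto)

lemma form_on_segment_integral:
  fixes u :: "'e::euclidean_space"
  assumes S: "open S" "convex S" "\<And>x s. x \<in> S \<Longrightarrow> s \<in> {0..1} \<Longrightarrow> x + s *\<^sub>R u \<in> S"
    and k: "continuous_on {0..1} k" and \<omega>: "form_on j S \<omega>"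
  shows "form_on j S (\<lambda>x vs. if x \<in> S then segment_integral k u (\<lambda>y. \<omega> y vs) x else 0)"
proof (rule form_onI)
  fix x assume x: "x \<in> S"
  have "alternating_multilinear j (\<lambda>vs. segment_integral k u (\<lambda>y. \<omega> y vs) x)"
    by (rule alternating_multilinear_transform[where T="\<lambda>f. segment_integral k u f x" and S=S])
      (auto simp: segment_integral_cmult
        intro: segment_integral_add[OF S(3)[OF x] k form_on_continuous_on[OF \<omega>] form_on_continuous_on[OF \<omega>]]
          form_on_alternating[OF \<omega>] segment_integral_cong S(3)[OF x])
  then show "alternating_multilinear j (\<lambda>vs. if x \<in> S then segment_integral k u (\<lambda>y. \<omega> y vs) x else 0)"
    using x by simp
next
  fix vs
  show "smooth_fun_on S (\<lambda>x. if x \<in> S then segment_integral k u (\<lambda>y. \<omega> y vs) x else 0)"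
    by (rule smooth_fun_on_cong[OF S(1) _ smooth_fun_on_segment_integral[OF S(1,1,2,3) k form_on_smooth[OF \<omega>, of vs]]])
      auto
qed (use \<omega> in \<open>auto simp: form_on_length\<close>)

section \<open>The exterior derivative\<close>

lemma ext_deriv_cong:
  assumes "open S" "\<And>y vs. y \<in> S \<Longrightarrow> \<omega> y vs = \<sigma> y vs"
  shows "ext_deriv S \<omega> = ext_deriv S \<sigma>"
proof (intro ext)
  fix x vs
  have "frechet_derivative (\<lambda>y. \<omega> y ws) (at x) = frechet_derivative (\<lambda>y. \<sigma> y ws) (at x)" if "x \<in> S" for ws
    by (rule frechet_derivative_cong_open[OF assms(1) that]) (use assms in auto)
  then show "ext_deriv S \<omega> x vs = ext_deriv S \<sigma> x vs" by (simp add: ext_deriv_def)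
qed

lemma ext_deriv_length:
  assumes "form_on k S \<omega>" "length vs \<noteq> Suc k"
  shows "ext_deriv S \<omega> x vs = 0"
proof -
  have "frechet_derivative (\<lambda>y. \<omega> y (omit i vs)) (at x) v = 0" if "i < length vs" for i v
  proof -
    have "(\<lambda>y. \<omega> y (omit i vs)) = (\<lambda>y. 0)"
      using that assms by (intro ext form_on_length[OF assms(1)]) auto
    then show ?thesis by simp
  qed
  then show ?thesis by (simp add: ext_deriv_def)
qed

lemma ext_deriv_add:
  assumes "form_on k S \<omega>" "form_on k S \<sigma>"
  shows "ext_deriv S (\<lambda>y ws. \<omega> y ws + \<sigma> y ws) x vs = ext_deriv S \<omega> x vs + ext_deriv S \<sigma> x vs"
  by (simp add: ext_deriv_def frechet_derivative_add[OF form_on_smooth[OF assms(1)] form_on_smooth[OF assms(2)]]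
      sum.distrib algebra_simps)

lemma ext_deriv_scale:
  assumes "form_on k S \<omega>"
  shows "ext_deriv S (\<lambda>y ws. c * \<omega> y ws) x vs = c * ext_deriv S \<omega> x vs"
  by (simp add: ext_deriv_def frechet_derivative_cmult[OF form_on_smooth[OF assms(1)]]
      sum_distrib_left algebra_simps)

lemma ext_deriv_diff:
  assumes "open S" "form_on k S \<omega>" "form_on k S \<sigma>"
  shows "ext_deriv S (\<lambda>y ws. \<omega> y ws - \<sigma> y ws) x vs = ext_deriv S \<omega> x vs - ext_deriv S \<sigma> x vs"
  using ext_deriv_add[OF assms(2) form_on_scale[OF assms(1,3), of "-1"]] ext_deriv_scale[OF assms(3), of "-1"]
  by simp

lemma ext_deriv_fun_mult:
  assumes "form_on k S \<omega>" "smooth_fun_on S g" "x \<in> S"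
  shows "ext_deriv S (\<lambda>y ws. g y * \<omega> y ws) x vs = g x * ext_deriv S \<omega> x vs
    + (\<Sum>i<length vs. (-1) ^ i * frechet_derivative g (at x) (vs ! i) * \<omega> x (omit i vs))"
  using assms by (simp add: ext_deriv_def frechet_derivative_mult[OF assms(2) form_on_smooth[OF assms(1)]]
      sum.distrib sum_distrib_left algebra_simps)

lemma ext_deriv_pullback:
  assumes "linear L" "\<And>x. L x \<in> S \<longleftrightarrow> x \<in> S" "form_on k S \<omega>"
  shows "ext_deriv S (\<lambda>y ws. \<omega> (L y) (map L ws)) x vs = ext_deriv S \<omega> (L x) (map L vs)"
proof (cases "x \<in> S")
  case True
  then have "frechet_derivative (\<lambda>y. \<omega> (L y) (map L ws)) (at x) v
      = frechet_derivative (\<lambda>y. \<omega> y (map L ws)) (at (L x)) (L v)" for ws v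
    using frechet_derivative_affine[OF assms(1) form_on_smooth[OF assms(3)], of x 0] assms(2) by simp
  then have "frechet_derivative (\<lambda>y. \<omega> (L y) (omit i (map L vs))) (at x) v
      = frechet_derivative (\<lambda>y. \<omega> y (omit i (map L vs))) (at (L x)) (L v)" for i v
    by (metis map_omit)
  then show ?thesis using True assms(2) by (simp add: ext_deriv_def map_omit)
qed (use assms in \<open>simp add: ext_deriv_def\<close>)

text \<open>Cartan's formula for the constant vector field \<open>u\<close>: the Lie derivative, which here is the
  directional derivative of the coefficients, is \<open>d i\<^sub>u + i\<^sub>u d\<close>.\<close>

lemma ext_deriv_Cons:
  assumes "x \<in> S"
  shows "ext_deriv S \<omega> x (u # vs)
    = frechet_derivative (\<lambda>y. \<omega> y vs) (at x) u - ext_deriv S (\<lambda>y ws. \<omega> y (u # ws)) x vs"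
  using assms by (simp add: ext_deriv_def sum.lessThan_Suc_shift sum_negf del: sum.lessThan_Suc)

text \<open>Integration along a segment commutes with the directional derivatives of the coefficients.\<close>

lemma ext_deriv_segment_integral:
  fixes u :: "'e::euclidean_space"
  assumes S: "open S" "convex S" "\<And>x s. x \<in> S \<Longrightarrow> s \<in> {0..1} \<Longrightarrow> x + s *\<^sub>R u \<in> S"
    and k: "continuous_on {0..1} k" and \<omega>: "form_on j S \<omega>" and x: "x \<in> S"
  shows "ext_deriv S (\<lambda>y ws. if y \<in> S then segment_integral k u (\<lambda>z. \<omega> z ws) y else 0) x vs
     = segment_integral k u (\<lambda>y. ext_deriv S \<omega> y vs) x"
proof -
  let ?D = "\<lambda>i y. frechet_derivative (\<lambda>z. \<omega> z (omit i vs)) (at y) (vs ! i)"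
  have "ext_deriv S (\<lambda>y ws. if y \<in> S then segment_integral k u (\<lambda>z. \<omega> z ws) y else 0) x vs
     = ext_deriv S (\<lambda>y ws. segment_integral k u (\<lambda>z. \<omega> z ws) y) x vs"
    by (rule arg_cong[where f="\<lambda>F. F x vs"], rule ext_deriv_cong[OF S(1)]) simp
  also have "\<dots> = (\<Sum>i<length vs. (-1) ^ i * segment_integral k u (?D i) x)"
    using x segment_integral_derivative[OF S(1,1,2,3) k form_on_smooth[OF \<omega>] x]
    by (simp add: ext_deriv_def)
  also have "\<dots> = (\<Sum>i<length vs. segment_integral k u (\<lambda>y. (-1) ^ i * ?D i y) x)"
    by (simp add: segment_integral_cmult)
  also have "\<dots> = segment_integral k u (\<lambda>y. \<Sum>i<length vs. (-1) ^ i * ?D i y) x"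
    by (rule segment_integral_sum[symmetric, OF _ S(3)[OF x] k])
      (auto intro!: continuous_intros smooth_fun_on_continuous_on[OF smooth_fun_on_directional[OF form_on_smooth[OF \<omega>]]])
  also have "\<dots> = segment_integral k u (\<lambda>y. ext_deriv S \<omega> y vs) x"
    by (rule segment_integral_cong) (use S(3)[OF x] in \<open>simp add: ext_deriv_def\<close>)
  finally show ?thesis .
qed

text \<open>Let \<open>K\<close> be the integral with weight \<open>s\<close>.  Since \<open>\<omega>\<close> is closed, Cartan's formula gives
  \<open>d (K i\<^sub>u \<omega>) = K (d i\<^sub>u \<omega>) = K (\<partial>\<^sub>u \<omega>)\<close>, and integration by parts evaluates the right-hand side
  for a form with period \<open>u\<close>.\<close>

lemma periodic_homotopy:
  fixes u :: "'e::euclidean_space"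
  assumes S: "open S" "convex S" "\<And>x s. x \<in> S \<Longrightarrow> s \<in> {0..1} \<Longrightarrow> x + s *\<^sub>R u \<in> S"
    and \<omega>: "form_on (Suc j) S \<omega>" and x: "x \<in> S"
    and periodic: "\<omega> (x + u) vs = \<omega> x vs"
    and closed: "\<And>y ws. y \<in> S \<Longrightarrow> ext_deriv S \<omega> y ws = 0"
  shows "ext_deriv S (\<lambda>y ws. if y \<in> S then segment_integral (\<lambda>s. s) u (\<lambda>z. \<omega> z (u # ws)) y else 0) x vs
    = \<omega> x vs - segment_integral (\<lambda>s. 1) u (\<lambda>z. \<omega> z vs) x"
proof -
  have "ext_deriv S (\<lambda>y ws. if y \<in> S then segment_integral (\<lambda>s. s) u (\<lambda>z. \<omega> z (u # ws)) y else 0) x vs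
     = segment_integral (\<lambda>s. s) u (\<lambda>y. ext_deriv S (\<lambda>z ws. \<omega> z (u # ws)) y vs) x"
    by (rule ext_deriv_segment_integral[OF S _ form_on_contract[OF \<omega>] x]) (auto intro: continuous_intros)
  also have "\<dots> = segment_integral (\<lambda>s. s) u (\<lambda>y. frechet_derivative (\<lambda>y. \<omega> y vs) (at y) u) x"
  proof (rule segment_integral_cong)
    fix s :: real assume "s \<in> {0..1}"
    then have y: "x + s *\<^sub>R u \<in> S" by (rule S(3)[OF x])
    show "ext_deriv S (\<lambda>z ws. \<omega> z (u # ws)) (x + s *\<^sub>R u) vs
       = frechet_derivative (\<lambda>y. \<omega> y vs) (at (x + s *\<^sub>R u)) u"
      using ext_deriv_Cons[OF y, of \<omega> u vs] closed[OF y] by simp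
  qed
  also have "\<dots> = \<omega> (x + u) vs - segment_integral (\<lambda>s. 1) u (\<lambda>z. \<omega> z vs) x"
    by (rule segment_integral_directional(2)[OF S(3)[OF x] form_on_smooth[OF \<omega>]])
  finally show ?thesis using periodic by simp
qed

text \<open>In each degree the terms of \<open>d (d \<omega>)\<close> cancel in pairs by the symmetry of second derivatives.\<close>

lemma ext_deriv_ext_deriv_0:
  assumes "open S" "form_on 0 S \<omega>" "x \<in> S"
  shows "ext_deriv S (ext_deriv S \<omega>) x [v, w] = 0"
proof -
  have f: "smooth_fun_on S (\<lambda>y. \<omega> y [])" by (rule form_on_smooth[OF assms(2)])
  have "frechet_derivative (\<lambda>y. ext_deriv S \<omega> y [u]) (at x) u'
     = frechet_derivative (\<lambda>y. frechet_derivative (\<lambda>y. \<omega> y []) (at y) u) (at x) u'" for u u'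
    by (rule fun_cong[OF frechet_derivative_cong_open[OF assms(1,3)]]) (simp add: ext_deriv_def omit_def)
  then show ?thesis
    using assms(3) symmetric_second_derivative[OF assms(1) f assms(3), of v w]
    by (simp add: ext_deriv_def[of S "ext_deriv S \<omega>"] omit_def)
qed

lemma ext_deriv_ext_deriv_1:
  assumes "open S" "form_on 1 S \<omega>" "x \<in> S"
  shows "ext_deriv S (ext_deriv S \<omega>) x [u, v, w] = 0"
proof -
  have f: "smooth_fun_on S (\<lambda>y. \<omega> y [a])" for a by (rule form_on_smooth[OF assms(2)])
  have e: "frechet_derivative (\<lambda>y. ext_deriv S \<omega> y [a, b]) (at x) c =
      frechet_derivative (\<lambda>y. frechet_derivative (\<lambda>y. \<omega> y [b]) (at y) a) (at x) c
        - frechet_derivative (\<lambda>y. frechet_derivative (\<lambda>y. \<omega> y [a]) (at y) b) (at x) c" for a b c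
  proof -
    have "frechet_derivative (\<lambda>y. ext_deriv S \<omega> y [a, b]) (at x)
       = frechet_derivative (\<lambda>y. frechet_derivative (\<lambda>y. \<omega> y [b]) (at y) a -
           frechet_derivative (\<lambda>y. \<omega> y [a]) (at y) b) (at x)"
      by (rule frechet_derivative_cong_open[OF assms(1,3)]) (simp add: ext_deriv_def omit_def)
    then show ?thesis
      using frechet_derivative_diff[OF smooth_fun_on_directional[OF f] smooth_fun_on_directional[OF f] assms(3)]
      by simp
  qed
  show ?thesis
    using assms(3) symmetric_second_derivative[OF assms(1) f assms(3)]
    by (simp add: ext_deriv_def[of S "ext_deriv S \<omega>"] omit_def e numeral_2_eq_2)
qed

section \<open>Height and horizontal directions\<close>

definition height :: "complex \<times> complex \<Rightarrow> real" where
  "height p = Im (snd p)"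

text \<open>The imaginary unit of the second factor, both as the vertical direction and as the base point of
  height 1.\<close>

definition vertical :: "complex \<times> complex" where
  "vertical = (0, \<i>)"

definition horizontal_part :: "complex \<times> complex \<Rightarrow> complex \<times> complex" where
  "horizontal_part p = (fst p, complex_of_real (Re (snd p)))"

lemma mem_C_times_H: "p \<in> C_times_H \<longleftrightarrow> height p > 0"
  by (cases p) (simp add: C_times_H_def height_def)

lemma open_C_times_H: "open C_times_H"
  unfolding C_times_H_def by (intro open_Times open_UNIV open_halfspace_Im_gt)

lemma convex_C_times_H: "convex C_times_H"
  unfolding C_times_H_def by (intro convex_Times convex_UNIV convex_halfspace_Im_gt)

lemma linear_height: "linear height"
  by (rule linearI) (auto simp: height_def)

lemma height_simps [simp]:
  "height (p + q) = height p + height q" "height (p - q) = height p - height q"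
  "height (r *\<^sub>R p) = r * height p" "height vertical = 1" "height (horizontal_part p) = 0"
  by (auto simp: height_def vertical_def horizontal_part_def)

lemma linear_horizontal_part: "linear horizontal_part"
  by (rule linearI) (auto simp: horizontal_part_def prod_eq_iff complex_eq_iff)

lemma horizontal_part_eq: "v = horizontal_part v + height v *\<^sub>R vertical"
  by (auto simp: prod_eq_iff complex_eq_iff horizontal_part_def height_def vertical_def)

lemma horizontal_part_idem: "height v = 0 \<Longrightarrow> horizontal_part v = v"
  using horizontal_part_eq[of v] by simp

lemma translate_C_times_H: "height h = 0 \<Longrightarrow> p + h \<in> C_times_H \<longleftrightarrow> p \<in> C_times_H"
  by (simp add: mem_C_times_H)

lemma segment_in_C_times_H:
  "height h = 0 \<Longrightarrow> p \<in> C_times_H \<Longrightarrow> s \<in> {0..1} \<Longrightarrow> p + s *\<^sub>R h \<in> C_times_H"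
  by (simp add: mem_C_times_H)

lemma smooth_height: "smooth_fun_on C_times_H height"
  by (rule smooth_fun_on_linear[OF open_C_times_H linear_height])

lemma smooth_height_compose:
  "smooth_fun_on {0<..} g \<Longrightarrow> smooth_fun_on C_times_H (\<lambda>p. g (height p))"
  by (rule smooth_fun_on_compose_real[OF open_C_times_H _ _ smooth_height, where J="{0<..}"])
    (auto simp: mem_C_times_H)

lemma height_compose_derivative:
  assumes "(g has_real_derivative g') (at (height p))"
  shows "frechet_derivative (\<lambda>q. g (height q)) (at p) v = g' * height v"
proof -
  have "(height has_derivative height) (at p)"
    using linear_height by (intro bounded_linear_imp_has_derivative) (simp add: linear_conv_bounded_linear)
  from has_derivative_compose[OF this assms[unfolded has_field_derivative_def]]
  show ?thesis using frechet_derivative_at by metis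
qed

section \<open>Averaging a form along a segment\<close>

text \<open>Off the half-space the value is 0, as for every form.\<close>

definition segment_average ::
  "complex \<times> complex \<Rightarrow> (complex \<times> complex) form \<Rightarrow> (complex \<times> complex) form" where
  "segment_average u \<sigma> = (\<lambda>p vs. if p \<in> C_times_H then segment_integral (\<lambda>s. 1) u (\<lambda>q. \<sigma> q vs) p else 0)"

definition flat_along :: "complex \<times> complex \<Rightarrow> (complex \<times> complex) form \<Rightarrow> bool" where
  "flat_along h \<sigma> \<longleftrightarrow> (\<forall>p\<in>C_times_H. \<forall>vs. frechet_derivative (\<lambda>q. \<sigma> q vs) (at p) h = 0)"

lemma segment_average_form:
  "height u = 0 \<Longrightarrow> form_on k C_times_H \<sigma> \<Longrightarrow> form_on k C_times_H (segment_average u \<sigma>)"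
  unfolding segment_average_def
  by (rule form_on_segment_integral[OF open_C_times_H convex_C_times_H segment_in_C_times_H]) auto

lemma segment_average_add:
  assumes "height u = 0" "form_on k C_times_H \<sigma>" "form_on k C_times_H \<tau>"
  shows "segment_average u (\<lambda>p vs. \<sigma> p vs + \<tau> p vs)
    = (\<lambda>p vs. segment_average u \<sigma> p vs + segment_average u \<tau> p vs)"
  unfolding segment_average_def using form_on_continuous_on[OF assms(2)] form_on_continuous_on[OF assms(3)]
  by (intro ext) (auto intro!: segment_integral_add[OF segment_in_C_times_H[OF assms(1)]])

lemma segment_average_scale:
  "segment_average u (\<lambda>p vs. c * \<sigma> p vs) = (\<lambda>p vs. c * segment_average u \<sigma> p vs)"
  unfolding segment_average_def by (intro ext) (simp add: segment_integral_cmult)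

lemma segment_average_const:
  assumes "height u = 0"
  shows "segment_average u (\<lambda>p vs. if p \<in> C_times_H then c vs else 0) = (\<lambda>p vs. if p \<in> C_times_H then c vs else 0)"
proof (intro ext)
  fix p vs
  have "segment_integral (\<lambda>s. 1) u (\<lambda>q. if q \<in> C_times_H then c vs else 0) p
     = segment_integral (\<lambda>s. 1) u (\<lambda>q. c vs) p" if "p \<in> C_times_H"
    by (rule segment_integral_cong) (use segment_in_C_times_H[OF assms that] in auto)
  then show "segment_average u (\<lambda>p vs. if p \<in> C_times_H then c vs else 0) p vs
      = (if p \<in> C_times_H then c vs else 0)"
    by (simp add: segment_average_def segment_integral_const)
qed

lemma segment_average_periodic:
  assumes "height u = 0" "height w = 0" "\<And>p vs. p \<in> C_times_H \<Longrightarrow> \<sigma> (p + w) vs = \<sigma> p vs" "p \<in> C_times_H"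
  shows "segment_average u \<sigma> (p + w) vs = segment_average u \<sigma> p vs"
proof -
  have "segment_integral (\<lambda>s. 1) u (\<lambda>q. \<sigma> q vs) (p + w) = segment_integral (\<lambda>s. 1) u (\<lambda>q. \<sigma> q vs) p"
    unfolding segment_integral_def
  proof (rule integral_cong)
    fix s :: real assume "s \<in> {0..1}"
    then show "1 * \<sigma> (p + w + s *\<^sub>R u) vs = 1 * \<sigma> (p + s *\<^sub>R u) vs"
      using assms(3)[OF segment_in_C_times_H[OF assms(1,4)], of s vs] by (simp add: add_ac)
  qed
  then show ?thesis using assms(2,4) by (simp add: segment_average_def translate_C_times_H)
qed

lemma segment_average_ext_deriv:
  assumes "height u = 0" "form_on k C_times_H \<sigma>"
  shows "ext_deriv C_times_H (segment_average u \<sigma>) = segment_average u (ext_deriv C_times_H \<sigma>)"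
proof (intro ext)
  fix p vs
  show "ext_deriv C_times_H (segment_average u \<sigma>) p vs = segment_average u (ext_deriv C_times_H \<sigma>) p vs"
  proof (cases "p \<in> C_times_H")
    case True
    then show ?thesis
      using ext_deriv_segment_integral[OF open_C_times_H convex_C_times_H segment_in_C_times_H[OF assms(1)]
          continuous_on_const assms(2) True]
      by (simp add: segment_average_def)
  qed (simp add: segment_average_def ext_deriv_def)
qed

lemma segment_average_directional:
  assumes "height u = 0" "form_on k C_times_H \<sigma>" "p \<in> C_times_H"
  shows "frechet_derivative (\<lambda>q. segment_average u \<sigma> q vs) (at p) v
     = segment_integral (\<lambda>s. 1) u (\<lambda>q. frechet_derivative (\<lambda>q. \<sigma> q vs) (at q) v) p"
proof -
  have "frechet_derivative (\<lambda>q. segment_average u \<sigma> q vs) (at p)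
      = frechet_derivative (segment_integral (\<lambda>s. 1) u (\<lambda>q. \<sigma> q vs)) (at p)"
    by (rule frechet_derivative_cong_open[OF open_C_times_H assms(3)]) (simp add: segment_average_def)
  then show ?thesis
    using segment_integral_derivative[OF open_C_times_H open_C_times_H convex_C_times_H
        segment_in_C_times_H[OF assms(1)] continuous_on_const form_on_smooth[OF assms(2)] assms(3)]
    by simp
qed

text \<open>The derivative along \<open>u\<close> of the average over the segment from \<open>p\<close> to \<open>p + u\<close> is the difference
  of the values at its end points.\<close>

lemma flat_along_segment_average:
  assumes "height u = 0" "form_on k C_times_H \<sigma>" "\<And>p vs. p \<in> C_times_H \<Longrightarrow> \<sigma> (p + u) vs = \<sigma> p vs"
  shows "flat_along u (segment_average u \<sigma>)"
  unfolding flat_along_def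
proof (intro ballI allI)
  fix p vs assume p: "p \<in> C_times_H"
  then show "frechet_derivative (\<lambda>q. segment_average u \<sigma> q vs) (at p) u = 0"
    using segment_average_directional[OF assms(1,2) p]
      segment_integral_directional(1)[OF segment_in_C_times_H[OF assms(1) p] form_on_smooth[OF assms(2)]]
      assms(3)[OF p] by simp
qed

lemma flat_along_segment_average_preserved:
  assumes "height u = 0" "form_on k C_times_H \<sigma>" "flat_along v \<sigma>"
  shows "flat_along v (segment_average u \<sigma>)"
  unfolding flat_along_def
proof (intro ballI allI)
  fix p vs assume p: "p \<in> C_times_H"
  have "segment_integral (\<lambda>s. 1) u (\<lambda>q. frechet_derivative (\<lambda>q. \<sigma> q vs) (at q) v) p
     = segment_integral (\<lambda>s. 1) u (\<lambda>q. 0) p"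
    by (rule segment_integral_cong)
      (use assms(3) segment_in_C_times_H[OF assms(1) p] in \<open>auto simp: flat_along_def\<close>)
  then show "frechet_derivative (\<lambda>q. segment_average u \<sigma> q vs) (at p) v = 0"
    using segment_average_directional[OF assms(1,2) p] by simp
qed

section \<open>Splitting off the vertical direction\<close>

lemma alternating_2:
  assumes "alternating_multilinear 2 c"
  shows "c [v + w, x] = c [v, x] + c [w, x]" "c [x, v + w] = c [x, v] + c [x, w]"
    "c [r *\<^sub>R v, x] = r * c [v, x]" "c [x, r *\<^sub>R v] = r * c [x, v]" "c [v, v] = 0"
  using alternating_multilinear_add_slot[OF assms, of "[x, x]" 0 v w]
    alternating_multilinear_add_slot[OF assms, of "[x, x]" 1 v w]
    alternating_multilinear_scale_slot[OF assms, of "[x, x]" 0 r v]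
    alternating_multilinear_scale_slot[OF assms, of "[x, x]" 1 r v]
    alternating_multilinear_repeat[OF assms, of "[v, v]" 0 1]
  by auto

lemma alternating_2_swap:
  assumes "alternating_multilinear 2 c"
  shows "c [v, w] = - c [w, v]"
proof -
  have "c [v, v + w] + c [w, v + w] = 0"
    unfolding alternating_2(1)[OF assms, symmetric] by (rule alternating_2(5)[OF assms])
  then show ?thesis by (simp add: alternating_2(2,5)[OF assms])
qed

lemma alternating_3:
  assumes "alternating_multilinear 3 c"
  shows "c [v + w, x, y] = c [v, x, y] + c [w, x, y]" "c [x, v + w, y] = c [x, v, y] + c [x, w, y]"
    "c [x, y, v + w] = c [x, y, v] + c [x, y, w]"
    "c [r *\<^sub>R v, x, y] = r * c [v, x, y]" "c [x, r *\<^sub>R v, y] = r * c [x, v, y]"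
    "c [x, y, r *\<^sub>R v] = r * c [x, y, v]"
    "c [v, v, x] = 0" "c [v, x, v] = 0" "c [x, v, v] = 0"
  using alternating_multilinear_add_slot[OF assms, of "[x, x, y]" 0 v w]
    alternating_multilinear_add_slot[OF assms, of "[x, x, y]" 1 v w]
    alternating_multilinear_add_slot[OF assms, of "[x, y, y]" 2 v w]
    alternating_multilinear_scale_slot[OF assms, of "[x, x, y]" 0 r v]
    alternating_multilinear_scale_slot[OF assms, of "[x, x, y]" 1 r v]
    alternating_multilinear_scale_slot[OF assms, of "[x, y, y]" 2 r v]
    alternating_multilinear_repeat[OF assms, of "[v, v, x]" 0 1]
    alternating_multilinear_repeat[OF assms, of "[v, x, v]" 0 2]
    alternating_multilinear_repeat[OF assms, of "[x, v, v]" 1 2]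
  by (auto simp: numeral_2_eq_2)

lemma alternating_3_swap:
  assumes "alternating_multilinear 3 c"
  shows "c [v, w, x] = - c [w, v, x]" "c [x, v, w] = - c [x, w, v]"
proof -
  have "c [v, v + w, x] + c [w, v + w, x] = 0"
    unfolding alternating_3(1)[OF assms, symmetric] by (rule alternating_3(7)[OF assms])
  then show "c [v, w, x] = - c [w, v, x]" by (simp add: alternating_3(2,7)[OF assms])
  have "c [x, v, v + w] + c [x, w, v + w] = 0"
    unfolding alternating_3(2)[OF assms, symmetric] by (rule alternating_3(9)[OF assms])
  then show "c [x, v, w] = - c [x, w, v]" by (simp add: alternating_3(3,9)[OF assms])
qed

lemma alternating_1:
  assumes "alternating_multilinear 1 c"
  shows "c [v + w] = c [v] + c [w]" "c [r *\<^sub>R v] = r * c [v]"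
  using alternating_multilinear_add_slot[OF assms, of "[v]" 0 v w]
    alternating_multilinear_scale_slot[OF assms, of "[v]" 0 r v] by auto

text \<open>Replace every argument \<open>v\<close> by \<open>horizontal_part v + height v *\<^sub>R vertical\<close> and expand.  Terms with
  two vertical arguments vanish, those with one are collected in the sum, where moving the vertical
  argument to the front produces the sign.\<close>

lemma alternating_vertical_expansion:
  assumes c: "alternating_multilinear n c" and n: "n \<in> {1, 2, 3}" and vs: "length vs = n"
  shows "c vs = (\<Sum>i<length vs. (-1) ^ i * height (vs ! i) * c (vertical # omit i vs))
    + c (map horizontal_part vs)"
proof -
  let ?h = horizontal_part and ?t = height and ?v = vertical
  consider x where "n = 1" "vs = [x]" | x y where "n = 2" "vs = [x, y]" | x y z where "n = 3" "vs = [x, y, z]"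
    using n vs by (auto simp: length_Suc_conv numeral_2_eq_2 numeral_3_eq_3)
  then show ?thesis
  proof cases
    case 1
    have "c [x] = c [?h x + ?t x *\<^sub>R ?v]" using horizontal_part_eq[of x] by simp
    also have "\<dots> = ?t x * c [?v] + c [?h x]" using alternating_1[of c] c 1 by simp
    finally show ?thesis using 1 by (simp add: omit_def)
  next
    case 2
    note r = alternating_2[OF c[unfolded 2]]
    have e: "c [?v, w] = c [?v, ?h w]" for w
      using r(2)[of ?v "?h w" "?t w *\<^sub>R ?v"] r(4,5) horizontal_part_eq[of w] by simp
    have "c [x, y] = c [?h x + ?t x *\<^sub>R ?v, ?h y + ?t y *\<^sub>R ?v]"
      using horizontal_part_eq[of x] horizontal_part_eq[of y] by simp
    also have "\<dots> = c [?h x, ?h y] + ?t x * c [?v, ?h y] - ?t y * c [?v, ?h x]"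
      using alternating_2_swap[OF c[unfolded 2], of "?h x" ?v] by (simp add: r algebra_simps)
    finally show ?thesis using 2 e[of x] e[of y] by (simp add: omit_def)
  next
    case 3
    note r = alternating_3[OF c[unfolded 3]] and s = alternating_3_swap[OF c[unfolded 3]]
    have e: "c [?v, w, u] = c [?v, ?h w, ?h u]" for w u
    proof -
      have "c [?v, w, u] = c [?v, ?h w + ?t w *\<^sub>R ?v, ?h u + ?t u *\<^sub>R ?v]"
        using horizontal_part_eq[of w] horizontal_part_eq[of u] by simp
      then show ?thesis by (simp add: r)
    qed
    have "c [x, y, z] = c [?h x + ?t x *\<^sub>R ?v, ?h y + ?t y *\<^sub>R ?v, ?h z + ?t z *\<^sub>R ?v]"
      using horizontal_part_eq[of x] horizontal_part_eq[of y] horizontal_part_eq[of z] by simp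
    also have "\<dots> = c [?h x, ?h y, ?h z] + ?t x * c [?v, ?h y, ?h z] - ?t y * c [?v, ?h x, ?h z]
        + ?t z * c [?v, ?h x, ?h y]"
      using s(1)[of "?h x" ?v] s(2)[of "?h x" "?h y" ?v] by (simp add: r algebra_simps)
    finally show ?thesis
      using 3 e[of x y] e[of x z] e[of y z] by (simp add: omit_def numeral_3_eq_3 numeral_2_eq_2)
  qed
qed

section \<open>Integration over the height\<close>

text \<open>The oriented integral of \<open>f\<close> from height 1 to the height of \<open>p\<close>; an integral over an interval
  with exchanged end points is 0, so one of the two terms always vanishes.\<close>

definition vertical_primitive :: "(complex \<times> complex \<Rightarrow> real) \<Rightarrow> complex \<times> complex \<Rightarrow> real" where
  "vertical_primitive f p = integral {1..height p} (\<lambda>s. f (s *\<^sub>R vertical))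
     - integral {height p..1} (\<lambda>s. f (s *\<^sub>R vertical))"

lemma vertical_line_integrable:
  fixes f :: "complex \<times> complex \<Rightarrow> real"
  assumes "continuous_on C_times_H f" "a > 0"
  shows "(\<lambda>s. f (s *\<^sub>R vertical)) integrable_on {a..b}"
proof (rule integrable_continuous_real)
  show "continuous_on {a..b} (\<lambda>s. f (s *\<^sub>R vertical))"
    by (rule continuous_on_compose2[OF assms(1)])
      (use assms(2) in \<open>auto intro!: continuous_intros simp: mem_C_times_H\<close>)
qed

lemma vertical_primitive_has_derivative:
  assumes f: "continuous_on C_times_H f" and p: "p \<in> C_times_H"
  shows "(vertical_primitive f has_derivative (\<lambda>v. f (height p *\<^sub>R vertical) * height v)) (at p)"
proof -
  let ?g = "\<lambda>s. f (s *\<^sub>R vertical)" and ?t = "height p"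
  \<comment> \<open>A lower limit below both 1 and t turns the oriented integral into a difference of two integrals starting at e.\<close>
  define e where "e = min 1 ?t / 2"
  have t: "?t > 0" using p by (simp add: mem_C_times_H)
  then have e: "0 < e" "e < 1" "e < ?t" by (auto simp: e_def)
  have "continuous_on {e..?t + 1} ?g"
    by (rule continuous_on_compose2[OF f]) (use e in \<open>auto intro!: continuous_intros simp: mem_C_times_H\<close>)
  from integral_has_real_derivative[OF this, of ?t]
  have "((\<lambda>y. integral {e..y} ?g) has_real_derivative ?g ?t) (at ?t within {e..?t + 1})"
    using e by simp
  moreover have "at ?t within {e..?t + 1} = at ?t"
    using e by (intro at_within_interior) (simp add: interior_atLeastAtMost_real)
  ultimately have "((\<lambda>y. integral {e..y} ?g - integral {e..1} ?g) has_real_derivative ?g ?t) (at ?t)"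
    by (auto intro!: derivative_eq_intros)
  then have "((\<lambda>y. integral {1..y} ?g - integral {y..1} ?g) has_real_derivative ?g ?t) (at ?t)"
  proof (rule has_field_derivative_transform_within_open[where S="{e<..}"])
    fix y assume y: "y \<in> {e<..}"
    show "integral {e..y} ?g - integral {e..1} ?g = integral {1..y} ?g - integral {y..1} ?g"
    proof (cases "y \<le> 1")
      case True
      then show ?thesis
        using y Henstock_Kurzweil_Integration.integral_combine[of e y 1, OF _ True vertical_line_integrable[OF f e(1)]]
        by (cases "y = 1") auto
    next
      case False
      then show ?thesis
        using y e Henstock_Kurzweil_Integration.integral_combine[of e 1 y, OF _ _ vertical_line_integrable[OF f e(1)]]
        by auto
    qed
  qed (use e in auto)
  moreover have "(height has_derivative height) (at p)"
    using linear_height by (intro bounded_linear_imp_has_derivative) (simp add: linear_conv_bounded_linear)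
  ultimately have "((\<lambda>q. integral {1..height q} ?g - integral {height q..1} ?g) has_derivative
      (\<lambda>v. ?g ?t * height v)) (at p)"
    using has_derivative_compose unfolding has_field_derivative_def by blast
  then show ?thesis by (simp add: vertical_primitive_def[abs_def])
qed

lemma vertical_primitive_add:
  assumes "continuous_on C_times_H f" "continuous_on C_times_H g" "p \<in> C_times_H"
  shows "vertical_primitive (\<lambda>q. f q + g q) p = vertical_primitive f p + vertical_primitive g p"
  using assms(3) vertical_line_integrable[OF assms(1)] vertical_line_integrable[OF assms(2)]
  by (simp add: vertical_primitive_def integral_add mem_C_times_H)

lemma vertical_primitive_cmult: "vertical_primitive (\<lambda>q. r * f q) p = r * vertical_primitive f p"
  by (simp add: vertical_primitive_def algebra_simps)

lemma vertical_primitive_cong: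
  assumes "\<And>q. q \<in> C_times_H \<Longrightarrow> f q = g q" "p \<in> C_times_H"
  shows "vertical_primitive f p = vertical_primitive g p"
proof -
  have "f (s *\<^sub>R vertical) = g (s *\<^sub>R vertical)" if "s \<in> {1..height p} \<or> s \<in> {height p..1}" for s
    using that assms(2) by (intro assms(1)) (auto simp: mem_C_times_H)
  then show ?thesis
    unfolding vertical_primitive_def by (intro arg_cong2[where f="(-)"] integral_cong) auto
qed

lemma vertical_primitive_zero [simp]: "vertical_primitive (\<lambda>q. 0) p = 0"
  by (simp add: vertical_primitive_def)

text \<open>Two points of equal height are joined by a horizontal segment.\<close>

lemma flat_horizontal_eq:
  assumes flat: "\<And>h. height h = 0 \<Longrightarrow> flat_along h \<sigma>" and \<sigma>: "form_on k C_times_H \<sigma>"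
    and p: "p \<in> C_times_H" "height q = height p"
  shows "\<sigma> q vs = \<sigma> p vs"
proof -
  let ?h = "q - p"
  have h: "height ?h = 0" using p by simp
  show ?thesis
    using constant_along_segment[OF segment_in_C_times_H[OF h p(1)] form_on_smooth[OF \<sigma>], of vs] flat[OF h]
    by (simp add: flat_along_def)
qed

text \<open>For a flat form \<open>\<omega>\<close> the integrand may be evaluated at any point of the given height, so the
  derivative of the primitive is \<open>\<omega>\<close> times the height of the direction.\<close>

lemma form_on_vertical_primitive:
  assumes \<omega>: "form_on j C_times_H \<omega>" and flat: "\<And>h. height h = 0 \<Longrightarrow> flat_along h \<omega>"
  shows "form_on j C_times_H (\<lambda>p vs. if p \<in> C_times_H then vertical_primitive (\<lambda>q. \<omega> q vs) p else 0)"
    and "p \<in> C_times_H \<Longrightarrow>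
      frechet_derivative (\<lambda>p. if p \<in> C_times_H then vertical_primitive (\<lambda>q. \<omega> q vs) p else 0) (at p) v
        = height v * \<omega> p vs"
proof -
  have d: "((\<lambda>p. if p \<in> C_times_H then vertical_primitive (\<lambda>q. \<omega> q vs) p else 0)
      has_derivative (\<lambda>v. height v * \<omega> p vs)) (at p)" if p: "p \<in> C_times_H" for p vs
  proof -
    have "\<omega> (height p *\<^sub>R vertical) vs = \<omega> p vs"
      by (rule flat_horizontal_eq[OF flat \<omega> p]) auto
    with vertical_primitive_has_derivative[OF form_on_continuous_on[OF \<omega>, of vs] p]
    have "(vertical_primitive (\<lambda>q. \<omega> q vs) has_derivative (\<lambda>v. height v * \<omega> p vs)) (at p)"
      by (simp add: mult.commute)
    then show ?thesis
      by (rule has_derivative_transform_within_open[OF _ open_C_times_H p]) simp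
  qed
  show "frechet_derivative (\<lambda>p. if p \<in> C_times_H then vertical_primitive (\<lambda>q. \<omega> q vs) p else 0) (at p) v
        = height v * \<omega> p vs" if "p \<in> C_times_H"
    using frechet_derivative_at[OF d[OF that]] by metis
  note cont = form_on_continuous_on[OF \<omega>]
  show "form_on j C_times_H (\<lambda>p vs. if p \<in> C_times_H then vertical_primitive (\<lambda>q. \<omega> q vs) p else 0)"
  proof (rule form_onI)
    fix p assume p: "p \<in> C_times_H"
    have "alternating_multilinear j (\<lambda>vs. vertical_primitive (\<lambda>q. \<omega> q vs) p)"
      by (rule alternating_multilinear_transform[where T="\<lambda>f. vertical_primitive f p" and S=C_times_H])
        (auto simp: vertical_primitive_cmult vertical_primitive_add[OF cont cont p]
          intro: form_on_alternating[OF \<omega>] vertical_primitive_cong[OF _ p])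
    then show "alternating_multilinear j (\<lambda>vs. if p \<in> C_times_H then vertical_primitive (\<lambda>q. \<omega> q vs) p else 0)"
      using p by simp
  next
    fix vs
    show "smooth_fun_on C_times_H (\<lambda>p. if p \<in> C_times_H then vertical_primitive (\<lambda>q. \<omega> q vs) p else 0)"
      by (rule smooth_fun_onI[OF open_C_times_H d])
        (auto intro: smooth_fun_on_mult open_C_times_H form_on_smooth[OF \<omega>])
  qed (auto simp: form_on_length[OF \<omega>])
qed

text \<open>Let \<open>\<omega>\<close> depend on the height only.  Differentiating the primitive of its vertical contraction
  gives the vertical part of \<open>\<omega>\<close>.  The horizontal coefficients that remain are constant: their
  vertical derivative occurs in \<open>d \<omega> = 0\<close> next to horizontal derivatives, which vanish.\<close>

lemma flat_closed_decomposition: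
  assumes \<omega>: "form_on (Suc j) C_times_H \<omega>" and flat: "\<And>h. height h = 0 \<Longrightarrow> flat_along h \<omega>"
    and closed: "\<And>p vs. p \<in> C_times_H \<Longrightarrow> ext_deriv C_times_H \<omega> p vs = 0"
    and j: "Suc j \<in> {1, 2, 3}" and p: "p \<in> C_times_H"
  shows "\<omega> p vs = ext_deriv C_times_H (\<lambda>p vs. if p \<in> C_times_H
      then vertical_primitive (\<lambda>q. \<omega> q (vertical # vs)) p else 0) p vs
    + \<omega> vertical (map horizontal_part vs)"
proof (cases "length vs = Suc j")
  case True
  have vflat: "flat_along h (\<lambda>p vs. \<omega> p (vertical # vs))" if "height h = 0" for h
    using flat[OF that] by (simp add: flat_along_def)
  have "ext_deriv C_times_H (\<lambda>p vs. if p \<in> C_times_H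
      then vertical_primitive (\<lambda>q. \<omega> q (vertical # vs)) p else 0) p vs
    = (\<Sum>i<length vs. (-1) ^ i * height (vs ! i) * \<omega> p (vertical # omit i vs))"
    using form_on_vertical_primitive(2)[OF form_on_contract[OF \<omega>] vflat p] p
    by (simp add: ext_deriv_def algebra_simps)
  moreover have "\<omega> p (map horizontal_part vs) = \<omega> vertical (map horizontal_part vs)"
  proof -
    let ?ws = "map horizontal_part vs"
    have zv: "frechet_derivative (\<lambda>y. \<omega> y ?ws) (at q) vertical = 0" if q: "q \<in> C_times_H" for q
    proof -
      have "frechet_derivative (\<lambda>y. \<omega> y (vertical # omit i ?ws)) (at q) (?ws ! i) = 0" if "i < length ?ws" for i
        using vflat[of "?ws ! i"] that q by (simp add: flat_along_def)
      then have "ext_deriv C_times_H (\<lambda>y ws. \<omega> y (vertical # ws)) q ?ws = 0"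
        by (simp add: ext_deriv_def)
      then show ?thesis using ext_deriv_Cons[OF q, of \<omega> vertical ?ws] closed[OF q] by simp
    qed
    have zh: "frechet_derivative (\<lambda>y. \<omega> y ?ws) (at q) (horizontal_part v) = 0" if "q \<in> C_times_H" for q v
      using flat[of "horizontal_part v"] that by (simp add: flat_along_def)
    have z: "frechet_derivative (\<lambda>y. \<omega> y ?ws) (at q) v = 0" if q: "q \<in> C_times_H" for q v
    proof -
      have lin: "linear (frechet_derivative (\<lambda>y. \<omega> y ?ws) (at q))"
        by (rule smooth_fun_on_linear_derivative[OF form_on_smooth[OF \<omega>] q])
      have "frechet_derivative (\<lambda>y. \<omega> y ?ws) (at q) v
          = frechet_derivative (\<lambda>y. \<omega> y ?ws) (at q) (horizontal_part v + height v *\<^sub>R vertical)"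
        using horizontal_part_eq[of v] by simp
      then show ?thesis
        by (simp add: zv[OF q] zh[OF q] linear_add[OF lin] linear_cmul[OF lin])
    qed
    have v: "vertical \<in> C_times_H" by (simp add: mem_C_times_H)
    have seg: "vertical + s *\<^sub>R (p - vertical) \<in> C_times_H" if "s \<in> {0..1}" for s
      using convexD_alt[OF convex_C_times_H v p, of s] that by (simp add: algebra_simps)
    show ?thesis using constant_along_segment[OF seg form_on_smooth[OF \<omega>], of ?ws] z by simp
  qed
  ultimately show ?thesis
    using alternating_vertical_expansion[OF form_on_alternating[OF \<omega> p] j True] by simp
next
  case False
  then have "ext_deriv C_times_H (\<lambda>p vs. if p \<in> C_times_H
      then vertical_primitive (\<lambda>q. \<omega> q (vertical # vs)) p else 0) p vs = 0"
    using form_on_vertical_primitive(1)[OF form_on_contract[OF \<omega>], of vertical] flat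
    by (intro ext_deriv_length) (auto simp: flat_along_def)
  then show ?thesis using False form_on_length[OF \<omega>] by simp
qed

section \<open>Periodic forms and their periods\<close>

abbreviation d_form :: "(complex \<times> complex) form \<Rightarrow> (complex \<times> complex) form" where
  "d_form \<equiv> ext_deriv C_times_H"

text \<open>Three horizontal vectors that span the horizontal directions; the slices of constant height become
  three-tori after dividing by the group that they generate.\<close>

locale horizontal_lattice =
  fixes l :: "3 \<Rightarrow> complex \<times> complex"
  assumes height_l [simp]: "height (l i) = 0"
    and l_spans: "height h = 0 \<Longrightarrow> \<exists>r::3 \<Rightarrow> real. h = (\<Sum>i\<in>UNIV. r i *\<^sub>R l i)"
begin

definition periodic_forms :: "nat \<Rightarrow> (complex \<times> complex) form set" where
  "periodic_forms k = {\<sigma>. form_on k C_times_H \<sigma> \<and> (\<forall>i. \<forall>p\<in>C_times_H. \<forall>vs. \<sigma> (p + l i) vs = \<sigma> p vs)}"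

lemma periodic_form_on: "\<sigma> \<in> periodic_forms k \<Longrightarrow> form_on k C_times_H \<sigma>"
  and periodic_shift: "\<sigma> \<in> periodic_forms k \<Longrightarrow> p \<in> C_times_H \<Longrightarrow> \<sigma> (p + l i) vs = \<sigma> p vs"
  by (auto simp: periodic_forms_def)

lemma periodic_formsI:
  "form_on k C_times_H \<sigma> \<Longrightarrow> (\<And>i p vs. p \<in> C_times_H \<Longrightarrow> \<sigma> (p + l i) vs = \<sigma> p vs) \<Longrightarrow> \<sigma> \<in> periodic_forms k"
  by (auto simp: periodic_forms_def)

lemma periodic_forms_zero: "(\<lambda>p vs. 0) \<in> periodic_forms k"
  by (rule periodic_formsI) (auto intro: form_on_zero)

lemma periodic_forms_add:
  "\<sigma> \<in> periodic_forms k \<Longrightarrow> \<tau> \<in> periodic_forms k \<Longrightarrow> (\<lambda>p vs. \<sigma> p vs + \<tau> p vs) \<in> periodic_forms k"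
  by (rule periodic_formsI) (auto simp: periodic_shift intro: form_on_add open_C_times_H periodic_form_on)

lemma periodic_forms_scale:
  "\<sigma> \<in> periodic_forms k \<Longrightarrow> (\<lambda>p vs. c * \<sigma> p vs) \<in> periodic_forms k"
  by (rule periodic_formsI) (auto simp: periodic_shift intro: form_on_scale open_C_times_H periodic_form_on)

lemma periodic_forms_diff:
  "\<sigma> \<in> periodic_forms k \<Longrightarrow> \<tau> \<in> periodic_forms k \<Longrightarrow> (\<lambda>p vs. \<sigma> p vs - \<tau> p vs) \<in> periodic_forms k"
  by (rule periodic_formsI) (auto simp: periodic_shift intro: form_on_diff open_C_times_H periodic_form_on)

lemma periodic_forms_const:
  assumes "alternating_multilinear k c" "\<And>vs. length vs \<noteq> k \<Longrightarrow> c vs = 0"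
  shows "(\<lambda>p vs. if p \<in> C_times_H then c vs else 0) \<in> periodic_forms k"
  by (rule periodic_formsI) (use assms in \<open>auto simp: translate_C_times_H intro: form_on_const open_C_times_H\<close>)

lemma periodic_forms_average:
  assumes "\<sigma> \<in> periodic_forms k"
  shows "segment_average (l i) \<sigma> \<in> periodic_forms k"
proof (rule periodic_formsI)
  fix j p vs assume "p \<in> C_times_H"
  then show "segment_average (l i) \<sigma> (p + l j) vs = segment_average (l i) \<sigma> p vs"
    using segment_average_periodic[OF height_l height_l, where \<sigma>=\<sigma>] periodic_shift[OF assms] by blast
qed (rule segment_average_form[OF height_l periodic_form_on[OF assms]])

text \<open>Averaging along the generators one at a time averages over the whole torus.\<close>

definition torus_average :: "(complex \<times> complex) form \<Rightarrow> (complex \<times> complex) form" where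
  "torus_average \<sigma> = segment_average (l 1) (segment_average (l 2) (segment_average (l 3) \<sigma>))"

text \<open>The mean of the horizontal coefficients over the torus of height 1.  On lattice
  directions and for a closed form these are integrals over subtori, hence cohomological invariants.\<close>

definition period :: "(complex \<times> complex) form \<Rightarrow> (complex \<times> complex) list \<Rightarrow> real" where
  "period \<sigma> vs = torus_average \<sigma> vertical (map horizontal_part vs)"

lemma periodic_torus_average: "\<sigma> \<in> periodic_forms k \<Longrightarrow> torus_average \<sigma> \<in> periodic_forms k"
  unfolding torus_average_def by (intro periodic_forms_average)

text \<open>Averaging along \<open>l i\<close> kills the derivative along \<open>l i\<close> and keeps derivatives that are already zero;
  by linearity the three lattice directions account for all horizontal ones.\<close>

lemma torus_average_flat:
  assumes \<sigma>: "\<sigma> \<in> periodic_forms k" and h: "height h = 0"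
  shows "flat_along h (torus_average \<sigma>)"
proof -
  let ?a = "\<lambda>i. segment_average (l i)"
  have f3: "flat_along (l i) (?a i \<tau>)" if "\<tau> \<in> periodic_forms k" for i \<tau>
    using that by (intro flat_along_segment_average periodic_form_on) (auto intro: periodic_shift)
  have pres: "flat_along (l j) (?a i \<tau>)" if "\<tau> \<in> periodic_forms k" "flat_along (l j) \<tau>" for i j \<tau>
    using that by (intro flat_along_segment_average_preserved periodic_form_on) auto
  have P: "?a i \<tau> \<in> periodic_forms k" if "\<tau> \<in> periodic_forms k" for i \<tau>
    using that by (rule periodic_forms_average)
  have fl: "flat_along (l i) (torus_average \<sigma>)" for i
    unfolding torus_average_def using exhaust_3[of i] \<sigma> f3 pres P by metis
  obtain r where r: "h = (\<Sum>i\<in>UNIV. r i *\<^sub>R l i)" using l_spans[OF h] by blast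
  show ?thesis unfolding flat_along_def
  proof (intro ballI allI)
    fix p vs assume p: "p \<in> C_times_H"
    let ?D = "frechet_derivative (\<lambda>q. torus_average \<sigma> q vs) (at p)"
    have "linear ?D"
      by (rule smooth_fun_on_linear_derivative[OF form_on_smooth[OF periodic_form_on[OF periodic_torus_average[OF \<sigma>]]] p])
    then have "?D h = (\<Sum>i\<in>UNIV. r i * ?D (l i))" by (simp add: r linear_sum linear_cmul)
    then show "?D h = 0" using fl p by (simp add: flat_along_def)
  qed
qed

lemma torus_average_ext_deriv:
  assumes "\<sigma> \<in> periodic_forms k"
  shows "d_form (torus_average \<sigma>) = torus_average (d_form \<sigma>)"
proof -
  have e: "d_form (segment_average (l i) \<tau>) = segment_average (l i) (d_form \<tau>)" if "\<tau> \<in> periodic_forms k" for i \<tau>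
    using that by (intro segment_average_ext_deriv periodic_form_on) auto
  show ?thesis unfolding torus_average_def by (simp add: e assms periodic_forms_average)
qed

lemma torus_average_const:
  "torus_average (\<lambda>p vs. if p \<in> C_times_H then c vs else 0) = (\<lambda>p vs. if p \<in> C_times_H then c vs else 0)"
  by (simp add: torus_average_def segment_average_const)

lemma torus_average_add:
  assumes "form_on k C_times_H \<sigma>" "form_on k C_times_H \<tau>"
  shows "torus_average (\<lambda>p vs. \<sigma> p vs + \<tau> p vs) = (\<lambda>p vs. torus_average \<sigma> p vs + torus_average \<tau> p vs)"
  unfolding torus_average_def using assms by (simp add: segment_average_add[where k=k] segment_average_form)

lemma torus_average_scale:
  "torus_average (\<lambda>p vs. c * \<sigma> p vs) = (\<lambda>p vs. c * torus_average \<sigma> p vs)"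
  unfolding torus_average_def by (simp add: segment_average_scale)

lemma vertical_in_C_times_H [simp]: "vertical \<in> C_times_H"
  by (simp add: mem_C_times_H)

lemma period_add:
  "form_on k C_times_H \<sigma> \<Longrightarrow> form_on k C_times_H \<tau> \<Longrightarrow>
    period (\<lambda>p vs. \<sigma> p vs + \<tau> p vs) vs = period \<sigma> vs + period \<tau> vs"
  by (simp add: period_def torus_average_add)

lemma period_scale: "period (\<lambda>p vs. c * \<sigma> p vs) vs = c * period \<sigma> vs"
  by (simp add: period_def torus_average_scale)

lemma period_const:
  "period (\<lambda>p vs. if p \<in> C_times_H then c vs else 0) vs = c (map horizontal_part vs)"
  by (simp add: period_def torus_average_const)

lemma period_alternating:
  assumes "\<sigma> \<in> periodic_forms k"
  shows "alternating_multilinear k (period \<sigma>)" "length vs \<noteq> k \<Longrightarrow> period \<sigma> vs = 0"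
proof -
  have f: "form_on k C_times_H (torus_average \<sigma>)" by (rule periodic_form_on[OF periodic_torus_average[OF assms]])
  show "alternating_multilinear k (period \<sigma>)"
    unfolding period_def[abs_def]
    by (rule alternating_multilinear_map[OF form_on_alternating[OF f] linear_horizontal_part]) simp
  show "length vs \<noteq> k \<Longrightarrow> period \<sigma> vs = 0" using form_on_length[OF f] by (simp add: period_def)
qed

text \<open>Only horizontal derivatives of the averaged form contribute to the horizontal coefficients of its
  differential, and these are zero.\<close>

lemma period_ext_deriv:
  assumes "\<sigma> \<in> periodic_forms k"
  shows "period (d_form \<sigma>) vs = 0"
proof -
  have "frechet_derivative (\<lambda>y. torus_average \<sigma> y ws) (at vertical) (horizontal_part v) = 0" for ws v
    using torus_average_flat[OF assms, of "horizontal_part v"] by (simp add: flat_along_def)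
  then show ?thesis
    unfolding period_def torus_average_ext_deriv[OF assms, symmetric] by (simp add: ext_deriv_def)
qed

text \<open>For closed \<open>\<sigma>\<close> the homotopy of \<open>periodic_homotopy\<close> provides a primitive of the difference between
  \<open>\<sigma>\<close> and its average; the primitive is periodic because it is built from translates of \<open>\<sigma>\<close>.\<close>

lemma average_homotopy:
  assumes \<sigma>: "\<sigma> \<in> periodic_forms (Suc k)" and closed: "d_form \<sigma> = (\<lambda>p vs. 0)"
  shows "\<exists>\<eta>\<in>periodic_forms k. \<sigma> = (\<lambda>p vs. d_form \<eta> p vs + segment_average (l i) \<sigma> p vs)"
proof
  let ?\<eta> = "\<lambda>p vs. if p \<in> C_times_H then segment_integral (\<lambda>s. s) (l i) (\<lambda>q. \<sigma> q (l i # vs)) p else 0"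
  have f: "form_on (Suc k) C_times_H \<sigma>" using \<sigma> by (rule periodic_form_on)
  show "?\<eta> \<in> periodic_forms k"
  proof (rule periodic_formsI)
    show "form_on k C_times_H ?\<eta>"
      by (rule form_on_segment_integral[OF open_C_times_H convex_C_times_H segment_in_C_times_H _ form_on_contract[OF f]])
        (auto intro: continuous_intros)
    fix j p vs assume p: "p \<in> C_times_H"
    have "segment_integral (\<lambda>s. s) (l i) (\<lambda>q. \<sigma> q (l i # vs)) (p + l j)
        = segment_integral (\<lambda>s. s) (l i) (\<lambda>q. \<sigma> q (l i # vs)) p"
      unfolding segment_integral_def
    proof (rule integral_cong)
      fix s :: real assume "s \<in> {0..1}"
      then show "s * \<sigma> (p + l j + s *\<^sub>R l i) (l i # vs) = s * \<sigma> (p + s *\<^sub>R l i) (l i # vs)"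
        using periodic_shift[OF \<sigma> segment_in_C_times_H[OF height_l p], of s i j "l i # vs"] by (simp add: add_ac)
    qed
    then show "?\<eta> (p + l j) vs = ?\<eta> p vs" using p by (simp add: translate_C_times_H)
  qed
  show "\<sigma> = (\<lambda>p vs. d_form ?\<eta> p vs + segment_average (l i) \<sigma> p vs)"
  proof (intro ext)
    fix p vs
    show "\<sigma> p vs = d_form ?\<eta> p vs + segment_average (l i) \<sigma> p vs"
    proof (cases "p \<in> C_times_H")
      case True
      then show ?thesis
        using periodic_homotopy[OF open_C_times_H convex_C_times_H segment_in_C_times_H[OF height_l] f True
            periodic_shift[OF \<sigma> True, of i vs]] closed
        by (simp add: segment_average_def)
    qed (simp add: form_on_outside[OF f] ext_deriv_def segment_average_def)
  qed
qed

lemma closed_average: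
  assumes "\<sigma> \<in> periodic_forms k" "d_form \<sigma> = (\<lambda>p vs. 0)"
  shows "d_form (segment_average (l i) \<sigma>) = (\<lambda>p vs. 0)"
  using segment_average_ext_deriv[OF height_l periodic_form_on[OF assms(1)], of i] assms(2)
  by (simp add: segment_average_def fun_eq_iff)

lemma d_form_add:
  "\<eta> \<in> periodic_forms k \<Longrightarrow> \<zeta> \<in> periodic_forms k \<Longrightarrow>
    d_form (\<lambda>p vs. \<eta> p vs + \<zeta> p vs) p vs = d_form \<eta> p vs + d_form \<zeta> p vs"
  by (rule ext_deriv_add) (auto intro: periodic_form_on)

lemma d_form_diff:
  "\<eta> \<in> periodic_forms k \<Longrightarrow> \<zeta> \<in> periodic_forms k \<Longrightarrow>
    d_form (\<lambda>p vs. \<eta> p vs - \<zeta> p vs) p vs = d_form \<eta> p vs - d_form \<zeta> p vs"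
  by (rule ext_deriv_diff) (auto intro: periodic_form_on open_C_times_H)

lemma torus_average_homotopy:
  assumes \<sigma>: "\<sigma> \<in> periodic_forms (Suc k)" and closed: "d_form \<sigma> = (\<lambda>p vs. 0)"
  shows "\<exists>\<eta>\<in>periodic_forms k. \<sigma> = (\<lambda>p vs. d_form \<eta> p vs + torus_average \<sigma> p vs)"
    and "d_form (torus_average \<sigma>) = (\<lambda>p vs. 0)"
proof -
  let ?a = "\<lambda>i. segment_average (l i)"
  have P: "?a 3 \<sigma> \<in> periodic_forms (Suc k)" "?a 2 (?a 3 \<sigma>) \<in> periodic_forms (Suc k)"
    using \<sigma> by (auto intro: periodic_forms_average)
  have C: "d_form (?a 3 \<sigma>) = (\<lambda>p vs. 0)" "d_form (?a 2 (?a 3 \<sigma>)) = (\<lambda>p vs. 0)"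
    using \<sigma> closed P by (auto intro: closed_average)
  show "d_form (torus_average \<sigma>) = (\<lambda>p vs. 0)"
    unfolding torus_average_def by (rule closed_average[OF P(2) C(2)])
  obtain x where x: "x \<in> periodic_forms k" "\<sigma> = (\<lambda>p vs. d_form x p vs + ?a 3 \<sigma> p vs)"
    using average_homotopy[OF \<sigma> closed] by blast
  obtain y where y: "y \<in> periodic_forms k" "?a 3 \<sigma> = (\<lambda>p vs. d_form y p vs + ?a 2 (?a 3 \<sigma>) p vs)"
    using average_homotopy[OF P(1) C(1)] by blast
  obtain z where z: "z \<in> periodic_forms k" "?a 2 (?a 3 \<sigma>) = (\<lambda>p vs. d_form z p vs + torus_average \<sigma> p vs)"
    using average_homotopy[OF P(2) C(2)] unfolding torus_average_def by blast
  have xy: "(\<lambda>p vs. x p vs + y p vs) \<in> periodic_forms k" using x(1) y(1) by (rule periodic_forms_add)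
  show "\<exists>\<eta>\<in>periodic_forms k. \<sigma> = (\<lambda>p vs. d_form \<eta> p vs + torus_average \<sigma> p vs)"
  proof
    show "(\<lambda>p vs. (x p vs + y p vs) + z p vs) \<in> periodic_forms k" by (rule periodic_forms_add[OF xy z(1)])
    show "\<sigma> = (\<lambda>p vs. d_form (\<lambda>p vs. (x p vs + y p vs) + z p vs) p vs + torus_average \<sigma> p vs)"
    proof (intro ext)
      fix p vs
      show "\<sigma> p vs = d_form (\<lambda>p vs. (x p vs + y p vs) + z p vs) p vs + torus_average \<sigma> p vs"
        using fun_cong[OF fun_cong[OF x(2)], of p vs] fun_cong[OF fun_cong[OF y(2)], of p vs]
          fun_cong[OF fun_cong[OF z(2)], of p vs]
        by (simp add: d_form_add[OF xy z(1)] d_form_add[OF x(1) y(1)])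
    qed
  qed
qed

text \<open>Average over the torus, then integrate the averaged form, which depends on the height only.\<close>

theorem periodic_closed_form_cohomologous_const:
  assumes \<sigma>: "\<sigma> \<in> periodic_forms (Suc k)" and closed: "d_form \<sigma> = (\<lambda>p vs. 0)" and k: "Suc k \<in> {1, 2, 3}"
  shows "\<exists>\<eta>\<in>periodic_forms k. \<sigma> = (\<lambda>p vs. d_form \<eta> p vs + (if p \<in> C_times_H then period \<sigma> vs else 0))"
proof -
  obtain x where x: "x \<in> periodic_forms k" "\<sigma> = (\<lambda>p vs. d_form x p vs + torus_average \<sigma> p vs)"
    using torus_average_homotopy(1)[OF \<sigma> closed] by blast
  let ?s = "torus_average \<sigma>"
  let ?y = "\<lambda>p vs. if p \<in> C_times_H then vertical_primitive (\<lambda>q. ?s q (vertical # vs)) p else 0"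
  have s: "form_on (Suc k) C_times_H ?s" using periodic_torus_average[OF \<sigma>] by (rule periodic_form_on)
  have fl: "flat_along h (\<lambda>p vs. ?s p (vertical # vs))" if "height h = 0" for h
    using torus_average_flat[OF \<sigma> that] by (simp add: flat_along_def)
  have y: "?y \<in> periodic_forms k"
  proof (rule periodic_formsI)
    show "form_on k C_times_H ?y"
      by (rule form_on_vertical_primitive(1)[OF form_on_contract[OF s] fl])
  qed (auto simp: translate_C_times_H vertical_primitive_def)
  show ?thesis
  proof
    show "(\<lambda>p vs. x p vs + ?y p vs) \<in> periodic_forms k" by (rule periodic_forms_add[OF x(1) y])
    show "\<sigma> = (\<lambda>p vs. d_form (\<lambda>p vs. x p vs + ?y p vs) p vs + (if p \<in> C_times_H then period \<sigma> vs else 0))"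
    proof (intro ext)
      fix p vs
      have "?s p vs = d_form ?y p vs + (if p \<in> C_times_H then period \<sigma> vs else 0)"
      proof (cases "p \<in> C_times_H")
        case True
        then show ?thesis
          using flat_closed_decomposition[OF s torus_average_flat[OF \<sigma>] _ k True]
            torus_average_homotopy(2)[OF \<sigma> closed]
          by (simp add: period_def)
      qed (simp add: form_on_outside[OF s] ext_deriv_def)
      then show "\<sigma> p vs = d_form (\<lambda>p vs. x p vs + ?y p vs) p vs + (if p \<in> C_times_H then period \<sigma> vs else 0)"
        using fun_cong[OF fun_cong[OF x(2)], of p vs] by (simp only: d_form_add[OF x(1) y])
    qed
  qed
qed

end

section \<open>The dilation and the lattice\<close>

definition dilation :: "real \<Rightarrow> complex \<Rightarrow> int \<Rightarrow> complex \<times> complex \<Rightarrow> complex \<times> complex" where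
  "dilation \<alpha> \<beta> n p = (\<beta> powi n * fst p, complex_of_real (\<alpha> powi n) * snd p)"

text \<open>The last two assumptions make periodicity compatible with pull-back along all powers of the
  dilation, positive and negative.\<close>

locale inoue_lattice = horizontal_lattice l for l :: "3 \<Rightarrow> complex \<times> complex" +
  fixes \<alpha> :: real and \<beta> :: complex
  assumes \<alpha>_gt_1: "\<alpha> > 1" and \<beta>_nonreal: "\<beta> \<notin> \<real>" and norm_\<beta>: "(cmod \<beta>)\<^sup>2 * \<alpha> = 1"
    and dilation_l: "\<exists>m::3 \<Rightarrow> int. dilation \<alpha> \<beta> 1 (l i) = (\<Sum>j\<in>UNIV. of_int (m j) *\<^sub>R l j)"
    and dilation_inverse_l: "\<exists>m::3 \<Rightarrow> int. dilation \<alpha> \<beta> (-1) (l i) = (\<Sum>j\<in>UNIV. of_int (m j) *\<^sub>R l j)"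
begin

abbreviation dil :: "int \<Rightarrow> complex \<times> complex \<Rightarrow> complex \<times> complex" where "dil \<equiv> dilation \<alpha> \<beta>"

lemma \<beta>_nonzero: "\<beta> \<noteq> 0" using \<beta>_nonreal by auto

lemma \<alpha>_pos: "\<alpha> > 0" using \<alpha>_gt_1 by simp

lemma dil_0 [simp]: "dil 0 p = p"
  by (simp add: dilation_def)

lemma dil_dil: "dil m (dil n p) = dil (m + n) p"
  using \<beta>_nonzero \<alpha>_pos by (simp add: dilation_def power_int_add mult.assoc)

lemma linear_dil: "linear (dil n)"
  by (rule linearI) (auto simp: dilation_def algebra_simps scaleR_conv_of_real)

lemma height_dil [simp]: "height (dil n p) = \<alpha> powi n * height p"
  by (simp add: height_def dilation_def del: of_real_power_int)

lemma dil_mem_C_times_H [simp]: "dil n p \<in> C_times_H \<longleftrightarrow> p \<in> C_times_H"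
  using zero_less_power_int[OF \<alpha>_pos, of n] by (auto simp: mem_C_times_H zero_less_mult_iff)

lemma horizontal_part_dil: "horizontal_part (dil n p) = dil n (horizontal_part p)"
  by (simp add: horizontal_part_def dilation_def del: of_real_power_int)

definition lattice_points :: "(complex \<times> complex) set" where
  "lattice_points = range (\<lambda>m::3 \<Rightarrow> int. \<Sum>j\<in>UNIV. of_int (m j) *\<^sub>R l j)"

lemma lattice_zero: "0 \<in> lattice_points"
  unfolding lattice_points_def by (rule range_eqI[of _ _ "\<lambda>j. 0"]) simp

lemma lattice_add: "v \<in> lattice_points \<Longrightarrow> w \<in> lattice_points \<Longrightarrow> v + w \<in> lattice_points"
proof -
  assume "v \<in> lattice_points" "w \<in> lattice_points"
  then obtain m n :: "3 \<Rightarrow> int" where "v = (\<Sum>j\<in>UNIV. of_int (m j) *\<^sub>R l j)" "w = (\<Sum>j\<in>UNIV. of_int (n j) *\<^sub>R l j)"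
    unfolding lattice_points_def by auto
  then show ?thesis
    unfolding lattice_points_def by (intro range_eqI[of _ _ "\<lambda>j. m j + n j"]) (simp add: sum.distrib scaleR_add_left)
qed

lemma lattice_scale: "v \<in> lattice_points \<Longrightarrow> of_int k *\<^sub>R v \<in> lattice_points"
proof -
  assume "v \<in> lattice_points"
  then obtain m :: "3 \<Rightarrow> int" where "v = (\<Sum>j\<in>UNIV. of_int (m j) *\<^sub>R l j)"
    unfolding lattice_points_def by auto
  then show ?thesis
    unfolding lattice_points_def by (intro range_eqI[of _ _ "\<lambda>j. k * m j"]) (simp add: scaleR_sum_right)
qed

lemma lattice_uminus: "v \<in> lattice_points \<Longrightarrow> - v \<in> lattice_points"
  using lattice_scale[of v "-1"] by simp

lemma lattice_l: "l i \<in> lattice_points"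
proof -
  have "(\<Sum>j\<in>UNIV. of_int (if j = i then 1 else 0) *\<^sub>R l j) = (\<Sum>j\<in>UNIV. if j = i then l j else 0)"
    by (rule sum.cong) auto
  then show ?thesis
    unfolding lattice_points_def by (intro range_eqI[of _ _ "\<lambda>j. if j = i then 1 else 0"]) simp
qed

lemma lattice_sum: "(\<And>i. i \<in> I \<Longrightarrow> f i \<in> lattice_points) \<Longrightarrow> sum f I \<in> lattice_points"
  by (induction I rule: infinite_finite_induct) (auto intro: lattice_zero lattice_add)

lemma lattice_dil_generators:
  assumes "\<And>i. dil n (l i) \<in> lattice_points" "v \<in> lattice_points"
  shows "dil n v \<in> lattice_points"
proof -
  obtain m :: "3 \<Rightarrow> int" where m: "v = (\<Sum>j\<in>UNIV. of_int (m j) *\<^sub>R l j)"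
    using assms(2) unfolding lattice_points_def by auto
  have "dil n v = (\<Sum>j\<in>UNIV. of_int (m j) *\<^sub>R dil n (l j))"
    unfolding m by (simp add: linear_sum[OF linear_dil] linear_cmul[OF linear_dil])
  then show ?thesis by (auto intro!: lattice_sum lattice_scale assms(1))
qed

lemma lattice_dil_l: "dil 1 (l i) \<in> lattice_points" "dil (-1) (l i) \<in> lattice_points"
  using dilation_l[of i] dilation_inverse_l[of i] unfolding lattice_points_def by blast+

lemma lattice_dil: "v \<in> lattice_points \<Longrightarrow> dil n v \<in> lattice_points"
proof (induction n arbitrary: v rule: int_induct[where k=0])
  case base
  then show ?case by simp
next
  case (step1 n)
  have "dil 1 v \<in> lattice_points"
    by (rule lattice_dil_generators[OF lattice_dil_l(1) step1.prems])
  from step1.IH[OF this] show ?case unfolding dil_dil .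
next
  case (step2 n)
  have "dil (-1) v \<in> lattice_points"
    by (rule lattice_dil_generators[OF lattice_dil_l(2) step2.prems])
  from step2.IH[OF this] show ?case unfolding dil_dil by simp
qed

lemma height_lattice: "v \<in> lattice_points \<Longrightarrow> height v = 0"
  by (auto simp: lattice_points_def linear_sum[OF linear_height])

text \<open>Periodicity is imposed for the three generators; it is needed for the images of the generators
  under dilations, which are general lattice vectors.\<close>

lemma periodic_lattice:
  assumes \<sigma>: "\<sigma> \<in> periodic_forms k" and p: "p \<in> C_times_H" and v: "v \<in> lattice_points"
  shows "\<sigma> (p + v) vs = \<sigma> p vs"
proof -
  have nat: "\<sigma> (q + real n *\<^sub>R l i) vs = \<sigma> q vs" if "q \<in> C_times_H" for q n i
  proof (induction n)
    case (Suc n)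
    have "q + real n *\<^sub>R l i \<in> C_times_H" using that by (simp add: mem_C_times_H)
    from periodic_shift[OF \<sigma> this, of i vs] Suc show ?case by (simp add: algebra_simps)
  qed simp
  have int: "\<sigma> (q + of_int n *\<^sub>R l i) vs = \<sigma> q vs" if q: "q \<in> C_times_H" for q n i
  proof (cases "n \<ge> 0")
    case True
    then show ?thesis using nat[OF q, of "nat n" i] by simp
  next
    case False
    have "q + of_int n *\<^sub>R l i \<in> C_times_H" using q by (simp add: mem_C_times_H)
    from nat[OF this, of "nat (- n)" i] False show ?thesis by (simp add: algebra_simps)
  qed
  obtain m :: "3 \<Rightarrow> int" where m: "v = (\<Sum>j\<in>UNIV. of_int (m j) *\<^sub>R l j)"
    using v unfolding lattice_points_def by auto
  have "p + of_int (m 1) *\<^sub>R l 1 \<in> C_times_H" "p + of_int (m 1) *\<^sub>R l 1 + of_int (m 2) *\<^sub>R l 2 \<in> C_times_H"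
    using p by (auto simp: mem_C_times_H)
  from int[OF p, of "m 1" 1] int[OF this(1), of "m 2" 2] int[OF this(2), of "m 3" 3] show ?thesis
    by (simp add: m sum_3 add.assoc)
qed

section \<open>Equivariant forms\<close>

definition pull :: "int \<Rightarrow> (complex \<times> complex) form \<Rightarrow> (complex \<times> complex) form" where
  "pull n \<sigma> p vs = \<sigma> (dil n p) (map (dil n) vs)"

text \<open>The operator \<open>D\<^sup>* - 1 / \<alpha>\<close>, whose kernel defines the equivariant forms.  The factor \<open>1 / \<alpha>\<close> is
  what remains of the invariance of \<open>height p * \<sigma> p vs\<close> under the dilation.\<close>

definition twist :: "(complex \<times> complex) form \<Rightarrow> (complex \<times> complex) form" where
  "twist \<sigma> p vs = pull 1 \<sigma> p vs - \<sigma> p vs / \<alpha>"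

definition equivariant_forms :: "nat \<Rightarrow> (complex \<times> complex) form set" where
  "equivariant_forms k = {\<sigma> \<in> periodic_forms k. twist \<sigma> = (\<lambda>p vs. 0)}"

lemma pull_0 [simp]: "pull 0 \<sigma> = \<sigma>"
  by (intro ext) (simp add: pull_def map_idI)

lemma pull_pull: "pull m (pull n \<sigma>) = pull (m + n) \<sigma>"
  by (intro ext) (simp add: pull_def dil_dil comp_def add.commute)

lemma periodic_pull: "\<sigma> \<in> periodic_forms k \<Longrightarrow> pull n \<sigma> \<in> periodic_forms k"
proof (rule periodic_formsI)
  assume \<sigma>: "\<sigma> \<in> periodic_forms k"
  show "form_on k C_times_H (pull n \<sigma>)"
    using form_on_pullback[OF open_C_times_H linear_dil dil_mem_C_times_H periodic_form_on[OF \<sigma>]]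
    by (simp add: pull_def[abs_def])
  fix i p vs assume "p \<in> C_times_H"
  then show "pull n \<sigma> (p + l i) vs = pull n \<sigma> p vs"
    using periodic_lattice[OF \<sigma> _ lattice_dil[OF lattice_l]]
    by (simp add: pull_def linear_add[OF linear_dil])
qed

lemma d_form_pull: "\<sigma> \<in> periodic_forms k \<Longrightarrow> d_form (pull n \<sigma>) = pull n (d_form \<sigma>)"
  using ext_deriv_pullback[OF linear_dil dil_mem_C_times_H periodic_form_on]
  by (intro ext) (simp add: pull_def[abs_def])

lemma twist_alt: "twist \<sigma> = (\<lambda>p vs. pull 1 \<sigma> p vs - (1 / \<alpha>) * \<sigma> p vs)"
  by (intro ext) (simp add: twist_def)

lemma periodic_twist: "\<sigma> \<in> periodic_forms k \<Longrightarrow> twist \<sigma> \<in> periodic_forms k"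
  unfolding twist_alt by (intro periodic_forms_diff periodic_forms_scale periodic_pull)

lemma d_form_twist:
  assumes "\<sigma> \<in> periodic_forms k"
  shows "d_form (twist \<sigma>) = twist (d_form \<sigma>)"
proof (intro ext)
  fix p vs
  show "d_form (twist \<sigma>) p vs = twist (d_form \<sigma>) p vs"
    unfolding twist_alt
    by (simp only: d_form_diff[OF periodic_pull[OF assms] periodic_forms_scale[OF assms]]
      d_form_pull[OF assms] ext_deriv_scale[OF periodic_form_on[OF assms]])
qed

lemma twist_add: "twist (\<lambda>p vs. \<sigma> p vs + \<tau> p vs) p vs = twist \<sigma> p vs + twist \<tau> p vs"
  and twist_diff: "twist (\<lambda>p vs. \<sigma> p vs - \<tau> p vs) p vs = twist \<sigma> p vs - twist \<tau> p vs"
  and twist_scale: "twist (\<lambda>p vs. c * \<sigma> p vs) p vs = c * twist \<sigma> p vs"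
  by (auto simp: twist_def pull_def field_simps add_divide_distrib diff_divide_distrib)

lemma equivariant_periodic: "\<sigma> \<in> equivariant_forms k \<Longrightarrow> \<sigma> \<in> periodic_forms k"
  and equivariant_twist: "\<sigma> \<in> equivariant_forms k \<Longrightarrow> twist \<sigma> p vs = 0"
  by (auto simp: equivariant_forms_def)

lemma equivariantI: "\<sigma> \<in> periodic_forms k \<Longrightarrow> (\<And>p vs. twist \<sigma> p vs = 0) \<Longrightarrow> \<sigma> \<in> equivariant_forms k"
  unfolding equivariant_forms_def by blast

section \<open>Surjectivity of the twisted difference operator\<close>

text \<open>Near every point the series is a finite sum with a fixed number of terms.\<close>

lemma locally_finite_sum_periodic:
  assumes g: "\<And>n. g n \<in> periodic_forms k"
    and fin: "\<And>p. p \<in> C_times_H \<Longrightarrow> \<exists>U N. open U \<and> p \<in> U \<and> (\<forall>q\<in>U \<inter> C_times_H. \<forall>n\<ge>N. \<forall>vs. g n q vs = 0)"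
  shows "(\<lambda>p vs. \<Sum>n. g n p vs) \<in> periodic_forms k"
proof (rule periodic_formsI)
  have sums: "(\<Sum>n. g n q vs) = (\<Sum>n<N. g n q vs)" if "\<forall>n\<ge>N. \<forall>vs. g n q vs = 0" for q vs N
    using that by (intro suminf_finite) auto
  have F: "form_on k C_times_H (\<lambda>p vs. \<Sum>n<N. g n p vs)" for N
    by (intro form_on_sum open_C_times_H periodic_form_on g)
  show "form_on k C_times_H (\<lambda>p vs. \<Sum>n. g n p vs)"
  proof (rule form_onI)
    fix p assume "p \<in> C_times_H"
    then obtain N where "\<forall>n\<ge>N. \<forall>vs. g n p vs = 0" using fin by blast
    then have "(\<lambda>vs. \<Sum>n. g n p vs) = (\<lambda>vs. \<Sum>n<N. g n p vs)" using sums by blast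
    then show "alternating_multilinear k (\<lambda>vs. \<Sum>n. g n p vs)"
      using form_on_alternating[OF F \<open>p \<in> C_times_H\<close>] by simp
  next
    fix vs
    show "smooth_fun_on C_times_H (\<lambda>p. \<Sum>n. g n p vs)"
    proof (rule smooth_fun_on_local)
      fix p assume p: "p \<in> C_times_H"
      from fin[OF p] obtain U N
        where U: "open U" "p \<in> U" "\<forall>q\<in>U \<inter> C_times_H. \<forall>n\<ge>N. \<forall>vs. g n q vs = 0"
        by (elim exE conjE) (rule that)
      have "smooth_fun_on (U \<inter> C_times_H) (\<lambda>p. \<Sum>n<N. g n p vs)"
        using form_on_smooth[OF F] by (rule smooth_fun_on_subset) auto
      then have "smooth_fun_on (U \<inter> C_times_H) (\<lambda>p. \<Sum>n. g n p vs)"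
        by (rule smooth_fun_on_cong[rotated 2]) (use U open_C_times_H sums[symmetric] in \<open>auto intro: open_Int\<close>)
      then show "\<exists>T. open T \<and> p \<in> T \<and> smooth_fun_on T (\<lambda>p. \<Sum>n. g n p vs)"
        using U open_C_times_H p by (intro exI[of _ "U \<inter> C_times_H"]) auto
    qed
  qed (auto simp: form_on_outside[OF periodic_form_on[OF g]] form_on_length[OF periodic_form_on[OF g]])
qed (simp add: periodic_shift[OF g])

text \<open>Formally \<open>u\<close> is the series of the \<open>g n\<close>, and \<open>twist u\<close> is a telescoping sum.\<close>

lemma twist_telescope:
  assumes g: "\<And>n. g n \<in> periodic_forms k"
    and fin: "\<And>p. p \<in> C_times_H \<Longrightarrow> \<exists>U N. open U \<and> p \<in> U \<and> (\<forall>q\<in>U \<inter> C_times_H. \<forall>n\<ge>N. \<forall>vs. g n q vs = 0)"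
    and tele: "\<And>n p vs. twist (g n) p vs = h n p vs - h (Suc n) p vs"
    and hfin: "\<And>p vs. p \<in> C_times_H \<Longrightarrow> \<exists>N. \<forall>n\<ge>N. h n p vs = 0"
    and h0: "h 0 \<in> periodic_forms k"
  shows "\<exists>u\<in>periodic_forms k. twist u = h 0"
proof
  let ?u = "\<lambda>p vs. \<Sum>n. g n p vs"
  show u: "?u \<in> periodic_forms k" using g fin by (rule locally_finite_sum_periodic)
  show "twist ?u = h 0"
  proof (intro ext)
    fix p vs
    show "twist ?u p vs = h 0 p vs"
    proof (cases "p \<in> C_times_H")
      case True
      obtain N1 where N1: "\<forall>n\<ge>N1. \<forall>vs. g n p vs = 0" using fin[OF True] True by blast
      have "dil 1 p \<in> C_times_H" using True by simp
      then obtain N2 where N2: "\<forall>n\<ge>N2. \<forall>vs. g n (dil 1 p) vs = 0" using fin by blast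
      obtain N3 where N3: "\<forall>n\<ge>N3. h n p vs = 0" using hfin[OF True] by blast
      define N where "N = max N1 (max N2 N3)"
      have "?u p vs = (\<Sum>n<N. g n p vs)"
        by (rule suminf_finite) (use N1 in \<open>auto simp: N_def\<close>)
      moreover have "?u (dil 1 p) (map (dil 1) vs) = (\<Sum>n<N. g n (dil 1 p) (map (dil 1) vs))"
        by (rule suminf_finite) (use N2 in \<open>auto simp: N_def\<close>)
      ultimately have "twist ?u p vs = (\<Sum>n<N. twist (g n) p vs)"
        by (simp add: twist_def pull_def sum_subtractf sum_divide_distrib)
      also have "\<dots> = (\<Sum>n<N. h n p vs - h (Suc n) p vs)" by (simp add: tele)
      also have "\<dots> = h 0 p vs - h N p vs" by (rule sum_lessThan_telescope')
      also have "h N p vs = 0" using N3 by (simp add: N_def)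
      finally show ?thesis by simp
    next
      case False
      then show ?thesis
        using form_on_outside[OF periodic_form_on[OF periodic_twist[OF u]]]
          form_on_outside[OF periodic_form_on[OF h0]] by simp
    qed
  qed
qed

text \<open>The series \<open>\<Sum>n. \<alpha>\<^sup>-\<^sup>n (D\<^sup>*)\<^sup>-\<^sup>n\<^sup>-\<^sup>1 \<psi>\<close> evaluates \<open>\<psi>\<close> at the points \<open>D\<^sup>-\<^sup>n\<^sup>-\<^sup>1 p\<close>, whose heights tend to
  0 and so leave the support of \<open>\<psi>\<close>.\<close>

lemma twist_surjective_above:
  assumes \<psi>: "\<psi> \<in> periodic_forms k" and van: "\<And>p vs. p \<in> C_times_H \<Longrightarrow> height p \<le> 1 \<Longrightarrow> \<psi> p vs = 0"
  shows "\<exists>u\<in>periodic_forms k. twist u = \<psi>"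
proof -
  define h where "h n = (\<lambda>p vs. (1 / \<alpha>) ^ n * pull (- int n) \<psi> p vs)" for n :: nat
  define g where "g n = (\<lambda>p vs. (1 / \<alpha>) ^ n * pull (- int (Suc n)) \<psi> p vs)" for n :: nat
  have z: "pull (- int n) \<psi> q vs = 0" if "q \<in> C_times_H" "height q \<le> \<alpha> ^ n" for n q vs
    using that \<alpha>_pos by (simp add: pull_def van power_int_minus divide_simps)
  have mono: "\<alpha> ^ N \<le> \<alpha> ^ n" if "n \<ge> N" for n N using that \<alpha>_gt_1 by (intro power_increasing) auto
  have "\<exists>u\<in>periodic_forms k. twist u = h 0"
  proof (rule twist_telescope[where g=g])
    show "g n \<in> periodic_forms k" for n
      unfolding g_def by (intro periodic_forms_scale periodic_pull \<psi>)
    show "h 0 \<in> periodic_forms k" using \<psi> by (simp add: h_def)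
    show "twist (g n) p vs = h n p vs - h (Suc n) p vs" for n p vs
    proof -
      have "pull 1 (g n) p vs = (1 / \<alpha>) ^ n * pull 1 (pull (- int (Suc n)) \<psi>) p vs"
        by (simp add: g_def pull_def)
      then show ?thesis unfolding pull_pull by (simp add: twist_def h_def g_def)
    qed
  next
    fix p :: "complex \<times> complex" assume p: "p \<in> C_times_H"
    \<comment> \<open>Below height p + 1, this many inverse dilations bring every point down to height at most 1.\<close>
    obtain N where N: "height p + 1 < \<alpha> ^ N" using real_arch_pow[OF \<alpha>_gt_1] by blast
    have "open {q. height q < height p + 1}"
      using linear_continuous_on[of height UNIV] linear_height
      by (intro open_Collect_less continuous_on_const) (simp add: linear_conv_bounded_linear)
    moreover have "g n q vs = 0" if "q \<in> C_times_H" "height q < height p + 1" "n \<ge> N" for n q vs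
      using z[OF that(1), of "Suc n" vs] mono[of N "Suc n"] that N by (simp add: g_def)
    ultimately show "\<exists>U N. open U \<and> p \<in> U \<and> (\<forall>q\<in>U \<inter> C_times_H. \<forall>n\<ge>N. \<forall>vs. g n q vs = 0)"
      by (intro exI[of _ "{q. height q < height p + 1}"] exI[of _ N]) auto
    show "\<exists>N. \<forall>n\<ge>N. h n p vs = 0" for vs
    proof (intro exI[of _ N] allI impI)
      fix n assume "n \<ge> N"
      then show "h n p vs = 0" using z[OF p, of n vs] mono[of N n] N by (simp add: h_def)
    qed
  qed
  then show ?thesis by (simp add: h_def)
qed

text \<open>The expansion in the opposite direction, \<open>- \<Sum>n. \<alpha>\<^sup>n\<^sup>+\<^sup>1 (D\<^sup>*)\<^sup>n \<psi>\<close>; here the heights of the points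
  \<open>D\<^sup>n p\<close> tend to infinity.\<close>

lemma twist_surjective_below:
  assumes \<psi>: "\<psi> \<in> periodic_forms k" and van: "\<And>p vs. p \<in> C_times_H \<Longrightarrow> height p \<ge> 2 \<Longrightarrow> \<psi> p vs = 0"
  shows "\<exists>u\<in>periodic_forms k. twist u = \<psi>"
proof -
  define h where "h n = (\<lambda>p vs. \<alpha> ^ n * pull (int n) \<psi> p vs)" for n :: nat
  define g where "g n = (\<lambda>p vs. (- (\<alpha> ^ Suc n)) * pull (int n) \<psi> p vs)" for n :: nat
  have z: "pull (int n) \<psi> q vs = 0" if "q \<in> C_times_H" "\<alpha> ^ n * height q \<ge> 2" for n q vs
    using that by (simp add: pull_def van)
  have mono: "\<alpha> ^ N \<le> \<alpha> ^ n" if "n \<ge> N" for n N using that \<alpha>_gt_1 by (intro power_increasing) auto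
  have "\<exists>u\<in>periodic_forms k. twist u = h 0"
  proof (rule twist_telescope[where g=g])
    show "g n \<in> periodic_forms k" for n
      unfolding g_def by (intro periodic_forms_scale periodic_pull \<psi>)
    show "h 0 \<in> periodic_forms k" using \<psi> by (simp add: h_def)
    show "twist (g n) p vs = h n p vs - h (Suc n) p vs" for n p vs
    proof -
      have "pull 1 (g n) p vs = (- (\<alpha> ^ Suc n)) * pull 1 (pull (int n) \<psi>) p vs"
        by (simp add: g_def pull_def)
      then show ?thesis using \<alpha>_pos unfolding pull_pull by (simp add: twist_def h_def g_def)
    qed
  next
    fix p :: "complex \<times> complex" assume p: "p \<in> C_times_H"
    then have hp: "height p > 0" by (simp add: mem_C_times_H)
    \<comment> \<open>Above half the height of p, this many dilations lift every point to height at least 2.\<close>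
    obtain N where N: "4 / height p < \<alpha> ^ N" using real_arch_pow[OF \<alpha>_gt_1] by blast
    have big: "2 \<le> \<alpha> ^ n * height q" if "height q > height p / 2" "n \<ge> N" for q n
    proof -
      have "2 = 4 / height p * (height p / 2)" using hp by simp
      also have "\<dots> \<le> \<alpha> ^ n * height q" using that N mono[of N n] hp \<alpha>_pos by (intro mult_mono) auto
      finally show ?thesis .
    qed
    have "open {q. height p / 2 < height q}"
      using linear_continuous_on[of height UNIV] linear_height
      by (intro open_Collect_less continuous_on_const) (simp add: linear_conv_bounded_linear)
    moreover have "g n q vs = 0" if "q \<in> C_times_H" "height p / 2 < height q" "n \<ge> N" for n q vs
      using z[OF that(1) big[OF that(2,3)]] by (simp add: g_def)
    ultimately show "\<exists>U N. open U \<and> p \<in> U \<and> (\<forall>q\<in>U \<inter> C_times_H. \<forall>n\<ge>N. \<forall>vs. g n q vs = 0)"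
      using hp by (intro exI[of _ "{q. height p / 2 < height q}"] exI[of _ N]) auto
    show "\<exists>N. \<forall>n\<ge>N. h n p vs = 0" for vs
      using z[OF p big] hp by (intro exI[of _ N]) (auto simp: h_def)
  qed
  then show ?thesis by (simp add: h_def)
qed

lemma periodic_forms_height_mult:
  assumes "\<sigma> \<in> periodic_forms k" "smooth_fun_on {0<..} f"
  shows "(\<lambda>p vs. f (height p) * \<sigma> p vs) \<in> periodic_forms k"
  using assms by (intro periodic_formsI form_on_fun_mult open_C_times_H smooth_height_compose)
    (auto simp: periodic_shift intro: periodic_form_on)

text \<open>Cut \<open>\<zeta>\<close> off at heights between 1 and 2 and treat the upper and the lower part separately.\<close>

lemma twist_surjective:
  assumes \<zeta>: "\<zeta> \<in> periodic_forms k"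
  shows "\<exists>u\<in>periodic_forms k. twist u = \<zeta>"
proof -
  obtain f :: "real \<Rightarrow> real" where f: "smooth_fun_on UNIV f" "\<forall>t\<le>1. f t = 0" "\<forall>t\<ge>2. f t = 1"
    using smooth_cutoff_exists by blast
  have sf: "smooth_fun_on {0<..} f" using smooth_fun_on_subset[OF f(1)] by simp
  then have sf': "smooth_fun_on {0<..} (\<lambda>t. 1 - f t)" by (intro smooth_fun_on_diff) auto
  obtain u where u: "u \<in> periodic_forms k" "twist u = (\<lambda>p vs. f (height p) * \<zeta> p vs)"
    using twist_surjective_above[OF periodic_forms_height_mult[OF \<zeta> sf]] f(2) by auto
  obtain v where v: "v \<in> periodic_forms k" "twist v = (\<lambda>p vs. (1 - f (height p)) * \<zeta> p vs)"
    using twist_surjective_below[OF periodic_forms_height_mult[OF \<zeta> sf']] f(3) by auto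
  show ?thesis
    using periodic_forms_add[OF u(1) v(1)]
    by (intro bexI[of _ "\<lambda>p vs. u p vs + v p vs"]) (auto simp: fun_eq_iff twist_add u(2) v(2) algebra_simps)
qed

end

section \<open>The exterior derivative as an operator on forms\<close>

lemma alternating_1I:
  assumes "\<And>v w. c [v + w] = c [v] + c [w]" "\<And>r v. c [r *\<^sub>R v] = r * c [v]"
  shows "alternating_multilinear 1 c"
  by (rule alternating_multilinearI) (use assms in \<open>auto simp: length_Suc_conv\<close>)

lemma alternating_2I:
  assumes "\<And>v w x. c [v + w, x] = c [v, x] + c [w, x]" "\<And>v w x. c [x, v + w] = c [x, v] + c [x, w]"
    "\<And>r v x. c [r *\<^sub>R v, x] = r * c [v, x]" "\<And>r v x. c [x, r *\<^sub>R v] = r * c [x, v]" "\<And>v. c [v, v] = 0"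
  shows "alternating_multilinear 2 c"
  by (rule alternating_multilinearI)
    (use assms in \<open>auto simp: length_Suc_conv numeral_2_eq_2 less_Suc_eq\<close>)

lemma alternating_3I:
  assumes "\<And>v w x y. c [v + w, x, y] = c [v, x, y] + c [w, x, y]" "\<And>v w x y. c [x, v + w, y] = c [x, v, y] + c [x, w, y]"
    "\<And>v w x y. c [x, y, v + w] = c [x, y, v] + c [x, y, w]"
    "\<And>r v x y. c [r *\<^sub>R v, x, y] = r * c [v, x, y]" "\<And>r v x y. c [x, r *\<^sub>R v, y] = r * c [x, v, y]"
    "\<And>r v x y. c [x, y, r *\<^sub>R v] = r * c [x, y, v]"
    "\<And>v x. c [v, v, x] = 0" "\<And>v x. c [v, x, v] = 0" "\<And>v x. c [x, v, v] = 0"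
  shows "alternating_multilinear 3 c"
  by (rule alternating_multilinearI)
    (use assms in \<open>auto simp: length_Suc_conv numeral_3_eq_3 less_Suc_eq\<close>)

lemma alternating_directional:
  assumes S: "open S" and \<omega>: "form_on k S \<omega>" and x: "x \<in> S"
  shows "alternating_multilinear k (\<lambda>ws. frechet_derivative (\<lambda>y. \<omega> y ws) (at x) u)"
  by (rule alternating_multilinear_transform[where T="\<lambda>f. frechet_derivative f (at x) u" and S=S])
    (auto simp: frechet_derivative_add[OF form_on_smooth[OF \<omega>] form_on_smooth[OF \<omega>] x]
      frechet_derivative_cmult[OF form_on_smooth[OF \<omega>] x]
      intro: form_on_alternating[OF \<omega>] frechet_derivative_cong_open[OF S x, THEN fun_cong])

text \<open>At a fixed point let \<open>c u ws\<close> be the derivative along \<open>u\<close> of the coefficient with arguments \<open>ws\<close>.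
  It is linear in \<open>u\<close> and alternating in \<open>ws\<close>, and the differential is the alternating sum over
  the choices of \<open>u\<close> among the arguments; in low degree the alternating property is read off from
  the explicit sum.\<close>

lemma form_on_ext_deriv:
  assumes S: "open S" and \<omega>: "form_on k S \<omega>" and k: "k \<le> 2"
  shows "form_on (Suc k) S (ext_deriv S \<omega>)"
proof (rule form_onI)
  fix x assume x: "x \<in> S"
  define c where "c u ws = frechet_derivative (\<lambda>y. \<omega> y ws) (at x) u" for u ws
  have alt: "alternating_multilinear k (c u)" for u
    unfolding c_def[abs_def] by (rule alternating_directional[OF S \<omega> x])
  have lin: "c (v + w) ws = c v ws + c w ws" "c (r *\<^sub>R v) ws = r * c v ws" for v w r ws
    using linear_add[OF smooth_fun_on_linear_derivative[OF form_on_smooth[OF \<omega>] x]]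
      linear_cmul[OF smooth_fun_on_linear_derivative[OF form_on_smooth[OF \<omega>] x]]
    by (simp_all add: c_def)
  have d: "ext_deriv S \<omega> x vs = (\<Sum>i<length vs. (-1) ^ i * c (vs ! i) (omit i vs))" for vs
    using x by (simp add: ext_deriv_def c_def)
  consider "k = 0" | "k = 1" | "k = 2" using k by linarith
  then show "alternating_multilinear (Suc k) (ext_deriv S \<omega> x)"
  proof cases
    case 1
    have "alternating_multilinear 1 (ext_deriv S \<omega> x)"
      by (rule alternating_1I) (simp_all add: d omit_def lin)
    then show ?thesis using 1 by simp
  next
    case 2
    note a = alternating_1[OF alt[unfolded 2]]
    have "alternating_multilinear 2 (ext_deriv S \<omega> x)"
      by (rule alternating_2I) (simp_all add: d omit_def lin a algebra_simps)
    then show ?thesis using 2 by (simp add: numeral_2_eq_2)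
  next
    case 3
    note a = alternating_2[OF alt[unfolded 3]]
    have "alternating_multilinear 3 (ext_deriv S \<omega> x)"
    proof (rule alternating_3I)
      fix v w show "ext_deriv S \<omega> x [v, w, v] = 0"
        using alternating_2_swap[OF alt[unfolded 3], of v v w]
        by (simp add: d omit_def numeral_2_eq_2 a)
    qed (simp_all add: d omit_def numeral_2_eq_2 lin a algebra_simps)
    then show ?thesis using 3 by (simp add: numeral_3_eq_3)
  qed
next
  fix vs
  have "smooth_fun_on S (\<lambda>x. \<Sum>i<length vs. (-1) ^ i * frechet_derivative (\<lambda>y. \<omega> y (omit i vs)) (at x) (vs ! i))"
    by (intro smooth_fun_on_sum smooth_fun_on_mult S smooth_fun_on_const smooth_fun_on_directional form_on_smooth[OF \<omega>])
  then show "smooth_fun_on S (\<lambda>x. ext_deriv S \<omega> x vs)"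
    by (rule smooth_fun_on_cong[OF S, rotated]) (simp add: ext_deriv_def)
next
  fix x vs assume "x \<notin> S"
  then show "ext_deriv S \<omega> x vs = 0" by (simp add: ext_deriv_def)
qed (rule ext_deriv_length[OF \<omega>])

lemma ext_deriv_ext_deriv_2:
  assumes "open S" "form_on 2 S \<omega>" "x \<in> S"
  shows "ext_deriv S (ext_deriv S \<omega>) x [a, b, c, e] = 0"
proof -
  have f: "smooth_fun_on S (\<lambda>y. \<omega> y [a, b])" for a b by (rule form_on_smooth[OF assms(2)])
  define H where "H a b u v = frechet_derivative (\<lambda>y. frechet_derivative (\<lambda>y. \<omega> y [a, b]) (at y) u) (at x) v" for a b u v
  have sym: "H a b u v = H a b v u" for a b u v
    unfolding H_def by (rule symmetric_second_derivative[OF assms(1) f assms(3)])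
  have e: "frechet_derivative (\<lambda>y. ext_deriv S \<omega> y [p, q, r]) (at x) v = H q r p v - H p r q v + H p q r v" for p q r v
  proof -
    note sm = smooth_fun_on_directional[OF f]
    have "frechet_derivative (\<lambda>y. ext_deriv S \<omega> y [p, q, r]) (at x)
       = frechet_derivative (\<lambda>y. (frechet_derivative (\<lambda>y. \<omega> y [q, r]) (at y) p -
           frechet_derivative (\<lambda>y. \<omega> y [p, r]) (at y) q) + frechet_derivative (\<lambda>y. \<omega> y [p, q]) (at y) r) (at x)"
      by (rule frechet_derivative_cong_open[OF assms(1,3)]) (simp add: ext_deriv_def omit_def numeral_2_eq_2)
    then show ?thesis
      by (simp add: H_def frechet_derivative_add[OF smooth_fun_on_diff[OF assms(1) sm sm] sm assms(3)]
          frechet_derivative_diff[OF sm sm assms(3)])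
  qed
  show ?thesis
    using assms(3) sym[of c e a b] sym[of b e a c] sym[of b c a e] sym[of a e b c] sym[of a c b e] sym[of a b c e]
    by (simp add: ext_deriv_def[of S "ext_deriv S \<omega>"] omit_def e numeral_2_eq_2 numeral_3_eq_3)
qed

lemma ext_deriv_ext_deriv:
  assumes "open S" "form_on k S \<omega>" "k \<le> 2"
  shows "ext_deriv S (ext_deriv S \<omega>) = (\<lambda>x vs. 0)"
proof (intro ext)
  fix x vs
  have "form_on (Suc k) S (ext_deriv S \<omega>)" using assms by (rule form_on_ext_deriv)
  note len = ext_deriv_length[OF this]
  show "ext_deriv S (ext_deriv S \<omega>) x vs = 0"
  proof (cases "x \<in> S \<and> length vs = Suc (Suc k)")
    case True
    consider "k = 0" | "k = 1" | "k = 2" using assms(3) by linarith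
    then show ?thesis
    proof cases
      case 1
      then obtain u v where "vs = [u, v]" using True by (auto simp: length_Suc_conv)
      then show ?thesis using ext_deriv_ext_deriv_0 assms True 1 by blast
    next
      case 2
      then obtain u v w where "vs = [u, v, w]" using True by (auto simp: length_Suc_conv)
      then show ?thesis using ext_deriv_ext_deriv_1 assms True 2 by blast
    next
      case 3
      then obtain u v w z where "vs = [u, v, w, z]" using True by (auto simp: length_Suc_conv numeral_2_eq_2)
      then show ?thesis using ext_deriv_ext_deriv_2 assms True 3 by blast
    qed
  next
    case outside: False
    show ?thesis
    proof (cases "x \<in> S")
      case True
      then show ?thesis using outside len by blast
    qed (simp add: ext_deriv_def)
  qed
qed

section \<open>Eigenvalues of the dilation on constant horizontal forms\<close>

definition const_form :: "((complex \<times> complex) list \<Rightarrow> real) \<Rightarrow> (complex \<times> complex) form" where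
  "const_form c p vs = (if p \<in> C_times_H then c vs else 0)"

text \<open>Horizontal forms of degree one and two are parametrised by complex numbers, on which the dilation
  acts by multiplication: \<open>covector\<close> is \<open>Re (P dz) + r d(Re w)\<close>, \<open>fiber_area\<close> is \<open>dx \<and> dy\<close> for
  \<open>z = x + i y\<close>, and \<open>mixed_area\<close> is \<open>Re (Q dz) \<and> d(Re w)\<close>.\<close>

definition covector :: "complex \<Rightarrow> real \<Rightarrow> (complex \<times> complex) list \<Rightarrow> real" where
  "covector P r vs = (case vs of [v] \<Rightarrow> Re (P * fst v) + r * Re (snd v) | _ \<Rightarrow> 0)"

definition fiber_area :: "(complex \<times> complex) list \<Rightarrow> real" where
  "fiber_area vs = (case vs of [v, w] \<Rightarrow> Im (cnj (fst v) * fst w) | _ \<Rightarrow> 0)"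

definition mixed_area :: "complex \<Rightarrow> (complex \<times> complex) list \<Rightarrow> real" where
  "mixed_area Q vs = (case vs of [v, w] \<Rightarrow> Re (Q * (fst v * of_real (Re (snd w)) - fst w * of_real (Re (snd v)))) | _ \<Rightarrow> 0)"

lemma covector_alternating: "alternating_multilinear 1 (covector P r)"
  by (rule alternating_1I) (auto simp: covector_def algebra_simps)

lemma fiber_area_alternating: "alternating_multilinear 2 fiber_area"
  by (rule alternating_2I) (auto simp: fiber_area_def algebra_simps)

lemma mixed_area_alternating: "alternating_multilinear 2 (mixed_area Q)"
  by (rule alternating_2I) (auto simp: mixed_area_def algebra_simps)

lemma covector_length: "length vs \<noteq> 1 \<Longrightarrow> covector P r vs = 0"
  and fiber_area_length: "length vs \<noteq> 2 \<Longrightarrow> fiber_area vs = 0"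
  and mixed_area_length: "length vs \<noteq> 2 \<Longrightarrow> mixed_area Q vs = 0"
  by (auto simp: covector_def fiber_area_def mixed_area_def split: list.split)

lemma horizontal_part_coordinates:
  "horizontal_part v = Re (fst v) *\<^sub>R (1, 0) + Im (fst v) *\<^sub>R (\<i>, 0) + Re (snd v) *\<^sub>R (0, 1)"
  by (auto simp: horizontal_part_def prod_eq_iff complex_eq_iff)

lemma covector_exists:
  assumes "alternating_multilinear 1 c" "\<And>vs. length vs \<noteq> 1 \<Longrightarrow> c vs = 0"
    and "\<And>vs. c (map horizontal_part vs) = c vs"
  shows "\<exists>P r. c = covector P r"
proof (intro exI ext)
  fix vs
  define e1 e2 e3 :: "complex \<times> complex" where e: "e1 = (1, 0)" "e2 = (\<i>, 0)" "e3 = (0, 1)"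
  show "c vs = covector (Complex (c [e1]) (- c [e2])) (c [e3]) vs"
  proof (cases "length vs = 1")
    case True
    then obtain v where v: "vs = [v]" by (auto simp: length_Suc_conv)
    have "c vs = c [horizontal_part v]" using assms(3)[of vs] v by simp
    then show ?thesis
      unfolding horizontal_part_coordinates e[symmetric]
      by (simp add: v alternating_1[OF assms(1)] covector_def algebra_simps)
  qed (simp add: assms(2) covector_length)
qed

lemma area_exists:
  assumes c: "alternating_multilinear 2 c" "\<And>vs. length vs \<noteq> 2 \<Longrightarrow> c vs = 0"
    and "\<And>vs. c (map horizontal_part vs) = c vs"
  shows "\<exists>Q. c = (\<lambda>vs. c [(1, 0), (\<i>, 0)] * fiber_area vs + mixed_area Q vs)"
proof (intro exI ext)
  fix vs
  define e1 e2 e3 :: "complex \<times> complex" where e: "e1 = (1, 0)" "e2 = (\<i>, 0)" "e3 = (0, 1)"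
  note a = alternating_2[OF c(1)] and sw = alternating_2_swap[OF c(1), of e2 e1]
    alternating_2_swap[OF c(1), of e3 e1] alternating_2_swap[OF c(1), of e3 e2]
  show "c vs = c [(1, 0), (\<i>, 0)] * fiber_area vs
    + mixed_area (Complex (c [e1, e3]) (- c [e2, e3])) vs"
  proof (cases "length vs = 2")
    case True
    then obtain v w where v: "vs = [v, w]" by (auto simp: length_Suc_conv numeral_2_eq_2)
    have "c vs = c [horizontal_part v, horizontal_part w]" using assms(3)[of vs] v by simp
    then show ?thesis
      unfolding horizontal_part_coordinates e[symmetric]
      by (simp add: v a sw fiber_area_def mixed_area_def algebra_simps)
  qed (simp add: c(2) fiber_area_length mixed_area_length)
qed

lemma covector_diff: "covector P r vs - covector P' r' vs = covector (P - P') (r - r') vs"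
  and covector_divide: "covector P r vs / a = covector (P / of_real a) (r / a) vs"
  and mixed_area_diff: "mixed_area Q vs - mixed_area Q' vs = mixed_area (Q - Q') vs"
  and mixed_area_divide: "mixed_area Q vs / a = mixed_area (Q / of_real a) vs"
  by (auto simp: covector_def mixed_area_def algebra_simps add_divide_distrib diff_divide_distrib split: list.split)

context inoue_lattice
begin

lemma periodic_const_form:
  "alternating_multilinear k c \<Longrightarrow> (\<And>vs. length vs \<noteq> k \<Longrightarrow> c vs = 0) \<Longrightarrow> const_form c \<in> periodic_forms k"
  unfolding const_form_def[abs_def] by (rule periodic_forms_const)

lemma period_const_form: "period (const_form c) vs = c (map horizontal_part vs)"
  unfolding const_form_def[abs_def] by (rule period_const)

lemma d_form_const_form [simp]: "d_form (const_form c) p vs = 0"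
proof (cases "p \<in> C_times_H")
  case True
  then have "frechet_derivative (\<lambda>q. const_form c q ws) (at p) = frechet_derivative (\<lambda>q. c ws) (at p)" for ws
    by (intro frechet_derivative_cong_open[OF open_C_times_H]) (auto simp: const_form_def)
  then show ?thesis using True by (simp add: ext_deriv_def)
qed (simp add: ext_deriv_def)

lemma twist_const_form:
  "twist (const_form c) = const_form (\<lambda>vs. c (map (dil 1) vs) - c vs / \<alpha>)"
  by (intro ext) (auto simp: twist_def pull_def const_form_def)

lemma \<beta>_cnj: "\<beta> * cnj \<beta> * \<alpha> = 1"
proof -
  have "\<beta> * cnj \<beta> * \<alpha> = of_real ((cmod \<beta>)\<^sup>2 * \<alpha>)" by (simp add: complex_norm_square del: of_real_power)
  then show ?thesis using norm_\<beta> by simp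
qed

text \<open>The only place where the eigenvalue \<open>1 / \<alpha>\<close> occurs: areas in the \<open>z\<close>-plane scale by
  \<open>\<beta> cnj \<beta> = 1 / \<alpha>\<close>.\<close>

lemma fiber_area_dil: "fiber_area (map (dil 1) vs) = fiber_area vs / \<alpha>"
proof -
  have n: "cnj \<beta> * \<beta> = of_real (1 / \<alpha>)" using \<beta>_cnj \<alpha>_pos by (simp add: field_simps)
  have "Im (cnj (\<beta> * z) * (\<beta> * w)) = Im (cnj z * w) / \<alpha>" for z w
  proof -
    have "cnj (\<beta> * z) * (\<beta> * w) = of_real (1 / \<alpha>) * (cnj z * w)" unfolding n[symmetric] by simp
    moreover have "Im (of_real r * x) = r * Im x" for r x by simp
    ultimately show ?thesis by (simp only: times_divide_eq_left mult_1)
  qed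
  then show ?thesis by (auto simp: fiber_area_def dilation_def split: list.split)
qed

lemma covector_dil: "covector P r (map (dil 1) vs) = covector (P * \<beta>) (r * \<alpha>) vs"
  by (auto simp: covector_def dilation_def algebra_simps split: list.split)

lemma mixed_area_dil: "mixed_area Q (map (dil 1) vs) = mixed_area (Q * \<alpha> * \<beta>) vs"
  by (auto simp: mixed_area_def dilation_def algebra_simps split: list.split)

lemma \<beta>_neq_real: "\<beta> \<noteq> complex_of_real r"
  using \<beta>_nonreal by (metis Reals_of_real)

text \<open>The dilation multiplies \<open>P\<close> by \<open>\<beta>\<close> and \<open>r\<close> by \<open>\<alpha>\<close>; neither factor equals \<open>1 / \<alpha>\<close>.\<close>

lemma covector_twist_solvable:
  "\<exists>P' r'. \<forall>vs. covector P' r' (map (dil 1) vs) - covector P' r' vs / \<alpha> = covector P r vs"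
proof (intro exI allI)
  fix vs
  have \<beta>: "\<beta> - of_real (1 / \<alpha>) \<noteq> 0" using \<beta>_neq_real[of "1 / \<alpha>"] by simp
  have \<alpha>: "\<alpha> - 1 / \<alpha> \<noteq> 0" using \<alpha>_gt_1 by (simp add: field_simps) (smt (verit) mult_less_cancel_left2)
  let ?P = "P / (\<beta> - of_real (1 / \<alpha>))" and ?r = "r / (\<alpha> - 1 / \<alpha>)"
  have "?P * \<beta> - ?P / of_real \<alpha> = ?P * (\<beta> - of_real (1 / \<alpha>))" "?r * \<alpha> - ?r / \<alpha> = ?r * (\<alpha> - 1 / \<alpha>)"
    by (simp_all add: right_diff_distrib)
  then show "covector ?P ?r (map (dil 1) vs) - covector ?P ?r vs / \<alpha> = covector P r vs"
    using \<alpha> \<beta> by (simp only: covector_dil covector_divide covector_diff) simp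
qed

text \<open>The dilation multiplies \<open>Q\<close> by \<open>\<alpha> \<beta>\<close>, which is not real and so differs from \<open>1 / \<alpha>\<close>.\<close>

lemma mixed_area_twist:
  "mixed_area Q (map (dil 1) vs) - mixed_area Q vs / \<alpha> = mixed_area (Q * (of_real \<alpha> * \<beta> - of_real (1 / \<alpha>))) vs"
  by (simp add: mixed_area_dil mixed_area_divide mixed_area_diff right_diff_distrib mult.assoc)

lemma mixed_eigenvalue: "of_real \<alpha> * \<beta> - of_real (1 / \<alpha>) \<noteq> 0"
proof
  assume "of_real \<alpha> * \<beta> - of_real (1 / \<alpha>) = 0"
  then have "\<beta> = of_real (1 / \<alpha> / \<alpha>)" using \<alpha>_pos by (simp add: field_simps)
  then show False using \<beta>_neq_real by blast
qed

lemma mixed_area_twist_solvable: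
  "\<exists>Q'. \<forall>vs. mixed_area Q' (map (dil 1) vs) - mixed_area Q' vs / \<alpha> = mixed_area Q vs"
  using mixed_eigenvalue
  by (intro exI[of _ "Q / (of_real \<alpha> * \<beta> - of_real (1 / \<alpha>))"]) (simp add: mixed_area_twist)

end

context inoue_lattice
begin

section \<open>Lifting closed equivariant forms to periodic primitives\<close>

lemma periodic_d_form: "\<sigma> \<in> periodic_forms k \<Longrightarrow> k \<le> 2 \<Longrightarrow> d_form \<sigma> \<in> periodic_forms (Suc k)"
proof (rule periodic_formsI)
  assume \<sigma>: "\<sigma> \<in> periodic_forms k" and k: "k \<le> 2"
  show "form_on (Suc k) C_times_H (d_form \<sigma>)"
    by (rule form_on_ext_deriv[OF open_C_times_H periodic_form_on[OF \<sigma>] k])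
  fix i p vs assume p: "p \<in> C_times_H"
  have p': "p + l i \<in> C_times_H" using p by (simp add: translate_C_times_H)
  have "frechet_derivative (\<lambda>q. \<sigma> q ws) (at (p + l i)) v = frechet_derivative (\<lambda>q. \<sigma> q ws) (at p) v" for ws v
  proof -
    have "frechet_derivative (\<lambda>q. \<sigma> (q + l i) ws) (at p) v = frechet_derivative (\<lambda>q. \<sigma> q ws) (at (p + l i)) v"
      using frechet_derivative_affine[OF linear_id form_on_smooth[OF periodic_form_on[OF \<sigma>]], of p "l i" ws] p' by simp
    moreover have "frechet_derivative (\<lambda>q. \<sigma> (q + l i) ws) (at p) = frechet_derivative (\<lambda>q. \<sigma> q ws) (at p)"
      by (rule frechet_derivative_cong_open[OF open_C_times_H p]) (rule periodic_shift[OF \<sigma>])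
    ultimately show ?thesis by simp
  qed
  then show "d_form \<sigma> (p + l i) vs = d_form \<sigma> p vs" using p p' by (simp add: ext_deriv_def)
qed

lemma d_form_d_form: "\<sigma> \<in> periodic_forms k \<Longrightarrow> k \<le> 2 \<Longrightarrow> d_form (d_form \<sigma>) p vs = 0"
  using ext_deriv_ext_deriv[OF open_C_times_H periodic_form_on] by simp

lemma period_horizontal: "period \<sigma> (map horizontal_part vs) = period \<sigma> vs"
  by (simp add: period_def comp_def horizontal_part_idem)

text \<open>Apply \<open>twist\<close> to \<open>\<sigma> = d \<eta> + c\<close>, where \<open>c\<close> is the period.  The left-hand side vanishes and
  \<open>twist (d \<eta>)\<close> is exact, so the constant form \<open>twist c\<close> has zero period, that is,
  \<open>D\<^sup>* c = c / \<alpha>\<close>, and then \<open>twist \<eta>\<close> is closed.\<close>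

lemma period_equivariant_closed:
  assumes \<sigma>: "\<sigma> \<in> equivariant_forms (Suc k)" and closed: "d_form \<sigma> = (\<lambda>p vs. 0)" and k: "k \<le> 2"
  obtains \<eta> where "\<eta> \<in> periodic_forms k" "\<sigma> = (\<lambda>p vs. d_form \<eta> p vs + const_form (period \<sigma>) p vs)"
    "d_form (twist \<eta>) = (\<lambda>p vs. 0)" "\<And>vs. period \<sigma> (map (dil 1) vs) = period \<sigma> vs / \<alpha>"
proof -
  have P: "\<sigma> \<in> periodic_forms (Suc k)" using \<sigma> by (rule equivariant_periodic)
  have "Suc k \<in> {1, 2, 3}" using k by auto
  from periodic_closed_form_cohomologous_const[OF P closed this] obtain \<eta>
    where \<eta>: "\<eta> \<in> periodic_forms k" "\<sigma> = (\<lambda>p vs. d_form \<eta> p vs + const_form (period \<sigma>) p vs)"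
    unfolding const_form_def by blast
  let ?c = "\<lambda>vs. period \<sigma> (map (dil 1) vs) - period \<sigma> vs / \<alpha>"
  have cP: "const_form (period \<sigma>) \<in> periodic_forms (Suc k)"
    by (rule periodic_const_form[OF period_alternating[OF P]])
  have tw: "d_form (twist \<eta>) p vs + const_form ?c p vs = 0" for p vs
  proof -
    have "twist \<sigma> p vs = twist (d_form \<eta>) p vs + twist (const_form (period \<sigma>)) p vs"
      using twist_add[of "d_form \<eta>" "const_form (period \<sigma>)" p vs] \<eta>(2) by simp
    then show ?thesis
      using equivariant_twist[OF \<sigma>] by (simp add: d_form_twist[OF \<eta>(1)] twist_const_form)
  qed
  have c0: "?c vs = 0" for vs
  proof -
    have "period (\<lambda>p vs. d_form (twist \<eta>) p vs + const_form ?c p vs) vs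
        = period (d_form (twist \<eta>)) vs + period (const_form ?c) vs"
      using periodic_d_form[OF periodic_twist[OF \<eta>(1)] k] periodic_twist[OF cP]
      unfolding twist_const_form by (intro period_add periodic_form_on)
    moreover have "period (\<lambda>p vs. d_form (twist \<eta>) p vs + const_form ?c p vs) vs = 0"
      unfolding tw using period_scale[of 0 "\<lambda>p vs. 0" vs] by simp
    ultimately have "?c (map horizontal_part vs) = 0"
      using period_ext_deriv[OF periodic_twist[OF \<eta>(1)]] by (simp add: period_const_form)
    moreover have "period \<sigma> (map (dil 1) (map horizontal_part vs)) = period \<sigma> (map (dil 1) vs)"
      using period_horizontal[of \<sigma> "map (dil 1) vs"] by (simp add: comp_def horizontal_part_dil)
    ultimately show ?thesis using period_horizontal[of \<sigma> vs] by simp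
  qed
  have "d_form (twist \<eta>) = (\<lambda>p vs. 0)"
    using tw c0 by (intro ext) (simp add: const_form_def)
  with that[OF \<eta>] c0 show ?thesis by simp
qed

lemma closed_0_form_const:
  assumes \<xi>: "\<xi> \<in> periodic_forms 0" and closed: "d_form \<xi> = (\<lambda>p vs. 0)"
  shows "\<xi> = const_form (\<xi> vertical)"
proof (intro ext)
  fix p vs
  have f: "form_on 0 C_times_H \<xi>" using \<xi> by (rule periodic_form_on)
  show "\<xi> p vs = const_form (\<xi> vertical) p vs"
  proof (cases "p \<in> C_times_H \<and> vs = []")
    case True
    then have p: "p \<in> C_times_H" and vs: "vs = []" by auto
    have z: "frechet_derivative (\<lambda>y. \<xi> y []) (at q) v = 0" if "q \<in> C_times_H" for q v
      using fun_cong[OF fun_cong[OF closed], of q "[v]"] that by (simp add: ext_deriv_def)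
    have seg: "vertical + s *\<^sub>R (p - vertical) \<in> C_times_H" if "s \<in> {0..1}" for s
      using convexD_alt[OF convex_C_times_H vertical_in_C_times_H p, of s] that by (simp add: algebra_simps)
    show ?thesis
      using constant_along_segment[OF seg form_on_smooth[OF f], of "[]"] z p vs
      by (simp add: const_form_def)
  next
    case False
    then show ?thesis using form_on_outside[OF f] form_on_length[OF f] by (auto simp: const_form_def)
  qed
qed

section \<open>Equivariant cohomology in degree one\<close>

text \<open>The period is an eigenvector for \<open>1 / \<alpha>\<close> in degree one, hence zero.  So \<open>\<sigma>\<close> has a periodic
  primitive, for which \<open>twist\<close> is a constant function; subtracting the right constant makes the
  primitive equivariant, because \<open>1 \<noteq> 1 / \<alpha>\<close>.\<close>

theorem equivariant_closed_1_exact: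
  assumes \<sigma>: "\<sigma> \<in> equivariant_forms 1" and closed: "d_form \<sigma> = (\<lambda>p vs. 0)"
  shows "\<exists>\<eta>\<in>equivariant_forms 0. \<sigma> = d_form \<eta>"
proof -
  have \<sigma>': "\<sigma> \<in> equivariant_forms (Suc 0)" using \<sigma> by simp
  obtain \<eta> where \<eta>: "\<eta> \<in> periodic_forms 0" "\<sigma> = (\<lambda>p vs. d_form \<eta> p vs + const_form (period \<sigma>) p vs)"
    "d_form (twist \<eta>) = (\<lambda>p vs. 0)" "\<And>vs. period \<sigma> (map (dil 1) vs) = period \<sigma> vs / \<alpha>"
    using period_equivariant_closed[OF \<sigma>' closed] by auto
  have P: "\<sigma> \<in> periodic_forms 1" using \<sigma> by (rule equivariant_periodic)
  obtain P' r where c: "period \<sigma> = covector P' r"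
    using covector_exists[OF period_alternating[OF P] period_horizontal] by blast
  have ev: "covector (P' * \<beta>) (r * \<alpha>) vs = covector P' r vs / \<alpha>" for vs
    using \<eta>(4) by (simp add: c covector_dil)
  have r0: "r = 0"
  proof -
    have "r * \<alpha> = r / \<alpha>" using ev[of "[(0, 1)]"] by (simp add: covector_def)
    then have "r * (\<alpha> * \<alpha> - 1) = 0" using \<alpha>_pos by (simp add: field_simps)
    moreover have "\<alpha> * \<alpha> > 1" using \<alpha>_gt_1 less_1_mult by blast
    ultimately show ?thesis by simp
  qed
  have P0: "P' = 0"
  proof -
    have "Re (P' * \<beta> * z) = Re (P' * z) / \<alpha>" for z
      using ev[of "[(z, 0)]"] by (simp add: covector_def)
    from this[of 1] this[of \<i>] have "P' * \<beta> = P' * of_real (1 / \<alpha>)"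
      by (simp add: complex_eq_iff)
    then have "P' * (\<beta> - of_real (1 / \<alpha>)) = 0" by (simp only: right_diff_distrib) simp
    then show ?thesis using \<beta>_neq_real[of "1 / \<alpha>"] by simp
  qed
  have c0: "period \<sigma> vs = 0" for vs by (auto simp: c r0 P0 covector_def split: list.split)
  have eq: "\<sigma> p vs = d_form \<eta> p vs" for p vs
    using fun_cong[OF fun_cong[OF \<eta>(2)], of p vs] c0 by (simp add: const_form_def)
  let ?k = "twist \<eta> vertical"
  \<comment> \<open>The factor by which twist multiplies constant functions.\<close>
  define a where "a = 1 - 1 / \<alpha>"
  have a: "a \<noteq> 0" using \<alpha>_gt_1 by (simp add: a_def)
  have k: "twist \<eta> = const_form ?k" by (rule closed_0_form_const[OF periodic_twist[OF \<eta>(1)] \<eta>(3)])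
  define c where "c vs = (1 / a) * ?k vs" for vs
  have len: "?k vs = 0" if "length vs \<noteq> 0" for vs
    using form_on_length[OF periodic_form_on[OF periodic_twist[OF \<eta>(1)]] that] .
  have cP: "const_form c \<in> periodic_forms 0"
    by (rule periodic_const_form) (auto simp: alternating_multilinear_def c_def len)
  have tc: "twist (const_form c) = const_form ?k"
  proof -
    have "c (map (dil 1) vs) - c vs / \<alpha> = ?k vs" for vs
    proof (cases "vs = []")
      case True
      have "c [] - c [] / \<alpha> = a * c []" using \<alpha>_pos by (simp add: a_def field_simps)
      then show ?thesis using a True by (simp add: c_def)
    qed (simp add: c_def len)
    then show ?thesis by (simp add: twist_const_form)
  qed
  let ?\<eta> = "\<lambda>p vs. \<eta> p vs - const_form c p vs"
  have "?\<eta> \<in> equivariant_forms 0"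
    by (rule equivariantI) (auto intro: periodic_forms_diff \<eta>(1) cP simp: twist_diff tc simp flip: k)
  moreover have "\<sigma> = d_form ?\<eta>"
    by (intro ext) (simp add: eq d_form_diff[OF \<eta>(1) cP])
  ultimately show ?thesis by blast
qed

section \<open>Equivariant cohomology in degree two\<close>

definition area_form :: "(complex \<times> complex) form" where
  "area_form = const_form fiber_area"

lemma area_form_equivariant: "area_form \<in> equivariant_forms 2"
proof (rule equivariantI)
  show "area_form \<in> periodic_forms 2"
    unfolding area_form_def by (rule periodic_const_form[OF fiber_area_alternating fiber_area_length])
  show "twist area_form p vs = 0" for p vs
    by (simp add: area_form_def twist_const_form const_form_def fiber_area_dil)
qed

lemma periodic_area_form: "area_form \<in> periodic_forms 2"
  by (rule equivariant_periodic[OF area_form_equivariant])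

lemma area_form_closed: "d_form area_form = (\<lambda>p vs. 0)"
  unfolding area_form_def by (intro ext) simp

lemma area_form_not_exact:
  assumes "\<eta> \<in> periodic_forms 1" "\<And>p vs. r * area_form p vs = d_form \<eta> p vs"
  shows "r = 0"
proof -
  have "period (\<lambda>p vs. r * area_form p vs) [(1, 0), (\<i>, 0)] = 0"
    unfolding assms(2) by (rule period_ext_deriv[OF assms(1)])
  then show ?thesis
    unfolding period_scale by (simp add: area_form_def period_const_form fiber_area_def horizontal_part_def)
qed

text \<open>Write the closed form \<open>twist \<eta>\<close> as \<open>d \<zeta> + c\<close> with its period \<open>c\<close>, solve \<open>twist u = \<zeta>\<close>, and replace
  \<open>\<eta>\<close> by \<open>\<eta> - d u\<close>.  This leaves the differential unchanged and reduces the failure of \<open>\<eta>\<close> to be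
  equivariant to a constant form.\<close>

lemma correct_primitive:
  assumes \<eta>: "\<eta> \<in> periodic_forms (Suc k)" and k: "k \<le> 1" and closed: "d_form (twist \<eta>) = (\<lambda>p vs. 0)"
  obtains \<eta>' where "\<eta>' \<in> periodic_forms (Suc k)" "d_form \<eta>' = d_form \<eta>"
    "twist \<eta>' = const_form (period (twist \<eta>))"
proof -
  have tP: "twist \<eta> \<in> periodic_forms (Suc k)" using \<eta> by (rule periodic_twist)
  have "Suc k \<in> {1, 2, 3}" using k by auto
  from periodic_closed_form_cohomologous_const[OF tP closed this] obtain \<zeta>
    where \<zeta>: "\<zeta> \<in> periodic_forms k" "twist \<eta> = (\<lambda>p vs. d_form \<zeta> p vs + const_form (period (twist \<eta>)) p vs)"
    unfolding const_form_def by blast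
  obtain u where u: "u \<in> periodic_forms k" "twist u = \<zeta>" using twist_surjective[OF \<zeta>(1)] by blast
  have du: "d_form u \<in> periodic_forms (Suc k)" using u(1) k by (intro periodic_d_form) auto
  show ?thesis
  proof (rule that)
    show "(\<lambda>p vs. \<eta> p vs - d_form u p vs) \<in> periodic_forms (Suc k)"
      by (rule periodic_forms_diff[OF \<eta> du])
    show "d_form (\<lambda>p vs. \<eta> p vs - d_form u p vs) = d_form \<eta>"
      using d_form_d_form[OF u(1)] k by (intro ext) (simp add: d_form_diff[OF \<eta> du])
    show "twist (\<lambda>p vs. \<eta> p vs - d_form u p vs) = const_form (period (twist \<eta>))"
    proof (intro ext)
      fix p vs
      show "twist (\<lambda>p vs. \<eta> p vs - d_form u p vs) p vs = const_form (period (twist \<eta>)) p vs"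
        using fun_cong[OF fun_cong[OF \<zeta>(2)], of p vs]
        by (simp add: twist_diff u(2) flip: d_form_twist[OF u(1)])
    qed
  qed
qed

text \<open>The eigenvalue condition leaves only the multiple of the area form in the period.  The primitive is
  made equivariant by \<open>correct_primitive\<close> and a constant one-form, because \<open>twist\<close> is bijective on
  constant horizontal one-forms.\<close>

theorem equivariant_closed_2_cohomologous:
  assumes \<sigma>: "\<sigma> \<in> equivariant_forms 2" and closed: "d_form \<sigma> = (\<lambda>p vs. 0)"
  shows "\<exists>r. \<exists>\<eta>\<in>equivariant_forms 1. \<forall>p vs. \<sigma> p vs - r * area_form p vs = d_form \<eta> p vs"
proof -
  have \<sigma>': "\<sigma> \<in> equivariant_forms (Suc 1)" using \<sigma> by (simp add: numeral_2_eq_2)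
  obtain \<eta> where \<eta>: "\<eta> \<in> periodic_forms 1" "\<sigma> = (\<lambda>p vs. d_form \<eta> p vs + const_form (period \<sigma>) p vs)"
    "d_form (twist \<eta>) = (\<lambda>p vs. 0)" "\<And>vs. period \<sigma> (map (dil 1) vs) = period \<sigma> vs / \<alpha>"
    using period_equivariant_closed[OF \<sigma>' closed] by auto
  have P: "\<sigma> \<in> periodic_forms 2" using \<sigma> by (rule equivariant_periodic)
  let ?r = "period \<sigma> [(1, 0), (\<i>, 0)]"
  obtain Q where Q: "period \<sigma> = (\<lambda>vs. ?r * fiber_area vs + mixed_area Q vs)"
    using area_exists[OF period_alternating[OF P] period_horizontal] by blast
  have "Q = 0"
  proof -
    have "mixed_area Q (map (dil 1) vs) - mixed_area Q vs / \<alpha> = 0" for vs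
      using \<eta>(4)[of vs] fun_cong[OF Q, of vs] fun_cong[OF Q, of "map (dil 1) vs"]
      by (simp add: fiber_area_dil add_divide_distrib)
    then have z: "mixed_area (Q * (of_real \<alpha> * \<beta> - of_real (1 / \<alpha>))) vs = 0" for vs
      unfolding mixed_area_twist .
    have "Q * (of_real \<alpha> * \<beta> - of_real (1 / \<alpha>)) = 0"
      using z[of "[(1, 0), (0, 1)]"] z[of "[(\<i>, 0), (0, 1)]"]
      unfolding mixed_area_def by (simp add: complex_eq_iff)
    then show ?thesis using mixed_eigenvalue by simp
  qed
  then have c: "const_form (period \<sigma>) p vs = ?r * area_form p vs" for p vs
    using fun_cong[OF Q, of vs] by (auto simp: const_form_def area_form_def mixed_area_def split: list.split)
  obtain \<eta>' where \<eta>': "\<eta>' \<in> periodic_forms 1" "d_form \<eta>' = d_form \<eta>"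
    "twist \<eta>' = const_form (period (twist \<eta>))"
    using correct_primitive[of \<eta> 0] \<eta>(1,3) by auto
  obtain P' r' where pr: "period (twist \<eta>) = covector P' r'"
    using covector_exists[OF period_alternating[OF periodic_twist[OF \<eta>(1)]] period_horizontal] by blast
  obtain P'' r'' where s: "\<forall>vs. covector P'' r'' (map (dil 1) vs) - covector P'' r'' vs / \<alpha> = covector P' r' vs"
    using covector_twist_solvable by blast
  have cP: "const_form (covector P'' r'') \<in> periodic_forms 1"
    by (rule periodic_const_form[OF covector_alternating covector_length])
  let ?\<eta> = "\<lambda>p vs. \<eta>' p vs - const_form (covector P'' r'') p vs"
  have "?\<eta> \<in> equivariant_forms 1"
    by (rule equivariantI[OF periodic_forms_diff[OF \<eta>'(1) cP]])
      (simp add: twist_diff twist_const_form \<eta>'(3) pr s)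
  moreover have "\<sigma> p vs - ?r * area_form p vs = d_form ?\<eta> p vs" for p vs
    using fun_cong[OF fun_cong[OF \<eta>(2)], of p vs] by (simp add: d_form_diff[OF \<eta>'(1) cP] \<eta>'(2) c)
  ultimately show ?thesis by blast
qed

section \<open>Equivariant cohomology in degree three\<close>

text \<open>Its differential is \<open>(dt / t) \<and> dx \<and> dy\<close>.  The logarithm turns the dilation into the addition of
  \<open>ln \<alpha>\<close>, so that \<open>twist\<close> of this form is a nonzero multiple of the area form, which is not in the
  image of \<open>twist\<close> on constant forms.\<close>

definition log_area_form :: "(complex \<times> complex) form" where
  "log_area_form p vs = ln (height p) * area_form p vs"

definition volume_form :: "(complex \<times> complex) form" where
  "volume_form = d_form log_area_form"

lemma periodic_log_area_form: "log_area_form \<in> periodic_forms 2"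
  unfolding log_area_form_def[abs_def]
  by (rule periodic_forms_height_mult[OF periodic_area_form smooth_fun_on_ln])

lemma twist_log_area_form: "twist log_area_form = (\<lambda>p vs. (ln \<alpha> / \<alpha>) * area_form p vs)"
proof (intro ext)
  fix p vs
  show "twist log_area_form p vs = (ln \<alpha> / \<alpha>) * area_form p vs"
  proof (cases "p \<in> C_times_H")
    case True
    then have "height p > 0" by (simp add: mem_C_times_H)
    then show ?thesis using True \<alpha>_pos
      by (simp add: twist_def pull_def log_area_form_def area_form_def const_form_def fiber_area_dil
          ln_mult field_simps)
  qed (simp add: twist_def pull_def log_area_form_def area_form_def const_form_def)
qed

lemma volume_form_equivariant: "volume_form \<in> equivariant_forms 3"
proof (rule equivariantI)
  show "volume_form \<in> periodic_forms 3"
    using periodic_d_form[OF periodic_log_area_form] by (simp add: volume_form_def numeral_3_eq_3 numeral_2_eq_2)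
  show "twist volume_form p vs = 0" for p vs
    unfolding volume_form_def d_form_twist[OF periodic_log_area_form, symmetric] twist_log_area_form
    using ext_deriv_scale[OF periodic_form_on[OF periodic_area_form], of "ln \<alpha> / \<alpha>" p vs]
    by (simp add: area_form_closed)
qed

lemma volume_form_closed: "d_form volume_form = (\<lambda>p vs. 0)"
  unfolding volume_form_def by (intro ext d_form_d_form[OF periodic_log_area_form]) simp

text \<open>Suppose that \<open>\<eta>\<close> is an equivariant primitive of \<open>s d (ln t dx \<and> dy)\<close>.  Then \<open>\<eta> - s ln t dx \<and> dy\<close> is
  a closed periodic form, hence \<open>d \<zeta> + c\<close> with constant \<open>c\<close>.  Apply \<open>twist\<close> and compare the
  coefficients of \<open>dx \<and> dy\<close> in the periods: on the left it is \<open>- s ln \<alpha> / \<alpha>\<close>, on the right 0.\<close>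

lemma volume_form_not_exact:
  assumes \<eta>: "\<eta> \<in> equivariant_forms 2" and eq: "\<And>p vs. s * volume_form p vs = d_form \<eta> p vs"
  shows "s = 0"
proof -
  have P: "\<eta> \<in> periodic_forms 2" using \<eta> by (rule equivariant_periodic)
  have sP: "(\<lambda>p vs. s * log_area_form p vs) \<in> periodic_forms 2"
    by (rule periodic_forms_scale[OF periodic_log_area_form])
  let ?x = "\<lambda>p vs. \<eta> p vs - s * log_area_form p vs"
  have x: "?x \<in> periodic_forms (Suc 1)"
    using periodic_forms_diff[OF P sP] by (simp add: numeral_2_eq_2)
  have tx: "twist ?x = (\<lambda>p vs. (- s * (ln \<alpha> / \<alpha>)) * area_form p vs)"
    by (intro ext) (simp add: twist_diff twist_scale equivariant_twist[OF \<eta>] twist_log_area_form)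
  have "d_form ?x = (\<lambda>p vs. 0)"
    using eq by (intro ext) (simp add: d_form_diff[OF P sP] volume_form_def
        ext_deriv_scale[OF periodic_form_on[OF periodic_log_area_form]])
  from periodic_closed_form_cohomologous_const[OF x this] obtain \<zeta>
    where \<zeta>: "\<zeta> \<in> periodic_forms 1" "?x = (\<lambda>p vs. d_form \<zeta> p vs + const_form (period ?x) p vs)"
    unfolding const_form_def by auto
  let ?e = "[(1, 0), (\<i>, 0)] :: (complex \<times> complex) list" and ?c = "period ?x"
  let ?d = "\<lambda>vs. ?c (map (dil 1) vs) - ?c vs / \<alpha>"
  have cP: "const_form ?c \<in> periodic_forms 2"
    using periodic_const_form[OF period_alternating[OF x]] by (simp add: numeral_2_eq_2)
  have "twist ?x p vs = d_form (twist \<zeta>) p vs + const_form ?d p vs" for p vs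
    by (subst \<zeta>(2)) (simp add: twist_add d_form_twist[OF \<zeta>(1)] twist_const_form)
  then have "(\<lambda>p vs. (- s * (ln \<alpha> / \<alpha>)) * area_form p vs) = (\<lambda>p vs. d_form (twist \<zeta>) p vs + const_form ?d p vs)"
    unfolding tx by (intro ext) simp
  then have "period (\<lambda>p vs. (- s * (ln \<alpha> / \<alpha>)) * area_form p vs) ?e
      = period (\<lambda>p vs. d_form (twist \<zeta>) p vs + const_form ?d p vs) ?e"
    by (rule arg_cong)
  also have "\<dots> = period (d_form (twist \<zeta>)) ?e + period (const_form ?d) ?e"
    using periodic_d_form[OF periodic_twist[OF \<zeta>(1)]] periodic_twist[OF cP]
    unfolding twist_const_form by (intro period_add[where k=2] periodic_form_on) (auto simp: numeral_2_eq_2)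
  also have "\<dots> = ?d ?e"
    using period_ext_deriv[OF periodic_twist[OF \<zeta>(1)]] by (simp add: period_const_form horizontal_part_def)
  also have "\<dots> = 0"
  proof -
    obtain Q where Q: "?c = (\<lambda>vs. ?c ?e * fiber_area vs + mixed_area Q vs)"
      using area_exists[of ?c] period_alternating[OF x] period_horizontal[of ?x] by (auto simp: numeral_2_eq_2)
    have "mixed_area Q (map (dil 1) ?e) = 0" "fiber_area ?e = 1"
      by (simp_all add: mixed_area_def fiber_area_def dilation_def)
    then have "?c (map (dil 1) ?e) = ?c ?e / \<alpha>"
      using fun_cong[OF Q, of "map (dil 1) ?e"]
      by (simp only: fiber_area_dil times_divide_eq_right mult_1_right add_0_right)
    then show ?thesis by simp
  qed
  finally have "s * (ln \<alpha> / \<alpha>) = 0"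
    unfolding period_scale by (simp add: area_form_def period_const_form fiber_area_def horizontal_part_def)
  then show ?thesis using \<alpha>_gt_1 by simp
qed

text \<open>The dilation has determinant \<open>\<beta> cnj \<beta> \<alpha> = 1\<close> on the horizontal directions, so it fixes every
  constant horizontal three-form.\<close>

lemma alternating_3_dil:
  assumes c: "alternating_multilinear 3 c" "\<And>vs. length vs \<noteq> 3 \<Longrightarrow> c vs = 0"
    and hor: "\<And>vs. c (map horizontal_part vs) = c vs" and ev: "\<And>vs. c (map (dil 1) vs) = c vs / \<alpha>"
  shows "c vs = 0"
proof -
  define e1 e2 e3 :: "complex \<times> complex" where e: "e1 = (1, 0)" "e2 = (\<i>, 0)" "e3 = (0, 1)"
  note a = alternating_3[OF c(1)]
  note sw = alternating_3_swap(1)[OF c(1), of e2 e1] alternating_3_swap(1)[OF c(1), of e3 e1]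
    alternating_3_swap(1)[OF c(1), of e3 e2] alternating_3_swap(2)[OF c(1), of _ e2 e1]
    alternating_3_swap(2)[OF c(1), of _ e3 e1] alternating_3_swap(2)[OF c(1), of _ e3 e2]
  have d: "dil 1 e1 = Re \<beta> *\<^sub>R e1 + Im \<beta> *\<^sub>R e2" "dil 1 e2 = (- Im \<beta>) *\<^sub>R e1 + Re \<beta> *\<^sub>R e2" "dil 1 e3 = \<alpha> *\<^sub>R e3"
    by (auto simp: dilation_def e prod_eq_iff complex_eq_iff)
  have n: "(Re \<beta> * Re \<beta> + Im \<beta> * Im \<beta>) * \<alpha> = 1"
    using norm_\<beta> unfolding cmod_power2 unfolding power2_eq_square .
  have "c [dil 1 e1, dil 1 e2, dil 1 e3] = ((Re \<beta> * Re \<beta> + Im \<beta> * Im \<beta>) * \<alpha>) * c [e1, e2, e3]"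
    unfolding d by (simp only: a sw) (simp add: algebra_simps)
  then have "c [e1, e2, e3] = c [e1, e2, e3] / \<alpha>" using ev[of "[e1, e2, e3]"] n by simp
  then have "c [e1, e2, e3] * (\<alpha> - 1) = 0" using \<alpha>_pos by (simp add: field_simps)
  then have z: "c [e1, e2, e3] = 0" using \<alpha>_gt_1 by simp
  show ?thesis
  proof (cases "length vs = 3")
    case True
    then obtain u v w where v: "vs = [u, v, w]" by (auto simp: length_Suc_conv numeral_3_eq_3)
    have "c vs = c [horizontal_part u, horizontal_part v, horizontal_part w]" using hor[of vs] v by simp
    also have "\<dots> = 0"
      unfolding horizontal_part_coordinates e[symmetric] by (simp only: a sw) (simp add: z a)
    finally show ?thesis .
  qed (rule c(2))
qed

text \<open>The period vanishes, so there is a periodic primitive \<open>\<eta>\<close>, and \<open>twist \<eta>\<close> can be assumed to be a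
  constant two-form.  Its mixed part is removed by a constant form, its multiple of the area form by
  a multiple of \<open>ln t dx \<and> dy\<close>, which changes the differential by a multiple of the volume form.\<close>

theorem equivariant_closed_3_cohomologous:
  assumes \<sigma>: "\<sigma> \<in> equivariant_forms 3" and closed: "d_form \<sigma> = (\<lambda>p vs. 0)"
  shows "\<exists>s. \<exists>\<eta>\<in>equivariant_forms 2. \<forall>p vs. \<sigma> p vs - s * volume_form p vs = d_form \<eta> p vs"
proof -
  have \<sigma>': "\<sigma> \<in> equivariant_forms (Suc 2)" using \<sigma> by (simp add: numeral_3_eq_3 numeral_2_eq_2)
  obtain \<eta> where \<eta>: "\<eta> \<in> periodic_forms 2" "\<sigma> = (\<lambda>p vs. d_form \<eta> p vs + const_form (period \<sigma>) p vs)"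
    "d_form (twist \<eta>) = (\<lambda>p vs. 0)" "\<And>vs. period \<sigma> (map (dil 1) vs) = period \<sigma> vs / \<alpha>"
    using period_equivariant_closed[OF \<sigma>' closed] by auto
  have P: "\<sigma> \<in> periodic_forms 3" using \<sigma> by (rule equivariant_periodic)
  have "period \<sigma> vs = 0" for vs
    by (rule alternating_3_dil[OF period_alternating[OF P] period_horizontal \<eta>(4)])
  then have eq: "\<sigma> p vs = d_form \<eta> p vs" for p vs
    using fun_cong[OF fun_cong[OF \<eta>(2)], of p vs] by (simp add: const_form_def)
  have \<eta>1: "\<eta> \<in> periodic_forms (Suc 1)" using \<eta>(1) by (simp add: numeral_2_eq_2)
  obtain \<eta>' where \<eta>': "\<eta>' \<in> periodic_forms 2" "d_form \<eta>' = d_form \<eta>"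
    "twist \<eta>' = const_form (period (twist \<eta>))"
    using correct_primitive[OF \<eta>1 _ \<eta>(3)] by (auto simp: numeral_2_eq_2)
  let ?r = "period (twist \<eta>) [(1, 0), (\<i>, 0)]"
  obtain Q where Q: "period (twist \<eta>) = (\<lambda>vs. ?r * fiber_area vs + mixed_area Q vs)"
    using area_exists[OF period_alternating[OF periodic_twist[OF \<eta>(1)]] period_horizontal] by blast
  obtain Q' where Q': "\<forall>vs. mixed_area Q' (map (dil 1) vs) - mixed_area Q' vs / \<alpha> = mixed_area Q vs"
    using mixed_area_twist_solvable by blast
  have cP: "const_form (mixed_area Q') \<in> periodic_forms 2"
    by (rule periodic_const_form[OF mixed_area_alternating mixed_area_length])
  define s where "s = ?r * \<alpha> / ln \<alpha>"
  have s: "s * (ln \<alpha> / \<alpha>) = ?r" using \<alpha>_gt_1 by (simp add: s_def)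
  have sP: "(\<lambda>p vs. s * log_area_form p vs) \<in> periodic_forms 2"
    by (rule periodic_forms_scale[OF periodic_log_area_form])
  have dP: "(\<lambda>p vs. \<eta>' p vs - const_form (mixed_area Q') p vs) \<in> periodic_forms 2"
    by (rule periodic_forms_diff[OF \<eta>'(1) cP])
  let ?\<eta> = "\<lambda>p vs. (\<eta>' p vs - const_form (mixed_area Q') p vs) - s * log_area_form p vs"
  have "?\<eta> \<in> equivariant_forms 2"
  proof (rule equivariantI[OF periodic_forms_diff[OF dP sP]])
    fix p vs
    have "twist ?\<eta> p vs = const_form (period (twist \<eta>)) p vs - const_form (mixed_area Q) p vs - ?r * area_form p vs"
      by (simp add: twist_diff twist_scale twist_const_form \<eta>'(3) Q' twist_log_area_form s[symmetric])
    also have "\<dots> = 0"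
      using fun_cong[OF Q, of vs] by (simp add: const_form_def area_form_def)
    finally show "twist ?\<eta> p vs = 0" .
  qed
  moreover have "\<sigma> p vs - s * volume_form p vs = d_form ?\<eta> p vs" for p vs
    by (simp add: d_form_diff[OF dP sP] d_form_diff[OF \<eta>'(1) cP] \<eta>'(2) eq volume_form_def
        ext_deriv_scale[OF periodic_form_on[OF periodic_log_area_form]])
  ultimately show ?thesis by blast
qed

end

section \<open>The lattice of an Inoue surface\<close>

text \<open>The inverse is the matrix of cofactors.\<close>

lemma integer_inverse_3:
  fixes A :: "int^3^3"
  assumes "det A = 1"
  shows "\<exists>N::int^3^3. N ** A = mat 1"
proof
  let ?x = "\<lambda>i j. A $ i $ j"
  let ?N = "vector [vector [?x 2 2 * ?x 3 3 - ?x 2 3 * ?x 3 2, ?x 1 3 * ?x 3 2 - ?x 1 2 * ?x 3 3, ?x 1 2 * ?x 2 3 - ?x 1 3 * ?x 2 2],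
    vector [?x 2 3 * ?x 3 1 - ?x 2 1 * ?x 3 3, ?x 1 1 * ?x 3 3 - ?x 1 3 * ?x 3 1, ?x 1 3 * ?x 2 1 - ?x 1 1 * ?x 2 3],
    vector [?x 2 1 * ?x 3 2 - ?x 2 2 * ?x 3 1, ?x 1 2 * ?x 3 1 - ?x 1 1 * ?x 3 2, ?x 1 1 * ?x 2 2 - ?x 1 2 * ?x 2 1]] :: int^3^3"
  show "?N ** A = mat 1"
    using assms unfolding det_3 vec_eq_iff forall_3 matrix_matrix_mult_def mat_def
    by (simp add: sum_3 algebra_simps)
qed

text \<open>The characteristic polynomial in expanded form, so that the product of the eigenvalues can be
  obtained from its coefficients.\<close>

lemma eigenvalue_charpoly_3:
  fixes M :: "complex^3^3"
  assumes "is_eigenvector M x v"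
  shows "x ^ 3 - (M$1$1 + M$2$2 + M$3$3) * x\<^sup>2
    + (M$1$1 * M$2$2 + M$1$1 * M$3$3 + M$2$2 * M$3$3 - M$1$2 * M$2$1 - M$1$3 * M$3$1 - M$2$3 * M$3$2) * x - det M = 0"
proof -
  let ?N = "\<chi> i j. M $ i $ j - (if i = j then x else 0)"
  have "(?N *v v) $ i = (M *v v) $ i - x * v $ i" for i
    using exhaust_3[of i] by (auto simp: matrix_vector_mult_def sum_3 algebra_simps)
  then have "?N *v v = 0"
    using assms by (simp add: is_eigenvector_def vec_eq_iff)
  moreover have "v \<noteq> 0" using assms by (simp add: is_eigenvector_def)
  ultimately have "\<not> (\<exists>B. B ** ?N = mat 1)" unfolding matrix_left_invertible_ker by blast
  then have "det ?N = 0" using invertible_det_nz[of ?N] invertible_left_inverse[of ?N] by blast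
  then show ?thesis
    by (simp add: det_3 algebra_simps power2_eq_square power3_eq_cube)
qed

text \<open>Vieta's formula: dividing differences of the three equations by differences of the roots determines
  \<open>t\<close> and \<open>s\<close> as elementary symmetric functions.\<close>

lemma cubic_roots_product:
  fixes x y z :: complex
  assumes "x ^ 3 - t * x\<^sup>2 + s * x - d = 0" "y ^ 3 - t * y\<^sup>2 + s * y - d = 0" "z ^ 3 - t * z\<^sup>2 + s * z - d = 0"
    and "x \<noteq> y" "x \<noteq> z" "y \<noteq> z"
  shows "x * y * z = d"
proof -
  have "(x - y) * (x\<^sup>2 + x * y + y\<^sup>2 - t * (x + y) + s) = 0"
    using assms(1,2) by algebra
  then have 1: "x\<^sup>2 + x * y + y\<^sup>2 - t * (x + y) + s = 0" using assms(4) by simp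
  have "(x - z) * (x\<^sup>2 + x * z + z\<^sup>2 - t * (x + z) + s) = 0"
    using assms(1,3) by algebra
  then have 2: "x\<^sup>2 + x * z + z\<^sup>2 - t * (x + z) + s = 0" using assms(5) by simp
  have "(y - z) * (x + y + z - t) = 0" using 1 2 by algebra
  then have t: "t = x + y + z" using assms(6) by simp
  have s: "s = x * y + x * z + y * z" using 1 t by algebra
  show ?thesis using assms(1) unfolding t s by algebra
qed

locale inoue_setting =
  fixes A :: "int^3^3" and \<alpha> :: real and \<beta> :: complex and a :: "real^3" and b :: "complex^3"
  assumes data: "inoue_data A \<alpha> \<beta> a b"
begin

definition generator :: "3 \<Rightarrow> complex \<times> complex" where
  "generator i = (b $ i, complex_of_real (a $ i))"

lemma A_b: "(\<Sum>j\<in>UNIV. complex_of_int (A $ i $ j) * b $ j) = \<beta> * b $ i"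
  and A_a: "(\<Sum>j\<in>UNIV. real_of_int (A $ i $ j) * a $ j) = \<alpha> * a $ i"
  and b_nonzero: "b \<noteq> 0" and a_nonzero: "a \<noteq> 0"
  and det_A: "det A = 1" and \<alpha>_1: "\<alpha> > 1" and \<beta>_not_real: "\<beta> \<notin> \<real>"
  using data unfolding inoue_data_def is_eigenvector_def
  by (auto simp: vec_eq_iff matrix_vector_mult_def map_matrix_def)

lemma Im_\<beta>: "Im \<beta> \<noteq> 0" using \<beta>_not_real complex_is_Real_iff by blast

lemma eigenvalue_product: "(cmod \<beta>)\<^sup>2 * \<alpha> = 1"
proof -
  let ?M = "map_matrix complex_of_int A"
  have "\<exists>v. is_eigenvector ?M x v" if "x \<in> {complex_of_real \<alpha>, \<beta>, cnj \<beta>}" for x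
    using data that unfolding inoue_data_def by blast
  then have p: "x ^ 3 - (?M$1$1 + ?M$2$2 + ?M$3$3) * x\<^sup>2
    + (?M$1$1 * ?M$2$2 + ?M$1$1 * ?M$3$3 + ?M$2$2 * ?M$3$3 - ?M$1$2 * ?M$2$1 - ?M$1$3 * ?M$3$1 - ?M$2$3 * ?M$3$2) * x - det ?M = 0"
    if "x \<in> {complex_of_real \<alpha>, \<beta>, cnj \<beta>}" for x
    using that eigenvalue_charpoly_3 by blast
  have d: "det ?M = 1"
  proof -
    have "det ?M = of_int (det A)" by (simp add: det_3 map_matrix_def)
    then show ?thesis using det_A by simp
  qed
  have "complex_of_real \<alpha> * \<beta> * cnj \<beta> = det ?M"
    by (rule cubic_roots_product[OF p p p]) (use Im_\<beta> in \<open>auto simp: complex_eq_iff\<close>)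
  then have "complex_of_real (\<alpha> * (cmod \<beta>)\<^sup>2) = 1"
    by (simp add: d complex_norm_square mult.assoc del: of_real_power)
  then show ?thesis by (metis mult.commute of_real_eq_1_iff)
qed

text \<open>The assumption is a real linear relation between \<open>Re b\<close>, \<open>Im b\<close> and \<open>a\<close>.  Applying \<open>A\<close> multiplies
  \<open>p\<close> by \<open>\<beta>\<close> and \<open>x\<close> by \<open>\<alpha>\<close>, so subtracting \<open>\<alpha>\<close> times the relation eliminates \<open>a\<close> and leaves
  \<open>Re (q b) = 0\<close>.  Applying \<open>A\<close> once more gives \<open>Re (\<beta> q b) = 0\<close>, and both together force \<open>q b = 0\<close>
  since \<open>\<beta>\<close> is not real.\<close>

lemma generators_independent:
  assumes "\<And>i. Re (p * b $ i) + x * a $ i = 0"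
  shows "p = 0 \<and> x = 0"
proof -
  have shift: "Re (q * \<beta> * b $ i) + y * \<alpha> * a $ i = 0" if "\<And>i. Re (q * b $ i) + y * a $ i = 0" for q y i
  proof -
    have "Re (q * \<beta> * b $ i) + y * \<alpha> * a $ i
      = Re (q * (\<Sum>j\<in>UNIV. complex_of_int (A $ i $ j) * b $ j)) + y * (\<Sum>j\<in>UNIV. real_of_int (A $ i $ j) * a $ j)"
      by (simp add: A_b A_a mult.assoc)
    also have "\<dots> = (\<Sum>j\<in>UNIV. real_of_int (A $ i $ j) * (Re (q * b $ j) + y * a $ j))"
      by (simp add: sum_3 algebra_simps)
    finally show ?thesis using that by simp
  qed
  define q where "q = p * (\<beta> - of_real \<alpha>)"
  have q: "Re (q * b $ i) + 0 * a $ i = 0" for i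
  proof -
    have "Re (q * b $ i) = Re (p * \<beta> * b $ i) - \<alpha> * Re (p * b $ i)"
      by (simp add: q_def algebra_simps)
    moreover have v: "Re (p * b $ i) = - (x * a $ i)" using assms[of i] by linarith
    have "\<alpha> * Re (p * b $ i) = - (x * \<alpha> * a $ i)" unfolding v by simp
    ultimately show ?thesis using shift[OF assms, of i] by linarith
  qed
  have "q * b $ i = 0" for i
  proof -
    have 1: "Re (q * b $ i) = 0" using q[of i] by simp
    have "Re (\<beta> * (q * b $ i)) = 0" using shift[OF q, of i] by (simp add: mult_ac)
    then have "Im \<beta> * Im (q * b $ i) = 0" using 1 by (simp only: times_complex.sel)
    then show ?thesis using 1 Im_\<beta> by (simp add: complex_eq_iff)
  qed
  moreover obtain i where "b $ i \<noteq> 0" using b_nonzero by (auto simp: vec_eq_iff)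
  ultimately have "q = 0" by (metis mult_eq_0_iff)
  moreover have "\<beta> \<noteq> of_real \<alpha>" using \<beta>_not_real by auto
  ultimately have p: "p = 0" by (simp add: q_def)
  obtain j where "a $ j \<noteq> 0" using a_nonzero by (auto simp: vec_eq_iff)
  then have "x = 0" using assms[of j] p by simp
  with p show ?thesis by simp
qed

text \<open>The columns \<open>Re b\<close>, \<open>Im b\<close>, \<open>a\<close> of a real \<open>3 \<times> 3\<close> matrix are independent, so its rows, which are
  the horizontal coordinates of the generators, form a basis as well.\<close>

lemma coefficient_map_exists:
  "\<exists>\<kappa>::complex \<times> complex \<Rightarrow> real^3. linear \<kappa> \<and> (\<forall>r. \<kappa> (\<Sum>j\<in>UNIV. r j *\<^sub>R generator j) = (\<chi> j. r j))
    \<and> (\<forall>h. height h = 0 \<longrightarrow> h = (\<Sum>j\<in>UNIV. (\<kappa> h $ j) *\<^sub>R generator j))"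
proof -
  define M :: "real^3^3" where "M = (\<chi> i. vector [Re (b $ i), Im (b $ i), a $ i])"
  have "x = 0" if "M *v x = 0" for x
  proof -
    have "Re (Complex (x $ 1) (- x $ 2) * b $ i) + x $ 3 * a $ i = 0" for i
      using that by (simp add: vec_eq_iff matrix_vector_mult_def M_def sum_3 algebra_simps)
    from generators_independent[OF this] show ?thesis
      by (simp add: vec_eq_iff forall_3 complex_eq_iff)
  qed
  then obtain B where B: "B ** M = mat 1" using matrix_left_invertible_ker by blast
  then have B': "M ** B = mat 1" using matrix_left_right_inverse by blast
  define y :: "complex \<times> complex \<Rightarrow> real^3" where "y h = vector [Re (fst h), Im (fst h), Re (snd h)]" for h
  have y: "y (\<Sum>j\<in>UNIV. r j *\<^sub>R generator j) = transpose M *v (\<chi> j. r j)" for r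
    by (simp add: y_def vec_eq_iff forall_3 matrix_vector_mult_def transpose_def M_def sum_3 generator_def mult.commute)
  have ly: "linear y" by (rule linearI) (auto simp: y_def vec_eq_iff forall_3)
  have inj: "g = h" if "y g = y h" "height g = 0" "height h = 0" for g h
    using that by (auto simp: y_def vec_eq_iff forall_3 prod_eq_iff complex_eq_iff height_def)
  show ?thesis
  proof (intro exI[of _ "\<lambda>h. transpose B *v y h"] conjI allI impI)
    show "linear (\<lambda>h. transpose B *v y h)"
      using linear_compose[OF ly matrix_vector_mul_linear[of "transpose B"]] by (simp add: comp_def)
    show "transpose B *v y (\<Sum>j\<in>UNIV. r j *\<^sub>R generator j) = (\<chi> j. r j)" for r
    proof -
      have "transpose B ** transpose M = mat 1" using B' by (metis matrix_transpose_mul transpose_mat)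
      then show ?thesis unfolding y matrix_vector_mul_assoc by simp
    qed
    fix h :: "complex \<times> complex" assume h: "height h = 0"
    show "h = (\<Sum>j\<in>UNIV. ((transpose B *v y h) $ j) *\<^sub>R generator j)"
    proof (rule inj)
      have "transpose M ** transpose B = mat 1" using B by (metis matrix_transpose_mul transpose_mat)
      then show "y h = y (\<Sum>j\<in>UNIV. ((transpose B *v y h) $ j) *\<^sub>R generator j)"
        unfolding y vec_lambda_eta matrix_vector_mul_assoc by simp
      show "height (\<Sum>j\<in>UNIV. ((transpose B *v y h) $ j) *\<^sub>R generator j) = 0"
        by (simp add: height_def generator_def sum_3)
    qed (rule h)
  qed
qed

sublocale inoue_lattice generator \<alpha> \<beta>
proof
  show "height (generator i) = 0" for i by (simp add: height_def generator_def)
  show "\<exists>r::3 \<Rightarrow> real. h = (\<Sum>i\<in>UNIV. r i *\<^sub>R generator i)" if "height h = 0" for h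
    using coefficient_map_exists that by blast
  show "\<exists>m::3 \<Rightarrow> int. dilation \<alpha> \<beta> 1 (generator i) = (\<Sum>j\<in>UNIV. of_int (m j) *\<^sub>R generator j)" for i
  proof (intro exI)
    show "dilation \<alpha> \<beta> 1 (generator i) = (\<Sum>j\<in>UNIV. of_int (A $ i $ j) *\<^sub>R generator j)"
      using A_b[of i] arg_cong[OF A_a[of i], of complex_of_real]
      by (simp add: dilation_def generator_def prod_eq_iff sum_3 scaleR_conv_of_real)
  qed
  show "\<exists>m::3 \<Rightarrow> int. dilation \<alpha> \<beta> (-1) (generator i) = (\<Sum>j\<in>UNIV. of_int (m j) *\<^sub>R generator j)" for i
  proof -
    obtain N where N: "N ** A = mat 1" using integer_inverse_3[OF det_A] by blast
    have NA: "(\<Sum>k\<in>UNIV. N $ i $ k * A $ k $ j) = (if i = j then 1 else 0)" for j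
      using N by (simp add: matrix_matrix_mult_def mat_def vec_eq_iff)
    have comb: "(\<Sum>k\<in>UNIV. of_int (N $ i $ k) * (\<Sum>j\<in>UNIV. of_int (A $ k $ j) * f j)) = f i"
      for f :: "3 \<Rightarrow> complex"
    proof -
      have "(\<Sum>k\<in>UNIV. of_int (N $ i $ k) * (\<Sum>j\<in>UNIV. of_int (A $ k $ j) * f j))
        = (\<Sum>j\<in>UNIV. of_int (\<Sum>k\<in>UNIV. N $ i $ k * A $ k $ j) * f j)"
        by (simp add: sum_3 algebra_simps)
      also have "\<dots> = (\<Sum>j\<in>UNIV. if i = j then f j else 0)" unfolding NA by (rule sum.cong) auto
      finally show ?thesis by simp
    qed
    have b: "(\<Sum>k\<in>UNIV. of_int (N $ i $ k) * b $ k) = b $ i / \<beta>"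
    proof -
      have "(\<Sum>k\<in>UNIV. of_int (N $ i $ k) * (\<beta> * b $ k)) = b $ i"
        using comb[of "\<lambda>j. b $ j"] unfolding A_b .
      then have "(\<Sum>k\<in>UNIV. of_int (N $ i $ k) * b $ k) * \<beta> = b $ i"
        by (simp add: sum_3 algebra_simps)
      moreover have "\<beta> \<noteq> 0" using \<beta>_not_real by auto
      ultimately show ?thesis by (simp add: nonzero_eq_divide_eq)
    qed
    have a: "(\<Sum>k\<in>UNIV. of_int (N $ i $ k) * complex_of_real (a $ k)) = complex_of_real (a $ i) / complex_of_real \<alpha>"
    proof -
      have "(\<Sum>j\<in>UNIV. complex_of_int (A $ k $ j) * complex_of_real (a $ j)) = of_real \<alpha> * of_real (a $ k)" for k
        using arg_cong[OF A_a[of k], of complex_of_real] by simp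
      then have "(\<Sum>k\<in>UNIV. of_int (N $ i $ k) * (complex_of_real \<alpha> * complex_of_real (a $ k))) = of_real (a $ i)"
        using comb[of "\<lambda>j. of_real (a $ j)"] by simp
      then have "(\<Sum>k\<in>UNIV. of_int (N $ i $ k) * complex_of_real (a $ k)) * of_real \<alpha> = of_real (a $ i)"
        by (simp add: sum_3 algebra_simps)
      then show ?thesis using \<alpha>_1 by (simp add: nonzero_eq_divide_eq)
    qed
    have "dilation \<alpha> \<beta> (-1) (generator i) = (\<Sum>j\<in>UNIV. of_int (N $ i $ j) *\<^sub>R generator j)"
      using a b
      by (simp add: dilation_def generator_def prod_eq_iff sum_3 scaleR_conv_of_real power_int_minus divide_inverse mult.commute)
    then show ?thesis by blast
  qed
qed (use \<alpha>_1 \<beta>_not_real eigenvalue_product in auto)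

text \<open>The integer coefficients of a lattice vector are bounded by a multiple of its norm.\<close>

lemma lattice_discrete: "\<exists>e>0. \<forall>v\<in>lattice_points. norm v < e \<longrightarrow> v = 0"
proof -
  obtain \<kappa> :: "complex \<times> complex \<Rightarrow> real^3" where \<kappa>: "linear \<kappa>"
    "\<And>r. \<kappa> (\<Sum>j\<in>UNIV. r j *\<^sub>R generator j) = (\<chi> j. r j)"
    using coefficient_map_exists by blast
  obtain K where K: "K > 0" "\<And>v. norm (\<kappa> v) \<le> K * norm v" using linear_bounded_pos[OF \<kappa>(1)] by blast
  show ?thesis
  proof (intro exI[of _ "1 / K"] conjI ballI impI)
    fix v assume "v \<in> lattice_points" and v: "norm v < 1 / K"
    then obtain m :: "3 \<Rightarrow> int" where m: "v = (\<Sum>j\<in>UNIV. of_int (m j) *\<^sub>R generator j)"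
      unfolding lattice_points_def by auto
    have "K * norm v < 1" using v K(1) by (simp add: field_simps)
    then have "norm (\<kappa> v) < 1" using K(2)[of v] by linarith
    then have "\<bar>real_of_int (m j)\<bar> < 1" for j
      using component_le_norm_cart[of "\<kappa> v" j] by (simp add: m \<kappa>(2))
    then have "m j = 0" for j by (metis of_int_abs of_int_less_1_iff zabs_less_one_iff)
    then show "v = 0" by (simp add: m)
  qed (use K in auto)
qed

end

section \<open>The deck group\<close>

context inoue_setting
begin

abbreviation "deck_group \<equiv> generate (BijGroup C_times_H)
  (insert (inoue_dilation \<alpha> \<beta>) (range (inoue_translation a b)))"

abbreviation "proj \<equiv> inoue_proj \<alpha> \<beta> a b"

abbreviation "atlas \<equiv> inoue_atlas \<alpha> \<beta> a b"

text \<open>Elements of \<open>BijGroup\<close> are undefined off the half-space, so the affine formula can hold on the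
  half-space only.\<close>

definition acts_affinely :: "int \<Rightarrow> complex \<times> complex \<Rightarrow> (complex \<times> complex \<Rightarrow> complex \<times> complex) \<Rightarrow> bool" where
  "acts_affinely n v g \<longleftrightarrow> v \<in> lattice_points \<and> (\<forall>p\<in>C_times_H. g p = dil n p + v)"

lemma affine_mem: "v \<in> lattice_points \<Longrightarrow> dil n p + v \<in> C_times_H \<longleftrightarrow> p \<in> C_times_H"
  by (simp add: translate_C_times_H height_lattice)

lemma affine_inverse: "dil n (dil (- n) p + dil (- n) (- v)) + v = p"
  by (simp add: linear_add[OF linear_dil] dil_dil)

lemma affine_inverse': "dil (- n) (dil n p + v) + dil (- n) (- v) = p"
  by (simp add: linear_add[OF linear_dil] linear_neg[OF linear_dil] dil_dil)

lemma affine_Bij: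
  assumes "v \<in> lattice_points"
  shows "restrict (\<lambda>p. dil n p + v) C_times_H \<in> Bij C_times_H"
proof -
  have "dil (- n) (- v) \<in> lattice_points" using assms by (intro lattice_dil lattice_uminus)
  then have "bij_betw (\<lambda>p. dil n p + v) C_times_H C_times_H"
    using assms
    by (intro bij_betw_byWitness[where f'="\<lambda>p. dil (- n) p + dil (- n) (- v)"])
      (auto simp: affine_inverse affine_inverse' affine_mem)
  then show ?thesis unfolding Bij_def by (auto cong: bij_betw_cong)
qed

lemma inoue_dilation_eq: "inoue_dilation \<alpha> \<beta> = restrict (\<lambda>p. dil 1 p + 0) C_times_H"
  and inoue_translation_eq: "inoue_translation a b i = restrict (\<lambda>p. dil 0 p + generator i) C_times_H"
  by (auto simp: inoue_dilation_def inoue_translation_def fun_eq_iff dilation_def generator_def restrict_def)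

lemma group_BijGroup_X: "group (BijGroup C_times_H)" by (rule group_BijGroup)

lemma carrier_BijGroup: "carrier (BijGroup C_times_H) = Bij C_times_H"
  by (simp add: BijGroup_def)

lemma generators_Bij: "insert (inoue_dilation \<alpha> \<beta>) (range (inoue_translation a b)) \<subseteq> Bij C_times_H"
  unfolding inoue_dilation_eq inoue_translation_eq
  using affine_Bij[OF lattice_zero, of 1] affine_Bij[OF lattice_l, of 0] by auto

lemma deck_subgroup: "subgroup deck_group (BijGroup C_times_H)"
  using group.generate_is_subgroup[OF group_BijGroup_X] generators_Bij by (simp add: carrier_BijGroup)

lemma deck_Bij: "g \<in> deck_group \<Longrightarrow> g \<in> Bij C_times_H"
  using subgroup.subset[OF deck_subgroup] by (auto simp: carrier_BijGroup)

lemma deck_mem: "g \<in> deck_group \<Longrightarrow> p \<in> C_times_H \<Longrightarrow> g p \<in> C_times_H"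
  using Bij_imp_funcset[OF deck_Bij] by blast

lemma mult_BijGroup:
  "f \<in> Bij C_times_H \<Longrightarrow> g \<in> Bij C_times_H \<Longrightarrow> p \<in> C_times_H \<Longrightarrow> (f \<otimes>\<^bsub>BijGroup C_times_H\<^esub> g) p = f (g p)"
  by (simp add: BijGroup_def compose_def)

lemma acts_affinely_inv:
  assumes g: "g \<in> Bij C_times_H" and act: "acts_affinely n v g"
  shows "acts_affinely (- n) (dil (- n) (- v)) (inv\<^bsub>BijGroup C_times_H\<^esub> g)"
proof -
  have v: "v \<in> lattice_points" and gp: "\<And>p. p \<in> C_times_H \<Longrightarrow> g p = dil n p + v"
    using act by (auto simp: acts_affinely_def)
  have v': "dil (- n) (- v) \<in> lattice_points" using v by (intro lattice_dil lattice_uminus)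
  have "(inv\<^bsub>BijGroup C_times_H\<^esub> g) p = dil (- n) p + dil (- n) (- v)" if p: "p \<in> C_times_H" for p
  proof -
    let ?q = "dil (- n) p + dil (- n) (- v)"
    have q: "?q \<in> C_times_H" using p v' by (simp add: affine_mem)
    have "g ?q = p" using gp[OF q] by (simp add: affine_inverse)
    then have "inv_into C_times_H g p = ?q"
      using g q by (metis Bij_def IntD2 bij_betw_def inv_into_f_f mem_Collect_eq)
    then show ?thesis using p by (simp add: inv_BijGroup[OF g])
  qed
  with v' show ?thesis by (simp add: acts_affinely_def)
qed

text \<open>Maps of this shape are closed under composition and inversion because dilations preserve the
  lattice.\<close>

lemma deck_acts_affinely: "g \<in> deck_group \<Longrightarrow> \<exists>n v. acts_affinely n v g"
proof (induction rule: generate.induct)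
  case one
  have "acts_affinely 0 0 \<one>\<^bsub>BijGroup C_times_H\<^esub>"
    by (simp add: acts_affinely_def lattice_zero BijGroup_def)
  then show ?case by blast
next
  case (incl h)
  have "acts_affinely 1 0 (inoue_dilation \<alpha> \<beta>)" "acts_affinely 0 (generator i) (inoue_translation a b i)" for i
    by (auto simp: acts_affinely_def lattice_zero lattice_l inoue_dilation_eq inoue_translation_eq)
  with incl show ?case by blast
next
  case (inv h)
  have "acts_affinely 1 0 (inoue_dilation \<alpha> \<beta>)" "acts_affinely 0 (generator i) (inoue_translation a b i)" for i
    by (auto simp: acts_affinely_def lattice_zero lattice_l inoue_dilation_eq inoue_translation_eq)
  with inv obtain n v where "acts_affinely n v h" by blast
  moreover have "h \<in> Bij C_times_H" using inv generators_Bij by blast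
  ultimately show ?case using acts_affinely_inv by blast
next
  case (eng g h)
  obtain m v n w where g: "acts_affinely m v g" and h: "acts_affinely n w h" using eng.IH by blast
  have "acts_affinely (m + n) (dil m w + v) (g \<otimes>\<^bsub>BijGroup C_times_H\<^esub> h)"
    unfolding acts_affinely_def
  proof (intro conjI ballI)
    show "dil m w + v \<in> lattice_points"
      using g h by (auto simp: acts_affinely_def intro: lattice_add lattice_dil)
    fix p assume p: "p \<in> C_times_H"
    show "(g \<otimes>\<^bsub>BijGroup C_times_H\<^esub> h) p = dil (m + n) p + (dil m w + v)"
      using g h p deck_mem[OF eng.hyps(2) p]
      by (simp add: mult_BijGroup[OF deck_Bij[OF eng.hyps(1)] deck_Bij[OF eng.hyps(2)] p]
          acts_affinely_def linear_add[OF linear_dil] dil_dil)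
  qed
  then show ?case by blast
qed

section \<open>The projection\<close>

lemma proj_eq: "proj p = {g p | g. g \<in> deck_group}"
  by (simp add: inoue_proj_def orbit_def inoue_group_def)

lemma surface_eq: "inoue_surface \<alpha> \<beta> a b = proj ` C_times_H"
  by (auto simp: inoue_surface_def orbits_def inoue_proj_def)

lemma proj_self: "p \<in> C_times_H \<Longrightarrow> p \<in> proj p"
proof -
  assume "p \<in> C_times_H"
  then have "p = \<one>\<^bsub>BijGroup C_times_H\<^esub> p" by (simp add: BijGroup_def)
  moreover have "\<one>\<^bsub>BijGroup C_times_H\<^esub> \<in> deck_group" by (rule generate.one)
  ultimately show ?thesis unfolding proj_eq by blast
qed

lemma proj_deck:
  assumes g: "g \<in> deck_group" and p: "p \<in> C_times_H"
  shows "proj (g p) = proj p"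
proof -
  have B: "h \<in> Bij C_times_H" if "h \<in> deck_group" for h using that by (rule deck_Bij)
  show ?thesis unfolding proj_eq
  proof (intro subset_antisym subsetI)
    fix q assume "q \<in> {h (g p) |h. h \<in> deck_group}"
    then obtain h where h: "h \<in> deck_group" "q = h (g p)" by blast
    have "h \<otimes>\<^bsub>BijGroup C_times_H\<^esub> g \<in> deck_group" using h(1) g by (rule generate.eng)
    moreover have "q = (h \<otimes>\<^bsub>BijGroup C_times_H\<^esub> g) p" using mult_BijGroup[OF B[OF h(1)] B[OF g] p] h(2) by simp
    ultimately show "q \<in> {h p |h. h \<in> deck_group}" by blast
  next
    fix q assume "q \<in> {h p |h. h \<in> deck_group}"
    then obtain h where h: "h \<in> deck_group" "q = h p" by blast
    have i: "inv\<^bsub>BijGroup C_times_H\<^esub> g \<in> deck_group" using subgroup.m_inv_closed[OF deck_subgroup g] .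
    have "(inv\<^bsub>BijGroup C_times_H\<^esub> g) (g p) = p"
    proof -
      have "(inv\<^bsub>BijGroup C_times_H\<^esub> g \<otimes>\<^bsub>BijGroup C_times_H\<^esub> g) p = \<one>\<^bsub>BijGroup C_times_H\<^esub> p"
        using group.l_inv[OF group_BijGroup_X, of g] B[OF g] by (simp add: carrier_BijGroup)
      then show ?thesis using mult_BijGroup[OF B[OF i] B[OF g] p] p by (simp add: BijGroup_def)
    qed
    then have "q = (h \<otimes>\<^bsub>BijGroup C_times_H\<^esub> inv\<^bsub>BijGroup C_times_H\<^esub> g) (g p)"
      using mult_BijGroup[OF B[OF h(1)] B[OF i] deck_mem[OF g p]] h(2) by simp
    moreover have "h \<otimes>\<^bsub>BijGroup C_times_H\<^esub> inv\<^bsub>BijGroup C_times_H\<^esub> g \<in> deck_group"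
      using h(1) i by (rule generate.eng)
    ultimately show "q \<in> {h (g p) |h. h \<in> deck_group}" by blast
  qed
qed

lemma proj_eqD: "proj p = proj q \<Longrightarrow> q \<in> C_times_H \<Longrightarrow> \<exists>g\<in>deck_group. q = g p"
  using proj_self[of q] by (auto simp: proj_eq[of p])

section \<open>Charts and transition maps\<close>

lemma atlasD:
  assumes "c \<in> atlas"
  shows "open (chart_image c)" "chart_image c \<subseteq> C_times_H" "u \<in> fst c \<Longrightarrow> proj (snd c u) = u"
    and "y \<in> chart_image c \<Longrightarrow> proj y \<in> fst c \<and> snd c (proj y) = y \<and> inv_into (fst c) (snd c) y = proj y"
proof -
  obtain U \<phi> where c: "c = (U, \<phi>)" by (cases c)
  show 1: "open (chart_image c)" "chart_image c \<subseteq> C_times_H" "u \<in> fst c \<Longrightarrow> proj (snd c u) = u" for u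
    using assms by (auto simp: inoue_atlas_def c chart_image_def)
  assume "y \<in> chart_image c"
  then obtain u where u: "u \<in> fst c" "y = snd c u" by (auto simp: chart_image_def)
  then have "proj y = u" using 1(3) by simp
  moreover have "inv_into (fst c) (snd c) y = u"
    unfolding u(2) by (rule inv_into_f_f[OF inj_on_inverseI[of _ proj] u(1)]) (rule 1(3))
  ultimately show "proj y \<in> fst c \<and> snd c (proj y) = y \<and> inv_into (fst c) (snd c) y = proj y" using u by simp
qed

text \<open>A chart is a section of the projection, which does not distinguish \<open>y\<close> from \<open>g y\<close>.  Hence the
  transition map sends \<open>y\<close> to \<open>g y\<close> whenever \<open>g y\<close> lies in the image of the second chart, and this
  persists near \<open>x\<close> because that image is open.\<close>

lemma transition_at_deck_image:
  assumes c: "c \<in> atlas" "c' \<in> atlas" and x: "x \<in> chart_image c"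
    and g: "g \<in> deck_group" and act: "acts_affinely n v g" and gx: "g x \<in> chart_image c'"
  shows "x \<in> snd c ` (fst c \<inter> fst c')" "transition c c' x = g x"
    "frechet_derivative (transition c c') (at x) = dil n"
proof -
  have X: "y \<in> C_times_H" if "y \<in> chart_image c" for y using atlasD(2)[OF c(1)] that by blast
  have t: "transition c c' y = g y" if y: "y \<in> chart_image c" "g y \<in> chart_image c'" for y
    using atlasD(4)[OF c(1) y(1)] atlasD(4)[OF c(2) y(2)] proj_deck[OF g X[OF y(1)]]
    by (simp add: transition_def)
  show "transition c c' x = g x" by (rule t[OF x gx])
  show "x \<in> snd c ` (fst c \<inter> fst c')"
  proof (rule image_eqI[of _ _ "proj x"])
    show "x = snd c (proj x)" using atlasD(4)[OF c(1) x] by simp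
    show "proj x \<in> fst c \<inter> fst c'"
      using atlasD(4)[OF c(1) x] atlasD(4)[OF c(2) gx] proj_deck[OF g X[OF x]] by simp
  qed
  let ?f = "\<lambda>y. dil n y + v" and ?W = "chart_image c \<inter> (\<lambda>y. dil n y + v) -` chart_image c'"
  have gf: "g y = ?f y" if "y \<in> C_times_H" for y using act that by (simp add: acts_affinely_def)
  have bl: "bounded_linear (dil n)" using linear_dil by (simp add: linear_conv_bounded_linear)
  have "continuous_on UNIV ?f" by (intro continuous_intros linear_continuous_on bl)
  then have W: "open ?W" by (intro open_Int open_vimage atlasD(1) c)
  have "x \<in> ?W" using x gx gf[OF X[OF x]] by simp
  then have "frechet_derivative (transition c c') (at x) = frechet_derivative ?f (at x)"
    by (rule frechet_derivative_cong_open[OF W]) (use t gf X in auto)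
  also have "\<dots> = dil n"
  proof -
    have "(?f has_derivative dil n) (at x)"
      by (auto intro!: derivative_eq_intros bounded_linear_imp_has_derivative bl)
    from frechet_derivative_at[OF this] show ?thesis by simp
  qed
  finally show "frechet_derivative (transition c c') (at x) = dil n" .
qed

lemma transition_deck_image:
  assumes c: "c \<in> atlas" "c' \<in> atlas" and x: "x \<in> snd c ` (fst c \<inter> fst c')"
  obtains g where "g \<in> deck_group" "x \<in> chart_image c" "g x \<in> chart_image c'"
proof -
  obtain u where u: "u \<in> fst c" "u \<in> fst c'" "x = snd c u" using x by auto
  have xc: "x \<in> chart_image c" using u by (auto simp: chart_image_def)
  have y: "snd c' u \<in> chart_image c'" using u by (auto simp: chart_image_def)
  have "proj x = proj (snd c' u)" using atlasD(3)[OF c(1) u(1)] atlasD(3)[OF c(2) u(2)] u(3) by simp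
  then obtain g where "g \<in> deck_group" "snd c' u = g x"
    using proj_eqD y atlasD(2)[OF c(2)] by blast
  with that xc y show ?thesis by metis
qed

text \<open>It suffices to find a neighbourhood of \<open>x\<close> on which the projection is injective; the inverse of the
  projection is then a chart.  If two nearby points are related by \<open>p \<mapsto> D\<^sup>n p + v\<close>, comparing heights
  shows \<open>n = 0\<close>, and then discreteness of the lattice shows \<open>v = 0\<close>.\<close>

lemma charts_cover:
  assumes x: "x \<in> C_times_H"
  shows "\<exists>c\<in>atlas. x \<in> chart_image c"
proof -
  let ?h = "height x"
  have h: "?h > 0" using x by (simp add: mem_C_times_H)
  obtain d where d: "d > 0" "\<And>v. v \<in> lattice_points \<Longrightarrow> norm v < d \<Longrightarrow> v = 0" using lattice_discrete by blast
  \<comment> \<open>The first bound makes differences of points in the ball shorter than d, the second keeps ratios of their heights below \<alpha>.\<close>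
  define e where "e = min (d / 2) (?h * (\<alpha> - 1) / (\<alpha> + 1))"
  have e: "e > 0" "e \<le> d / 2"
    using d(1) h \<alpha>_gt_1 unfolding e_def by (simp, intro min.cobounded1)
  have e2: "?h + e \<le> \<alpha> * (?h - e)"
  proof -
    have "e \<le> ?h * (\<alpha> - 1) / (\<alpha> + 1)" by (simp add: e_def)
    then have "e * (\<alpha> + 1) \<le> ?h * (\<alpha> - 1)" using \<alpha>_gt_1 by (simp add: pos_le_divide_eq)
    then show ?thesis by (simp add: algebra_simps)
  qed
  define W where "W = ball x e \<inter> C_times_H"
  have W: "open W" "x \<in> W" using x e open_C_times_H by (auto simp: W_def)
  have hW: "?h - e < height p" "height p < ?h + e" if "p \<in> W" for p
  proof -
    have "\<bar>height (p - x)\<bar> \<le> norm (p - x)"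
      using abs_Im_le_cmod[of "snd (p - x)"] norm_snd_le[of "snd (p - x)" "fst (p - x)"]
      unfolding height_def prod.collapse by linarith
    also have "\<dots> < e" using that by (simp add: W_def dist_norm norm_minus_commute)
    finally show "?h - e < height p" "height p < ?h + e" by auto
  qed
  have inj: "p = q" if p: "p \<in> W" and q: "q \<in> W" and pq: "proj p = proj q" for p q
  proof -
    obtain g where g: "g \<in> deck_group" "q = g p" using proj_eqD[OF pq] q by (auto simp: W_def)
    obtain n v where "acts_affinely n v g" using deck_acts_affinely[OF g(1)] by blast
    then have v: "v \<in> lattice_points" and qp: "q = dil n p + v"
      using g(2) p by (auto simp: acts_affinely_def W_def)
    have hq: "height q = \<alpha> powi n * height p" using qp v by (simp add: height_lattice)
    have pos: "height p > 0" "height q > 0" using p q by (auto simp: W_def mem_C_times_H)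
    have step: "\<alpha> \<le> \<alpha> powi m" if "m \<ge> 1" for m :: int
      using power_int_increasing[OF that, of \<alpha>] \<alpha>_gt_1 by simp
    have "n = 0"
    proof (rule ccontr)
      assume "n \<noteq> 0"
      then consider "n \<ge> 1" | "- n \<ge> 1" by linarith
      then show False
      proof cases
        case 1
        have "\<alpha> * (?h - e) < \<alpha> * height p" using hW(1)[OF p] \<alpha>_gt_1 by simp
        also have "\<dots> \<le> height q" unfolding hq using step[OF 1] pos by simp
        finally show False using hW(2)[OF q] e2 by simp
      next
        case 2
        have "height p = \<alpha> powi (- n) * height q" using hq \<alpha>_pos by (simp add: power_int_minus field_simps)
        then have "\<alpha> * height q \<le> height p" using step[OF 2] pos by simp
        moreover have "\<alpha> * (?h - e) < \<alpha> * height q" using hW(1)[OF q] \<alpha>_gt_1 by simp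
        ultimately show False using hW(2)[OF p] e2 by simp
      qed
    qed
    then have "v = q - p" using qp by simp
    moreover have "norm (q - p) < d"
    proof -
      have "dist q p \<le> dist x q + dist x p" by (metis dist_commute dist_triangle)
      then show ?thesis using p q e(2) by (simp add: W_def dist_norm)
    qed
    ultimately have "v = 0" using d(2)[OF v] by simp
    then show ?thesis using \<open>v = q - p\<close> by simp
  qed
  define \<phi> where "\<phi> = restrict (inv_into W proj) (proj ` W)"
  have \<phi>: "\<phi> (proj p) = p" if "p \<in> W" for p
    using inv_into_f_f[of proj W p] inj that by (auto simp: \<phi>_def inj_on_def)
  then have im: "\<phi> ` proj ` W = W" by force
  have "(proj ` W, \<phi>) \<in> atlas"
    unfolding inoue_atlas_def using W \<phi> im by (auto simp: surface_eq W_def \<phi>_def)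
  moreover have "x \<in> chart_image (proj ` W, \<phi>)" using W im by (simp add: chart_image_def)
  ultimately show ?thesis by blast
qed

end

context inoue_setting
begin

section \<open>Forms on the surface\<close>

text \<open>Multiplication by the height turns the condition \<open>D\<^sup>* \<sigma> = \<sigma> / \<alpha>\<close> into invariance and the exterior
  derivative into the Morse--Novikov differential.\<close>

definition descend ::
  "(complex \<times> complex) form \<Rightarrow> ((complex \<times> complex) set, complex \<times> complex) mform" where
  "descend \<sigma> c p vs = (if c \<in> atlas \<and> p \<in> chart_image c then height p * \<sigma> p vs else 0)"

lemma pull_equivariant:
  assumes \<sigma>: "\<sigma> \<in> equivariant_forms k"
  shows "pull n \<sigma> p vs = \<alpha> powi (- n) * \<sigma> p vs"
proof -
  have 1: "pull 1 \<sigma> = (\<lambda>p vs. \<sigma> p vs / \<alpha>)"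
    using equivariant_twist[OF \<sigma>] by (intro ext) (simp add: twist_def)
  have step: "pull (m + 1) \<sigma> p vs = pull m \<sigma> p vs / \<alpha>" for m p vs
  proof -
    have "pull (m + 1) \<sigma> p vs = pull m (pull 1 \<sigma>) p vs" by (simp only: pull_pull)
    then show ?thesis by (simp add: 1 pull_def)
  qed
  show ?thesis
  proof (induction n arbitrary: p vs rule: int_induct[where k=0])
    case (step1 n)
    have "\<alpha> powi (- (n + 1)) = \<alpha> powi (- n) / \<alpha>"
      using \<alpha>_pos power_int_diff[of \<alpha> "- n" 1] by simp
    then show ?case using step[of n p vs] step1.IH by simp
  next
    case (step2 n)
    have "\<alpha> powi (- (n - 1)) = \<alpha> powi (- n) * \<alpha>"
      using \<alpha>_pos power_int_add[of \<alpha> "- n" 1] by (simp add: add.commute)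
    then show ?case using step[of "n - 1" p vs] step2.IH[of p vs] \<alpha>_pos by (simp add: field_simps)
  qed simp
qed

lemma equivariant_deck:
  assumes \<sigma>: "\<sigma> \<in> equivariant_forms k" and v: "v \<in> lattice_points" and p: "p \<in> C_times_H"
  shows "height (dil n p + v) * \<sigma> (dil n p + v) (map (dil n) vs) = height p * \<sigma> p vs"
proof -
  have "\<sigma> (dil n p + v) (map (dil n) vs) = pull n \<sigma> p vs"
    using periodic_lattice[OF equivariant_periodic[OF \<sigma>] _ v, of "dil n p"] p by (simp add: pull_def)
  then show ?thesis
    using \<alpha>_pos v by (simp add: pull_equivariant[OF \<sigma>] height_lattice power_int_minus)
qed

lemma form_on_height_mult: "form_on k C_times_H \<sigma> \<Longrightarrow> form_on k C_times_H (\<lambda>p vs. height p * \<sigma> p vs)"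
  by (rule form_on_fun_mult[OF open_C_times_H _ smooth_height])

lemma descend_mforms:
  assumes \<sigma>: "\<sigma> \<in> equivariant_forms k"
  shows "descend \<sigma> \<in> mforms atlas k"
  unfolding mforms_def
proof (intro CollectI conjI ballI allI impI)
  fix c assume c: "c \<in> atlas"
  show "form_on k (chart_image c) (descend \<sigma> c)"
    using form_on_restrict[OF atlasD(1,2)[OF c] form_on_height_mult[OF periodic_form_on[OF equivariant_periodic[OF \<sigma>]]]] c
    by (simp add: descend_def[abs_def] cong: if_cong)
next
  fix c c' x vs assume c: "c \<in> atlas" "c' \<in> atlas" and x: "x \<in> snd c ` (fst c \<inter> fst c')"
  obtain g where g: "g \<in> deck_group" "x \<in> chart_image c" "g x \<in> chart_image c'"
    using transition_deck_image[OF c x] by blast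
  obtain n v where act: "acts_affinely n v g" using deck_acts_affinely[OF g(1)] by blast
  have xX: "x \<in> C_times_H" using atlasD(2)[OF c(1)] g(2) by blast
  have gx: "g x = dil n x + v" "v \<in> lattice_points" using act xX by (auto simp: acts_affinely_def)
  show "descend \<sigma> c x vs = descend \<sigma> c' (transition c c' x)
     (map (frechet_derivative (transition c c') (at x)) vs)"
    unfolding transition_at_deck_image(2,3)[OF c g(2,1) act g(3)]
    using c g(2,3) equivariant_deck[OF \<sigma> gx(2) xX, of n vs] by (simp add: descend_def gx(1))
next
  fix c assume "c \<notin> atlas"
  then show "descend \<sigma> c = (\<lambda>x vs. 0)" by (intro ext) (simp add: descend_def)
qed

text \<open>The local expressions in the charts around the points of the covering glue to a form \<open>W\<close> on the
  half-space: transition maps are deck transformations, so two charts around the same point give the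
  same value, and \<open>W\<close> is invariant under the deck group.  Dividing by the height gives \<open>\<sigma>\<close>.\<close>

lemma mforms_descend:
  assumes \<omega>: "\<omega> \<in> mforms atlas k"
  shows "\<exists>\<sigma>\<in>equivariant_forms k. \<omega> = descend \<sigma>"
proof -
  have F: "form_on k (chart_image c) (\<omega> c)" if "c \<in> atlas" for c
    using \<omega> that by (simp add: mforms_def)
  have T: "\<omega> c x vs = \<omega> c' (transition c c' x) (map (frechet_derivative (transition c c') (at x)) vs)"
    if "c \<in> atlas" "c' \<in> atlas" "x \<in> snd c ` (fst c \<inter> fst c')" for c c' x vs
    using \<omega> that unfolding mforms_def by blast
  have deck: "\<omega> c x vs = \<omega> c' (g x) (map (dil n) vs)"
    if "c \<in> atlas" "c' \<in> atlas" "x \<in> chart_image c" "g x \<in> chart_image c'" "g \<in> deck_group" "acts_affinely n v g"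
    for c c' g n v x vs
    using T[OF that(1,2)] transition_at_deck_image[OF that(1,2,3,5,6,4)] by simp
  define ch where "ch p = (SOME c. c \<in> atlas \<and> p \<in> chart_image c)" for p
  have ch: "ch p \<in> atlas" "p \<in> chart_image (ch p)" if "p \<in> C_times_H" for p
    using someI_ex[of "\<lambda>c. c \<in> atlas \<and> p \<in> chart_image c"] charts_cover[OF that] by (auto simp: ch_def)
  define W where "W p vs = (if p \<in> C_times_H then \<omega> (ch p) p vs else 0)" for p vs
  have one: "\<one>\<^bsub>BijGroup C_times_H\<^esub> \<in> deck_group" "acts_affinely 0 0 \<one>\<^bsub>BijGroup C_times_H\<^esub>"
    by (rule generate.one) (simp add: acts_affinely_def lattice_zero BijGroup_def)
  have W: "W p vs = \<omega> c p vs" if c: "c \<in> atlas" "p \<in> chart_image c" for c p vs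
  proof -
    have p: "p \<in> C_times_H" using atlasD(2)[OF c(1)] c(2) by blast
    have idp: "\<one>\<^bsub>BijGroup C_times_H\<^esub> p = p" using p by (simp add: BijGroup_def)
    show ?thesis
      using deck[OF ch(1)[OF p] c(1) ch(2)[OF p] _ one, of vs] c(2) p by (simp add: idp W_def map_idI)
  qed
  have W_deck: "W (g p) (map (dil n) vs) = W p vs" if p: "p \<in> C_times_H" and g: "g \<in> deck_group" "acts_affinely n v g" for p g n v vs
  proof -
    have gp: "g p \<in> C_times_H" using deck_mem[OF g(1) p] .
    show ?thesis
      using deck[OF ch(1)[OF p] ch(1)[OF gp] ch(2)[OF p] ch(2)[OF gp] g, of vs] p gp by (simp add: W_def)
  qed
  have W_form: "form_on k C_times_H W"
  proof (rule form_onI)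
    fix p assume p: "p \<in> C_times_H"
    have "W p = \<omega> (ch p) p" using p by (intro ext) (simp add: W_def)
    then show "alternating_multilinear k (W p)"
      using form_on_alternating[OF F[OF ch(1)[OF p]] ch(2)[OF p]] by simp
    show "length vs \<noteq> k \<Longrightarrow> W p vs = 0" for vs
      using form_on_length[OF F[OF ch(1)[OF p]]] p by (simp add: W_def)
  next
    fix vs
    show "smooth_fun_on C_times_H (\<lambda>p. W p vs)"
    proof (rule smooth_fun_on_local)
      fix p assume p: "p \<in> C_times_H"
      have "smooth_fun_on (chart_image (ch p)) (\<lambda>p. W p vs)"
        by (rule smooth_fun_on_cong[OF atlasD(1)[OF ch(1)[OF p]] _ form_on_smooth[OF F[OF ch(1)[OF p]]]])
          (simp add: W[OF ch(1)[OF p]])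
      then show "\<exists>T. open T \<and> p \<in> T \<and> smooth_fun_on T (\<lambda>p. W p vs)"
        using atlasD(1)[OF ch(1)[OF p]] ch(2)[OF p] by blast
    qed
  qed (simp add: W_def)
  define \<sigma> where "\<sigma> p vs = inverse (height p) * W p vs" for p vs
  have "\<sigma> \<in> equivariant_forms k"
  proof (rule equivariantI)
    show "\<sigma> \<in> periodic_forms k"
    proof (rule periodic_formsI)
      show "form_on k C_times_H \<sigma>"
        unfolding \<sigma>_def[abs_def]
        by (rule form_on_fun_mult[OF open_C_times_H W_form smooth_height_compose[OF smooth_fun_on_inverse]])
      fix i p vs assume p: "p \<in> C_times_H"
      have g: "inoue_translation a b i \<in> deck_group" by (rule generate.incl) auto
      have act: "acts_affinely 0 (generator i) (inoue_translation a b i)"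
        by (auto simp: acts_affinely_def lattice_l inoue_translation_eq)
      show "\<sigma> (p + generator i) vs = \<sigma> p vs"
        using W_deck[OF p g act, of vs] p by (simp add: \<sigma>_def inoue_translation_eq map_idI)
    qed
    fix p vs
    show "twist \<sigma> p vs = 0"
    proof (cases "p \<in> C_times_H")
      case True
      have g: "inoue_dilation \<alpha> \<beta> \<in> deck_group" by (rule generate.incl) auto
      have act: "acts_affinely 1 0 (inoue_dilation \<alpha> \<beta>)"
        by (auto simp: acts_affinely_def lattice_zero inoue_dilation_eq)
      show ?thesis
        using W_deck[OF True g act, of vs] True by (simp add: twist_def pull_def \<sigma>_def inoue_dilation_eq divide_inverse)
    qed (simp add: twist_def pull_def \<sigma>_def W_def)
  qed
  moreover have "\<omega> = descend \<sigma>"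
  proof (intro ext)
    fix c p vs
    show "\<omega> c p vs = descend \<sigma> c p vs"
    proof (cases "c \<in> atlas")
      case c: True
      show ?thesis
      proof (cases "p \<in> chart_image c")
        case True
        then have "height p > 0" using atlasD(2)[OF c] by (auto simp: mem_C_times_H)
        then show ?thesis using c True W[OF c True] by (simp add: descend_def \<sigma>_def)
      qed (simp add: descend_def form_on_outside[OF F[OF c]])
    next
      case False
      then have "\<omega> c = (\<lambda>x vs. 0)" using \<omega> unfolding mforms_def by blast
      then show ?thesis using False by (simp add: descend_def)
    qed
  qed
  ultimately show ?thesis by blast
qed

abbreviation "lee \<equiv> lee_form \<alpha> \<beta> a b"

text \<open>By the Leibniz rule \<open>d (t \<sigma>) = t d\<sigma> + dt \<and> \<sigma>\<close>, and the last term is the wedge product of the Lee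
  form \<open>dt / t\<close> with \<open>t \<sigma>\<close>.\<close>

lemma mn_deriv_descend:
  assumes \<sigma>: "\<sigma> \<in> periodic_forms k"
  shows "mn_deriv lee (descend \<sigma>) = descend (d_form \<sigma>)"
proof (intro ext)
  fix c p vs
  have f: "form_on k C_times_H \<sigma>" using \<sigma> by (rule periodic_form_on)
  have expand: "mn_deriv lee (descend \<sigma>) c p vs
      = ext_deriv (chart_image c) (descend \<sigma> c) p vs - wedge_one (lee c) (descend \<sigma> c) p vs"
    by (simp add: mn_deriv_def mform_diff_def mform_ext_deriv_def mform_wedge_one_def)
  show "mn_deriv lee (descend \<sigma>) c p vs = descend (d_form \<sigma>) c p vs"
  proof (cases "c \<in> atlas \<and> p \<in> chart_image c")
    case True
    then have c: "c \<in> atlas" and p: "p \<in> chart_image c" by auto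
    have pX: "p \<in> C_times_H" using atlasD(2)[OF c] p by blast
    have hp: "height p > 0" using pX by (simp add: mem_C_times_H)
    have "ext_deriv (chart_image c) (descend \<sigma> c) p vs
        = ext_deriv (chart_image c) (\<lambda>p vs. height p * \<sigma> p vs) p vs"
      by (rule arg_cong[where f="\<lambda>F. F p vs"], rule ext_deriv_cong[OF atlasD(1)[OF c]]) (simp add: descend_def c)
    also have "\<dots> = ext_deriv C_times_H (\<lambda>p vs. height p * \<sigma> p vs) p vs"
      using p pX by (simp add: ext_deriv_def)
    also have "\<dots> = height p * d_form \<sigma> p vs
        + (\<Sum>i<length vs. (-1) ^ i * height (vs ! i) * \<sigma> p (omit i vs))"
      using ext_deriv_fun_mult[OF f smooth_height pX, of vs] height_compose_derivative[OF DERIV_ident, of p] by simp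
    also have "(\<Sum>i<length vs. (-1) ^ i * height (vs ! i) * \<sigma> p (omit i vs)) = wedge_one (lee c) (descend \<sigma> c) p vs"
      using c p hp by (simp add: wedge_one_def lee_form_def descend_def mult.assoc flip: height_def)
    finally have e: "ext_deriv (chart_image c) (descend \<sigma> c) p vs
        = height p * d_form \<sigma> p vs + wedge_one (lee c) (descend \<sigma> c) p vs" .
    show ?thesis unfolding expand e using c p by (simp add: descend_def[of "d_form \<sigma>"])
  next
    case False
    have z: "ext_deriv (chart_image c) (descend \<sigma> c) p vs = 0"
    proof (cases "c \<in> atlas")
      case True
      then show ?thesis using False by (simp add: ext_deriv_def)
    next
      case c: False
      have "descend \<sigma> c = (\<lambda>p vs. 0)" by (intro ext) (simp add: descend_def c)
      then show ?thesis by (simp add: ext_deriv_def)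
    qed
    have "wedge_one (lee c) (descend \<sigma> c) p vs = 0"
    proof -
      have "descend \<sigma> c p ws = 0" for ws using False by (auto simp: descend_def)
      then show ?thesis by (simp add: wedge_one_def)
    qed
    then show ?thesis using False z by (auto simp: expand descend_def)
  qed
qed

lemma descend_injD:
  assumes eq: "descend \<sigma> = descend \<tau>" and p: "p \<in> C_times_H"
  shows "\<sigma> p vs = \<tau> p vs"
proof -
  obtain c where c: "c \<in> atlas" "p \<in> chart_image c" using charts_cover[OF p] by blast
  have "height p * \<sigma> p vs = height p * \<tau> p vs"
    using fun_cong[OF fun_cong[OF fun_cong[OF eq]], of c p vs] c by (simp add: descend_def)
  then show ?thesis using p by (simp add: mem_C_times_H)
qed

lemma descend_eq_iff:
  assumes "\<And>p vs. p \<notin> C_times_H \<Longrightarrow> \<sigma> p vs = 0" "\<And>p vs. p \<notin> C_times_H \<Longrightarrow> \<tau> p vs = 0"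
  shows "descend \<sigma> = descend \<tau> \<longleftrightarrow> \<sigma> = \<tau>"
proof
  assume eq: "descend \<sigma> = descend \<tau>"
  show "\<sigma> = \<tau>"
  proof (intro ext)
    fix p vs show "\<sigma> p vs = \<tau> p vs"
      using descend_injD[OF eq] assms by (cases "p \<in> C_times_H") auto
  qed
qed simp

lemma d_form_outside: "p \<notin> C_times_H \<Longrightarrow> d_form \<sigma> p vs = 0"
  by (simp add: ext_deriv_def)

lemma descend_zero: "descend (\<lambda>p vs. 0) = mform_zero"
  and descend_add: "mform_add (descend \<sigma>) (descend \<tau>) = descend (\<lambda>p vs. \<sigma> p vs + \<tau> p vs)"
  and descend_scale: "mform_scale r (descend \<sigma>) = descend (\<lambda>p vs. r * \<sigma> p vs)"
  and descend_diff: "mform_diff (descend \<sigma>) (descend \<tau>) = descend (\<lambda>p vs. \<sigma> p vs - \<tau> p vs)"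
  by (auto simp: fun_eq_iff descend_def mform_zero_def mform_add_def mform_scale_def mform_diff_def algebra_simps)

section \<open>Morse-Novikov cohomology\<close>

definition closed_equivariant :: "nat \<Rightarrow> (complex \<times> complex) form set" where
  "closed_equivariant k = {\<sigma> \<in> equivariant_forms k. d_form \<sigma> = (\<lambda>p vs. 0)}"

lemma d_form_zero_iff: "descend (d_form \<sigma>) = mform_zero \<longleftrightarrow> d_form \<sigma> = (\<lambda>p vs. 0)"
  unfolding descend_zero[symmetric] by (rule descend_eq_iff) (auto simp: d_form_outside)

lemma mn_cocycles_eq: "mn_cocycles atlas lee k = descend ` closed_equivariant k"
proof (intro subset_antisym subsetI)
  fix \<omega> assume \<omega>: "\<omega> \<in> mn_cocycles atlas lee k"
  then obtain \<sigma> where \<sigma>: "\<sigma> \<in> equivariant_forms k" "\<omega> = descend \<sigma>"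
    using mforms_descend by (auto simp: mn_cocycles_def)
  have "descend (d_form \<sigma>) = mform_zero"
    using \<omega> \<sigma> mn_deriv_descend[OF equivariant_periodic[OF \<sigma>(1)]] by (simp add: mn_cocycles_def)
  then show "\<omega> \<in> descend ` closed_equivariant k"
    using \<sigma> d_form_zero_iff by (auto simp: closed_equivariant_def)
next
  fix \<omega> assume "\<omega> \<in> descend ` closed_equivariant k"
  then obtain \<sigma> where \<sigma>: "\<sigma> \<in> equivariant_forms k" "d_form \<sigma> = (\<lambda>p vs. 0)" "\<omega> = descend \<sigma>"
    by (auto simp: closed_equivariant_def)
  then show "\<omega> \<in> mn_cocycles atlas lee k"
    using mn_deriv_descend[OF equivariant_periodic[OF \<sigma>(1)]] descend_mforms[OF \<sigma>(1)]
    by (simp add: mn_cocycles_def descend_zero)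
qed

lemma mn_coboundaries_eq: "mn_coboundaries atlas lee (Suc j) = descend ` d_form ` equivariant_forms j"
proof -
  have "mforms atlas j = descend ` equivariant_forms j"
    using mforms_descend descend_mforms by blast
  moreover have "mn_deriv lee (descend \<sigma>) = descend (d_form \<sigma>)" if "\<sigma> \<in> equivariant_forms j" for \<sigma>
    by (rule mn_deriv_descend[OF equivariant_periodic[OF that]])
  ultimately show ?thesis by (auto simp: mn_coboundaries_def image_iff)
qed

lemma equivariant_add:
  assumes "\<sigma> \<in> equivariant_forms k" "\<tau> \<in> equivariant_forms k"
  shows "(\<lambda>p vs. \<sigma> p vs + \<tau> p vs) \<in> equivariant_forms k"
  by (rule equivariantI)
    (simp_all add: periodic_forms_add equivariant_periodic assms twist_add equivariant_twist[OF assms(1)] equivariant_twist[OF assms(2)])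

lemma equivariant_scale:
  assumes "\<sigma> \<in> equivariant_forms k"
  shows "(\<lambda>p vs. r * \<sigma> p vs) \<in> equivariant_forms k"
  by (rule equivariantI)
    (simp_all add: periodic_forms_scale equivariant_periodic assms twist_scale equivariant_twist[OF assms])

lemma closed_equivariant_add:
  assumes "\<sigma> \<in> closed_equivariant k" "\<tau> \<in> closed_equivariant k"
  shows "(\<lambda>p vs. \<sigma> p vs + \<tau> p vs) \<in> closed_equivariant k"
  using assms equivariant_add d_form_add[OF equivariant_periodic equivariant_periodic]
  by (auto simp: closed_equivariant_def fun_eq_iff)

lemma closed_equivariant_scale:
  assumes "\<sigma> \<in> closed_equivariant k"
  shows "(\<lambda>p vs. r * \<sigma> p vs) \<in> closed_equivariant k"
  using assms equivariant_scale ext_deriv_scale[OF periodic_form_on[OF equivariant_periodic]]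
  by (auto simp: closed_equivariant_def fun_eq_iff)

lemma equivariant_zero: "(\<lambda>p vs. 0) \<in> equivariant_forms k"
  by (rule equivariantI) (auto simp: periodic_forms_zero twist_def pull_def)

lemma mn_cohomology_1: "mn_cohomology atlas lee 1 = {mn_class atlas lee 1 mform_zero}"
proof -
  let ?Z = "mn_cocycles atlas lee 1"
  have class_eq: "mn_rel atlas lee 1 `` {\<omega>} = ?Z" if "\<omega> \<in> ?Z" for \<omega>
  proof -
    have "mform_diff \<omega> \<tau> \<in> mn_coboundaries atlas lee 1" if \<tau>: "\<tau> \<in> ?Z" for \<tau>
    proof -
      obtain x y where xy: "x \<in> closed_equivariant 1" "y \<in> closed_equivariant 1" "\<omega> = descend x" "\<tau> = descend y"
        using \<open>\<omega> \<in> ?Z\<close> \<tau> by (auto simp: mn_cocycles_eq)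
      let ?d = "\<lambda>p vs. x p vs + (- 1) * y p vs"
      have "?d \<in> closed_equivariant 1"
        by (rule closed_equivariant_add[OF xy(1) closed_equivariant_scale[OF xy(2)]])
      then obtain \<eta> where "\<eta> \<in> equivariant_forms 0" "?d = d_form \<eta>"
        using equivariant_closed_1_exact unfolding closed_equivariant_def by blast
      then show ?thesis
        using mn_coboundaries_eq[of 0] by (auto simp: xy(3,4) descend_diff)
    qed
    then show ?thesis using that by (auto simp: mn_rel_def)
  qed
  have "mform_zero \<in> ?Z"
    unfolding mn_cocycles_eq descend_zero[symmetric] closed_equivariant_def
    using equivariant_zero by (intro image_eqI[OF refl]) (auto simp: ext_deriv_def fun_eq_iff)
  then show ?thesis
    unfolding mn_cohomology_def mn_class_def quotient_def using class_eq by auto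
qed

text \<open>If \<open>\<tau>\<close> spans the closed forms modulo exact ones and no nonzero multiple of it is exact, the
  coefficient of \<open>\<tau>\<close> is a linear functional on closed forms with the exact forms as its kernel, and
  it induces the isomorphism.\<close>

lemma mn_linear_iso_of_generator:
  assumes \<tau>: "\<tau> \<in> closed_equivariant (Suc k)"
    and span: "\<And>\<sigma>. \<sigma> \<in> closed_equivariant (Suc k) \<Longrightarrow>
      \<exists>r. \<exists>\<eta>\<in>equivariant_forms k. \<forall>p vs. \<sigma> p vs - r * \<tau> p vs = d_form \<eta> p vs"
    and nontrivial: "\<And>r \<eta>. \<eta> \<in> equivariant_forms k \<Longrightarrow> (\<And>p vs. r * \<tau> p vs = d_form \<eta> p vs) \<Longrightarrow> r = 0"
  shows "\<exists>f :: _ \<Rightarrow> real. mn_linear_iso atlas lee (Suc k) f"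
proof -
  let ?Z = "closed_equivariant (Suc k)" and ?R = "mn_rel atlas lee (Suc k)"
  define is_coef where "is_coef \<sigma> r \<longleftrightarrow> (\<exists>\<eta>\<in>equivariant_forms k. \<forall>p vs. \<sigma> p vs - r * \<tau> p vs = d_form \<eta> p vs)" for \<sigma> r
  have lincomb: "(\<lambda>p vs. \<eta> p vs + s * \<zeta> p vs) \<in> equivariant_forms k"
    "d_form (\<lambda>p vs. \<eta> p vs + s * \<zeta> p vs) p vs = d_form \<eta> p vs + s * d_form \<zeta> p vs"
    if "\<eta> \<in> equivariant_forms k" "\<zeta> \<in> equivariant_forms k" for \<eta> \<zeta> s p vs
    using that equivariant_add equivariant_scale
      d_form_add[OF equivariant_periodic[OF that(1)] periodic_forms_scale[OF equivariant_periodic[OF that(2)]]]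
      ext_deriv_scale[OF periodic_form_on[OF equivariant_periodic[OF that(2)]]]
    by auto
  have comb: "is_coef (\<lambda>p vs. \<sigma> p vs + s * \<rho> p vs) (r + s * t)" if "is_coef \<sigma> r" "is_coef \<rho> t" for \<sigma> \<rho> r s t
  proof -
    obtain \<eta> \<zeta> where \<eta>: "\<eta> \<in> equivariant_forms k" "\<forall>p vs. \<sigma> p vs - r * \<tau> p vs = d_form \<eta> p vs"
      and \<zeta>: "\<zeta> \<in> equivariant_forms k" "\<forall>p vs. \<rho> p vs - t * \<tau> p vs = d_form \<zeta> p vs"
      using \<open>is_coef \<sigma> r\<close> \<open>is_coef \<rho> t\<close> unfolding is_coef_def by blast
    have "\<sigma> p vs + s * \<rho> p vs - (r + s * t) * \<tau> p vs = d_form (\<lambda>p vs. \<eta> p vs + s * \<zeta> p vs) p vs" for p vs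
      unfolding lincomb(2)[OF \<eta>(1) \<zeta>(1)] \<eta>(2)[rule_format, symmetric] \<zeta>(2)[rule_format, symmetric]
      by (simp add: algebra_simps)
    then show ?thesis unfolding is_coef_def using lincomb(1)[OF \<eta>(1) \<zeta>(1)] by blast
  qed
  have exact: "is_coef \<sigma> 0 \<longleftrightarrow> (\<exists>\<eta>\<in>equivariant_forms k. \<sigma> = d_form \<eta>)" for \<sigma>
    by (auto simp: is_coef_def fun_eq_iff)
  have unique: "r = t" if "is_coef \<sigma> r" "is_coef \<sigma> t" for \<sigma> r t
  proof -
    have "is_coef (\<lambda>p vs. 0) (r - t)" using comb[OF that, of "-1"] by simp
    then obtain \<eta> where \<eta>: "\<eta> \<in> equivariant_forms k" "\<And>p vs. (t - r) * \<tau> p vs = d_form \<eta> p vs"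
      unfolding is_coef_def by (auto simp: algebra_simps)
    then have "t - r = 0" by (rule nontrivial)
    then show ?thesis by simp
  qed
  define coef where "coef \<sigma> = (THE r. is_coef \<sigma> r)" for \<sigma>
  have coef_eq: "coef \<sigma> = r" if "is_coef \<sigma> r" for \<sigma> r
    unfolding coef_def using that unique[OF _ that] by (rule the_equality)
  have coef: "is_coef \<sigma> (coef \<sigma>)" if Z: "\<sigma> \<in> ?Z" for \<sigma>
  proof -
    obtain r where "is_coef \<sigma> r" using span[OF Z] unfolding is_coef_def by blast
    then show ?thesis using coef_eq by simp
  qed
  have Zform: "form_on (Suc k) C_times_H \<sigma>" if "\<sigma> \<in> ?Z" for \<sigma>
    using that periodic_form_on[OF equivariant_periodic] by (auto simp: closed_equivariant_def)
  have rel: "(descend \<sigma>, descend \<rho>) \<in> ?R \<longleftrightarrow> coef \<sigma> = coef \<rho>" if "\<sigma> \<in> ?Z" "\<rho> \<in> ?Z" for \<sigma> \<rho>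
  proof -
    let ?d = "\<lambda>p vs. \<sigma> p vs + (- 1) * \<rho> p vs"
    have dZ: "?d \<in> ?Z" by (rule closed_equivariant_add[OF that(1) closed_equivariant_scale[OF that(2)]])
    have c: "is_coef ?d (coef \<sigma> + (- 1) * coef \<rho>)" by (rule comb[OF coef coef]) (use that in auto)
    have "(descend \<sigma>, descend \<rho>) \<in> ?R \<longleftrightarrow> descend ?d \<in> descend ` d_form ` equivariant_forms k"
      using that by (auto simp: mn_rel_def mn_cocycles_eq descend_diff mn_coboundaries_eq)
    also have "\<dots> \<longleftrightarrow> (\<exists>\<eta>\<in>equivariant_forms k. ?d = d_form \<eta>)"
      unfolding image_image image_iff
      using descend_eq_iff[OF form_on_outside[OF Zform[OF dZ]] d_form_outside] by simp
    also have "\<dots> \<longleftrightarrow> is_coef ?d 0" by (rule exact[symmetric])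
    also have "\<dots> \<longleftrightarrow> coef \<sigma> = coef \<rho>" using c unique[OF c, of 0] by auto
    finally show ?thesis .
  qed
  \<comment> \<open>The functional transported to forms on the surface, and then to classes by choosing representatives.\<close>
  define L where "L \<omega> = coef (SOME \<sigma>. \<sigma> \<in> ?Z \<and> descend \<sigma> = \<omega>)" for \<omega>
  have L: "L (descend \<sigma>) = coef \<sigma>" if "\<sigma> \<in> ?Z" for \<sigma>
  proof -
    have "(SOME \<rho>. \<rho> \<in> ?Z \<and> descend \<rho> = descend \<sigma>) = \<sigma>"
    proof (rule some_equality)
      fix \<rho> assume \<rho>: "\<rho> \<in> ?Z \<and> descend \<rho> = descend \<sigma>"
      have "\<rho> p vs = 0" "\<sigma> p vs = 0" if "p \<notin> C_times_H" for p vs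
        using form_on_outside[OF Zform that] \<rho> \<open>\<sigma> \<in> ?Z\<close> by auto
      then show "\<rho> = \<sigma>" using descend_eq_iff[of \<rho> \<sigma>] \<rho> by blast
    qed (use that in blast)
    then show ?thesis by (simp add: L_def)
  qed
  define f where "f C = L (SOME \<omega>. \<omega> \<in> C)" for C
  have class_iff: "\<omega> \<in> mn_class atlas lee (Suc k) (descend \<sigma>) \<longleftrightarrow> (\<exists>\<rho>\<in>?Z. \<omega> = descend \<rho> \<and> coef \<sigma> = coef \<rho>)"
    if "\<sigma> \<in> ?Z" for \<omega> \<sigma>
  proof -
    have "\<omega> \<in> mn_class atlas lee (Suc k) (descend \<sigma>) \<Longrightarrow> \<omega> \<in> descend ` ?Z"
      by (auto simp: mn_class_def mn_rel_def mn_cocycles_eq)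
    then show ?thesis using rel[OF that] by (auto simp: mn_class_def)
  qed
  have f: "f (mn_class atlas lee (Suc k) (descend \<sigma>)) = coef \<sigma>" if "\<sigma> \<in> ?Z" for \<sigma>
  proof -
    have "descend \<sigma> \<in> mn_class atlas lee (Suc k) (descend \<sigma>)" using class_iff[OF that] that by blast
    then have "(SOME \<omega>. \<omega> \<in> mn_class atlas lee (Suc k) (descend \<sigma>)) \<in> mn_class atlas lee (Suc k) (descend \<sigma>)"
      by (rule someI[where P="\<lambda>\<omega>. \<omega> \<in> mn_class atlas lee (Suc k) (descend \<sigma>)"])
    then show ?thesis using class_iff[OF that] L unfolding f_def by auto
  qed
  have coh: "mn_cohomology atlas lee (Suc k) = (\<lambda>\<sigma>. mn_class atlas lee (Suc k) (descend \<sigma>)) ` ?Z"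
    by (auto simp: mn_cohomology_def quotient_def mn_class_def mn_cocycles_eq)
  have "mn_linear_iso atlas lee (Suc k) f"
    unfolding mn_linear_iso_def
  proof (intro conjI ballI allI)
    show "bij_betw f (mn_cohomology atlas lee (Suc k)) UNIV"
    proof (rule bij_betw_imageI)
      show "inj_on f (mn_cohomology atlas lee (Suc k))"
        unfolding coh by (rule inj_onI) (auto simp: f class_iff)
      have "r \<in> f ` mn_cohomology atlas lee (Suc k)" for r
      proof -
        have Z: "(\<lambda>p vs. r * \<tau> p vs) \<in> ?Z" by (rule closed_equivariant_scale[OF \<tau>])
        have "is_coef (\<lambda>p vs. r * \<tau> p vs) r"
          unfolding is_coef_def using equivariant_zero by (intro bexI[of _ "\<lambda>p vs. 0"]) (auto simp: ext_deriv_def)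
        then have "f (mn_class atlas lee (Suc k) (descend (\<lambda>p vs. r * \<tau> p vs))) = r"
          using f[OF Z] coef_eq by simp
        then show ?thesis unfolding coh using Z by (auto simp: image_iff intro: bexI[OF _ Z])
      qed
      then show "f ` mn_cohomology atlas lee (Suc k) = UNIV" by blast
    qed
  next
    fix \<omega> \<rho> assume "\<omega> \<in> mn_cocycles atlas lee (Suc k)" "\<rho> \<in> mn_cocycles atlas lee (Suc k)"
    then obtain x y where xy: "x \<in> ?Z" "y \<in> ?Z" "\<omega> = descend x" "\<rho> = descend y" by (auto simp: mn_cocycles_eq)
    have "coef (\<lambda>p vs. x p vs + y p vs) = coef x + coef y"
      using coef_eq[OF comb[OF coef[OF xy(1)] coef[OF xy(2)], of 1]] by simp
    then show "f (mn_class atlas lee (Suc k) (mform_add \<omega> \<rho>)) =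
        f (mn_class atlas lee (Suc k) \<omega>) + f (mn_class atlas lee (Suc k) \<rho>)"
      using f[OF xy(1)] f[OF xy(2)] f[OF closed_equivariant_add[OF xy(1,2)]] by (simp add: xy(3,4) descend_add)
  next
    fix r \<omega> assume "\<omega> \<in> mn_cocycles atlas lee (Suc k)"
    then obtain x where x: "x \<in> ?Z" "\<omega> = descend x" by (auto simp: mn_cocycles_eq)
    have "is_coef (\<lambda>p vs. 0) 0"
      unfolding is_coef_def using equivariant_zero by (intro bexI[of _ "\<lambda>p vs. 0"]) (auto simp: ext_deriv_def)
    from comb[OF this coef[OF x(1)], of r] have "coef (\<lambda>p vs. r * x p vs) = r * coef x"
      using coef_eq by simp
    then show "f (mn_class atlas lee (Suc k) (mform_scale r \<omega>)) = r *\<^sub>R f (mn_class atlas lee (Suc k) \<omega>)"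
      using f[OF x(1)] f[OF closed_equivariant_scale[OF x(1)]] by (simp add: x(2) descend_scale)
  qed
  then show ?thesis by blast
qed

lemma mn_cohomology_2: "\<exists>f :: _ \<Rightarrow> real. mn_linear_iso atlas lee 2 f"
proof -
  have "\<exists>f :: _ \<Rightarrow> real. mn_linear_iso atlas lee (Suc 1) f"
  proof (rule mn_linear_iso_of_generator[of area_form])
    show "area_form \<in> closed_equivariant (Suc 1)"
      using area_form_equivariant area_form_closed by (simp add: closed_equivariant_def numeral_2_eq_2)
    show "\<exists>r. \<exists>\<eta>\<in>equivariant_forms 1. \<forall>p vs. \<sigma> p vs - r * area_form p vs = d_form \<eta> p vs"
      if "\<sigma> \<in> closed_equivariant (Suc 1)" for \<sigma>
      using that equivariant_closed_2_cohomologous[of \<sigma>] by (simp add: closed_equivariant_def numeral_2_eq_2)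
    show "r = 0" if "\<eta> \<in> equivariant_forms 1" "\<And>p vs. r * area_form p vs = d_form \<eta> p vs" for r \<eta>
      using area_form_not_exact[OF equivariant_periodic[OF that(1)] that(2)] .
  qed
  then show ?thesis by (simp add: numeral_2_eq_2)
qed

lemma mn_cohomology_3: "\<exists>f :: _ \<Rightarrow> real. mn_linear_iso atlas lee 3 f"
proof -
  have "\<exists>f :: _ \<Rightarrow> real. mn_linear_iso atlas lee (Suc 2) f"
  proof (rule mn_linear_iso_of_generator[of volume_form])
    show "volume_form \<in> closed_equivariant (Suc 2)"
      using volume_form_equivariant volume_form_closed by (simp add: closed_equivariant_def eval_nat_numeral)
    show "\<exists>r. \<exists>\<eta>\<in>equivariant_forms 2. \<forall>p vs. \<sigma> p vs - r * volume_form p vs = d_form \<eta> p vs"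
      if "\<sigma> \<in> closed_equivariant (Suc 2)" for \<sigma>
      using that equivariant_closed_3_cohomologous[of \<sigma>] by (simp add: closed_equivariant_def eval_nat_numeral)
    show "r = 0" if "\<eta> \<in> equivariant_forms 2" "\<And>p vs. r * volume_form p vs = d_form \<eta> p vs" for r \<eta>
      using volume_form_not_exact[OF that] .
  qed
  then show ?thesis by (simp add: eval_nat_numeral)
qed

end

theorem theorem3p2:
  fixes A :: "int^3^3" and \<alpha> :: real and \<beta> :: complex and a :: "real^3" and b :: "complex^3"
  assumes "inoue_data A \<alpha> \<beta> a b"
  defines "At \<equiv> inoue_atlas \<alpha> \<beta> a b"
    and "\<theta> \<equiv> lee_form \<alpha> \<beta> a b"
  shows "mn_cohomology At \<theta> 1 = {mn_class At \<theta> 1 mform_zero}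
    \<and> (\<exists>f :: _ \<Rightarrow> real. mn_linear_iso At \<theta> 2 f)
    \<and> (\<exists>f :: _ \<Rightarrow> real. mn_linear_iso At \<theta> 3 f)"
proof -
  interpret inoue_setting A \<alpha> \<beta> a b by unfold_locales (rule assms(1))
  show ?thesis
    unfolding At_def \<theta>_def using mn_cohomology_1 mn_cohomology_2 mn_cohomology_3 by blast
qed

end
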